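(* Let $k\ge 3$ and $n>2k$ be integers, let $X$ be a set with $|X|=n$, and let $\mathcal{H}\subseteq\binom{X}{k}$ be an intersecting family. Assume that $\mathcal{H}\nsubseteq_S \mathcal{F}_0$, that $\mathcal{H}\nsubseteq_S \mathcal{F}_1$, and, if $k=3$, that $\mathcal{H}\nsubseteq_S \mathcal{G}_2$. Then \[ |\mathcal{H}|\le \binom{n-1}{k-1}-\binom{n-k-1}{k-1}-\binom{n-k-2}{k-2}+2 . \] Moreover, for $k=4$ equality holds if and only if $\mathcal{H}$ is isomorphic to $\mathcal{J}_2$, $\mathcal{G}_2$ or $\mathcal{G}_3$; for every other $k\ge 3$, equality holds if and only if $\mathcal{H}$ is isomorphic to $\mathcal{J}_2$.
   Context: A family $\mathcal{F}$ of sets is intersecting if $F_1\cap F_2\neq\emptyset$ for all $F_1,F_2\in\mathcal{F}$; $\binom{X}{k}$ denotes the set of all $k$-element subsets of $X$. For families $\mathcal{H}\subseteq 2^X$, $\mathcal{G}\subseteq 2^Y$, write $\mathcal{H}\subseteq_S\mathcal{G}$ if there is an injective map $f:X\to Y$ with $f(E)\in\mathcal{G}$ for all $E\in\mathcal{H}$; $\mathcal{H}$ and $\mathcal{G}$ are isomorphic if $\mathcal{H}\subseteq_S\mathcal{G}$ and $\mathcal{G}\subseteq_S\mathcal{H}$. All families below are $k$-uniform families on $X$. $\mathcal{F}_0$: any family isomorphic to $\{F\in\binom{X}{k}: x\in F\}$ for some $x\in X$. $\mathcal{F}_1$: any family isomorphic to $\{F\}\cup\{G\in\binom{X}{k}: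 x\in G,\ G\cap F\neq\emptyset\}$ for some $k$-set $F\subseteq X$ and $x\in X\setminus F$. $\mathcal{G}_i$ ($2\le i\le k$): any family isomorphic to $\mathcal{G}(E,x_0)=\{G\in\binom{X}{k}: E\subseteq G\}\cup\{G\in\binom{X}{k}: x_0\in G,\ G\cap E\neq\emptyset\}$, where $E\subseteq X$ is an $i$-set and $x_0\in X\setminus E$. (So $\mathcal{G}_2$ is isomorphic to $\{F\in\binom{X}{k}:|F\cap S|\ge 2\}$ for a 3-set $S$.) $\mathcal{J}_i$ ($1\le i\le k-1$): any family isomorphic to $\mathcal{J}(E,J,x_0)=\{G\in\binom{X}{k}: E\subseteq G,\ G\cap J\neq\emptyset\}\cup\{G\in\binom{X}{k}: J\subseteq G\}\cup\{G\in\binom{X}{k}: x_0\in G,\ G\cap E\neq\emptyset\}$, where $E\subseteq X$ is a $(k-1)$-set, $J\subseteq X\setminus E$ is an $(i+1)$-set and $x_0\in J$. *)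

theory Defs
  imports Main
begin

definition ksets :: "'a set \<Rightarrow> nat \<Rightarrow> 'a set set" where
  "ksets X k = {F. F \<subseteq> X \<and> card F = k}"

definition intersecting :: "'a set set \<Rightarrow> bool" where
  "intersecting \<F> \<longleftrightarrow> (\<forall>F1\<in>\<F>. \<forall>F2\<in>\<F>. F1 \<inter> F2 \<noteq> {})"

definition subS :: "'a set \<Rightarrow> 'a set set \<Rightarrow> 'b set \<Rightarrow> 'b set set \<Rightarrow> bool" where
  "subS X H Y G \<longleftrightarrow> (\<exists>f. inj_on f X \<and> f ` X \<subseteq> Y \<and> (\<forall>E\<in>H. f ` E \<in> G))"

definition iso_fam :: "'a set \<Rightarrow> 'a set set \<Rightarrow> 'b set \<Rightarrow> 'b set set \<Rightarrow> bool" where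
  "iso_fam X H Y G \<longleftrightarrow> subS X H Y G \<and> subS Y G X H"

definition star :: "'a set \<Rightarrow> nat \<Rightarrow> 'a \<Rightarrow> 'a set set" where
  "star X k x = {F \<in> ksets X k. x \<in> F}"

definition F1fam :: "'a set \<Rightarrow> nat \<Rightarrow> 'a set \<Rightarrow> 'a \<Rightarrow> 'a set set" where
  "F1fam X k F x = {F} \<union> {G \<in> ksets X k. x \<in> G \<and> G \<inter> F \<noteq> {}}"

definition Gfam :: "'a set \<Rightarrow> nat \<Rightarrow> 'a set \<Rightarrow> 'a \<Rightarrow> 'a set set" where
  "Gfam X k E x0 = {G \<in> ksets X k. E \<subseteq> G} \<union> {G \<in> ksets X k. x0 \<in> G \<and> G \<inter> E \<noteq> {}}"

definition Jfam :: "'a set \<Rightarrow> nat \<Rightarrow> 'a set \<Rightarrow> 'a set \<Rightarrow> 'a \<Rightarrow> 'a set set" where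
  "Jfam X k E J x0 = {G \<in> ksets X k. E \<subseteq> G \<and> G \<inter> J \<noteq> {}}
      \<union> {G \<in> ksets X k. J \<subseteq> G}
      \<union> {G \<in> ksets X k. x0 \<in> G \<and> G \<inter> E \<noteq> {}}"

definition is_F0 :: "'a set \<Rightarrow> nat \<Rightarrow> 'a set set \<Rightarrow> bool" where
  "is_F0 X k \<G> \<longleftrightarrow> (\<exists>x\<in>X. iso_fam X \<G> X (star X k x))"

definition is_F1 :: "'a set \<Rightarrow> nat \<Rightarrow> 'a set set \<Rightarrow> bool" where
  "is_F1 X k \<G> \<longleftrightarrow> (\<exists>F x. F \<in> ksets X k \<and> x \<in> X - F \<and> iso_fam X \<G> X (F1fam X k F x))"

definition is_G :: "'a set \<Rightarrow> nat \<Rightarrow> nat \<Rightarrow> 'a set set \<Rightarrow> bool" where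
  "is_G X k i \<G> \<longleftrightarrow> (\<exists>E x0. E \<subseteq> X \<and> card E = i \<and> x0 \<in> X - E \<and> iso_fam X \<G> X (Gfam X k E x0))"

definition is_J :: "'a set \<Rightarrow> nat \<Rightarrow> nat \<Rightarrow> 'a set set \<Rightarrow> bool" where
  "is_J X k i \<G> \<longleftrightarrow> (\<exists>E J x0. E \<subseteq> X \<and> card E = k - 1 \<and> J \<subseteq> X - E \<and> card J = i + 1
       \<and> x0 \<in> J \<and> iso_fam X \<G> X (Jfam X k E J x0))"

end

theory Submission
  imports Defs
begin

text \<open>
  Suppose two points \<open>x\<close>, \<open>y\<close> cover \<open>H\<close>. At most \<open>(n - 2) choose (k - 2)\<close> members contain both, and
  the members containing exactly one of them form a cross-intersecting pair of families of
  \<open>(k - 1)\<close>-sets on \<open>n - 2\<close> points, each with at least two members since \<open>H\<close> lies neither in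
  \<open>F\<^sub>0\<close> nor in \<open>F\<^sub>1\<close>. Such pairs are bounded by compressing both families: for shifted
  families of \<open>l\<close>-sets all intersections are witnessed among the first \<open>2l\<close> points, so one
  compares traces on these points. The extremal pairs are then recovered by undoing single
  compressions.

  If \<open>H\<close> has no two-element cover, the inequality is strict. For shifted \<open>H\<close> the members avoiding
  the first two points are 3-intersecting, hence by Katona's shadow argument at most as numerous
  as the \<open>(k - 2)\<close>-sets they forbid in the common link of these points. Otherwise compress; if a
  compression at \<open>i\<close>, \<open>j\<close> creates a two-element cover, then the two links of \<open>H\<close> at \<open>i\<close> and \<open>j\<close> are
  almost disjoint and cross-intersecting, which makes \<open>H\<close> too small.
\<close>

section \<open>Counting sets by their traces\<close>

text \<open>Compression preserves sizes and cross-intersection, but neither the absence of a common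
  point nor the absence of a two-element cover, and this dictates the case division. A pair of links
  with one family of size two is settled directly. If both families have at least three members,
  that condition survives compression, and for \<open>l \<ge> 3\<close> equality leaves only the
  sporadic pairs at \<open>l = 3\<close>. For \<open>l = 2\<close> two stars with the same centre
  would exceed the bound, so the links are treated as graphs without compressing. The bound is
  \<open>(n - 2) choose (k - 2)\<close>, for members through both points of a cover, plus the
  extremal size of two links with \<open>l = k - 1\<close> on \<open>n - 2\<close> points. Without a
  cover, the members avoiding the first two points are paid for out of the first summand, while the
  shadow of a single such member already makes both links too rich to be extremal. A compression
  that creates a cover is harmless unless its result attains the bound or has a single member
  outside a star; these two situations need the analysis of the links at \<open>i\<close> and
  \<open>j\<close>.\<close>

lemma finite_ksets: "finite V \<Longrightarrow> finite (ksets V k)"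
  unfolding ksets_def by simp

lemma ksets_finite_mem: "finite V \<Longrightarrow> F \<in> ksets V k \<Longrightarrow> finite F"
  unfolding ksets_def by (auto intro: finite_subset)

lemma card_ksets: "finite V \<Longrightarrow> card (ksets V k) = card V choose k"
  unfolding ksets_def by (rule n_subsets)

lemma card_ksets_disjoint:
  assumes "finite V" "P \<subseteq> V"
  shows "card {F \<in> ksets V k. F \<inter> P = {}} = (card V - card P) choose k"
proof -
  have "{F \<in> ksets V k. F \<inter> P = {}} = ksets (V - P) k"
    unfolding ksets_def by auto
  then show ?thesis
    using assms by (simp add: card_ksets card_Diff_subset finite_subset)
qed

lemma card_ksets_meet:
  assumes "finite V" "P \<subseteq> V"
  shows "card {F \<in> ksets V k. F \<inter> P \<noteq> {}} + ((card V - card P) choose k) = card V choose k"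
proof -
  have "ksets V k = {F \<in> ksets V k. F \<inter> P \<noteq> {}} \<union> {F \<in> ksets V k. F \<inter> P = {}}"
    by auto
  then have "card (ksets V k)
      = card {F \<in> ksets V k. F \<inter> P \<noteq> {}} + card {F \<in> ksets V k. F \<inter> P = {}}"
    by (metis (no_types, lifting) assms(1) card_Un_disjoint disjoint_iff finite_Un finite_ksets
        mem_Collect_eq)
  then show ?thesis
    using assms by (simp add: card_ksets card_ksets_disjoint)
qed

lemma card_ksets_meet_both:
  assumes "finite V" "P \<subseteq> V" "Q \<subseteq> V"
  shows "card {F \<in> ksets V k. F \<inter> P \<noteq> {} \<and> F \<inter> Q \<noteq> {}}
      + ((card V - card P) choose k) + ((card V - card Q) choose k)
    = (card V choose k) + ((card V - card (P \<union> Q)) choose k)"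
proof -
  let ?p = "{F \<in> ksets V k. F \<inter> P = {}}" and ?q = "{F \<in> ksets V k. F \<inter> Q = {}}"
  let ?m = "{F \<in> ksets V k. F \<inter> P \<noteq> {} \<and> F \<inter> Q \<noteq> {}}"
  have fin: "finite (ksets V k)" using assms(1) by (rule finite_ksets)
  have "ksets V k = ?m \<union> (?p \<union> ?q)" "?m \<inter> (?p \<union> ?q) = {}" by auto
  then have 1: "card (ksets V k) = card ?m + card (?p \<union> ?q)"
    by (metis (no_types, lifting) card_Un_disjoint fin finite_Un)
  have "?p \<inter> ?q = {F \<in> ksets V k. F \<inter> (P \<union> Q) = {}}" by auto
  moreover have "card ?p + card ?q = card (?p \<union> ?q) + card (?p \<inter> ?q)"
    using fin by (intro card_Un_Int) auto
  ultimately show ?thesis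
    using 1 assms by (simp add: card_ksets card_ksets_disjoint)
qed

lemma card_ksets_trace:
  assumes "finite V" "Y \<subseteq> V" "S \<subseteq> ksets Y i" "i \<le> l"
  shows "card {F \<in> ksets V l. F \<inter> Y \<in> S} = card S * ((card V - card Y) choose (l - i))"
proof -
  have fY: "finite Y" using assms finite_subset by blast
  have "bij_betw (\<lambda>(G, R). G \<union> R) (S \<times> ksets (V - Y) (l - i)) {F \<in> ksets V l. F \<inter> Y \<in> S}"
  proof (rule bij_betw_byWitness[where f' = "\<lambda>F. (F \<inter> Y, F - Y)"])
    show "\<forall>a\<in>S \<times> ksets (V - Y) (l - i).
        (\<lambda>F. (F \<inter> Y, F - Y)) (case a of (G, R) \<Rightarrow> G \<union> R) = a"
      using assms(3) unfolding ksets_def by auto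
    show "\<forall>F\<in>{F \<in> ksets V l. F \<inter> Y \<in> S}. (case (F \<inter> Y, F - Y) of (G, R) \<Rightarrow> G \<union> R) = F"
      by auto
    show "(\<lambda>(G, R). G \<union> R) ` (S \<times> ksets (V - Y) (l - i)) \<subseteq> {F \<in> ksets V l. F \<inter> Y \<in> S}"
    proof clarify
      fix G R assume GR: "G \<in> S" "R \<in> ksets (V - Y) (l - i)"
      then have G: "G \<subseteq> Y" "card G = i" and R: "R \<subseteq> V - Y" "card R = l - i"
        using assms(3) unfolding ksets_def by auto
      have "card (G \<union> R) = card G + card R"
        using G R fY assms(1) by (intro card_Un_disjoint) (auto intro: finite_subset)
      moreover have "(G \<union> R) \<inter> Y = G" using G R by auto
      ultimately show "G \<union> R \<in> ksets V l \<and> (G \<union> R) \<inter> Y \<in> S"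
        using G R GR assms(2,4) unfolding ksets_def by auto
    qed
    show "(\<lambda>F. (F \<inter> Y, F - Y)) ` {F \<in> ksets V l. F \<inter> Y \<in> S} \<subseteq> S \<times> ksets (V - Y) (l - i)"
    proof clarify
      fix F assume F: "F \<in> ksets V l" "F \<inter> Y \<in> S"
      then have "card (F \<inter> Y) = i" using assms(3) unfolding ksets_def by auto
      moreover have "finite F" using F assms(1) unfolding ksets_def by (auto intro: finite_subset)
      ultimately have "card (F - Y) = l - i"
        using F(1) card_Diff_subset_Int[of F Y] unfolding ksets_def by auto
      then show "F - Y \<in> ksets (V - Y) (l - i)"
        using F unfolding ksets_def by auto
    qed
  qed
  then have "card {F \<in> ksets V l. F \<inter> Y \<in> S} = card (S \<times> ksets (V - Y) (l - i))"
    by (simp add: bij_betw_same_card)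
  also have "\<dots> = card S * ((card V - card Y) choose (l - i))"
    using assms fY by (simp add: card_cartesian_product card_ksets card_Diff_subset)
  finally show ?thesis .
qed

lemma card_ksets_trace_sum:
  assumes "finite V" "Y \<subseteq> V"
  shows "card {F \<in> ksets V l. R (F \<inter> Y)}
    = (\<Sum>i\<le>l. card {G \<in> ksets Y i. R G} * ((card V - card Y) choose (l - i)))"
proof -
  let ?T = "\<lambda>i. {F \<in> ksets V l. F \<inter> Y \<in> {G \<in> ksets Y i. R G}}"
  have fV: "finite (ksets V l)" using assms(1) by (rule finite_ksets)
  have "{F \<in> ksets V l. R (F \<inter> Y)} = (\<Union>i\<in>{..l}. ?T i)"
  proof (intro equalityI subsetI)
    fix F assume F: "F \<in> {F \<in> ksets V l. R (F \<inter> Y)}"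
    then have "finite F" using assms(1) unfolding ksets_def by (auto intro: finite_subset)
    then have "card (F \<inter> Y) \<le> card F" by (intro card_mono) auto
    then show "F \<in> (\<Union>i\<in>{..l}. ?T i)"
      using F unfolding ksets_def by auto
  qed auto
  then have "card {F \<in> ksets V l. R (F \<inter> Y)} = card (\<Union>i\<in>{..l}. ?T i)" by simp
  also have "\<dots> = (\<Sum>i\<le>l. card (?T i))"
  proof (intro card_UN_disjoint)
    show "\<forall>i\<in>{..l}. finite (?T i)" using fV by auto
  qed (auto simp: ksets_def)
  also have "\<dots> = (\<Sum>i\<le>l. card {G \<in> ksets Y i. R G} * ((card V - card Y) choose (l - i)))"
    using assms by (intro sum.cong refl card_ksets_trace) auto
  finally show ?thesis .
qed

text \<open>Graded by size because every \<open>i\<close>-set in \<open>Y\<close> is the trace of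
  equally many \<open>l\<close>-sets of \<open>V\<close>; a bound then needs only the number of
  traces of each size.\<close>

definition trace :: "'a set \<Rightarrow> nat \<Rightarrow> 'a set set \<Rightarrow> 'a set set" where
  "trace Y i A = {G \<in> ksets Y i. G \<in> (\<lambda>F. F \<inter> Y) ` A}"

lemma card_le_trace_sum:
  assumes "finite V" "Y \<subseteq> V" "A \<subseteq> ksets V l"
  shows "card A \<le> (\<Sum>i\<le>l. card (trace Y i A) * ((card V - card Y) choose (l - i)))"
proof -
  have "A \<subseteq> {F \<in> ksets V l. F \<inter> Y \<in> (\<lambda>F. F \<inter> Y) ` A}" using assms(3) by auto
  then have "card A \<le> card {F \<in> ksets V l. F \<inter> Y \<in> (\<lambda>F. F \<inter> Y) ` A}"
    using assms(1) by (intro card_mono) (auto simp: finite_ksets)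
  also have "\<dots> = (\<Sum>i\<le>l. card (trace Y i A) * ((card V - card Y) choose (l - i)))"
    unfolding trace_def using assms by (intro card_ksets_trace_sum) auto
  finally show ?thesis .
qed

text \<open>\<open>R\<close> describes the target family through its traces. Level \<open>l\<close>
  has weight 1, so an excess \<open>e\<close> there costs just \<open>e\<close> overall; a deficit
  at a lower level \<open>q\<close> of nonzero weight makes the total strictly smaller.\<close>

lemma trace_compare:
  assumes V: "finite V" "Y \<subseteq> V" "A \<subseteq> ksets V l" "B \<subseteq> ksets V l"
    and low: "\<And>i. i < l \<Longrightarrow> card (trace Y i A) + card (trace Y i B) \<le> card {G \<in> ksets Y i. R G}"
    and top: "card (trace Y l A) + card (trace Y l B) \<le> card {G \<in> ksets Y l. R G} + e"
  shows "card A + card B \<le> card {F \<in> ksets V l. R (F \<inter> Y)} + e"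
    and "\<lbrakk>q < l; l - q \<le> card V - card Y;
          card (trace Y q A) + card (trace Y q B) < card {G \<in> ksets Y q. R G}\<rbrakk>
      \<Longrightarrow> card A + card B < card {F \<in> ksets V l. R (F \<inter> Y)} + e"
proof -
  let ?c = "\<lambda>i. (card V - card Y) choose (l - i)"
  let ?t = "\<lambda>i. card (trace Y i A) + card (trace Y i B)"
  let ?p = "\<lambda>i. card {G \<in> ksets Y i. R G}"
  have le: "card A + card B \<le> (\<Sum>i\<le>l. ?t i * ?c i)"
    using card_le_trace_sum[OF V(1,2,3)] card_le_trace_sum[OF V(1,2,4)]
    by (simp add: add_mult_distrib sum.distrib)
  have split: "(\<Sum>i\<le>l. f i) = (\<Sum>i<l. f i) + f l" for f :: "nat \<Rightarrow> nat"
    by (simp add: lessThan_Suc_atMost[symmetric])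
  have T: "card {F \<in> ksets V l. R (F \<inter> Y)} = (\<Sum>i<l. ?p i * ?c i) + ?p l"
    using card_ksets_trace_sum[OF V(1,2), of l R] split[of "\<lambda>i. ?p i * ?c i"] by simp
  have mono: "(\<Sum>i<l. ?t i * ?c i) \<le> (\<Sum>i<l. ?p i * ?c i)"
    by (intro sum_mono mult_right_mono low) auto
  show "card A + card B \<le> card {F \<in> ksets V l. R (F \<inter> Y)} + e"
    using le mono T top split[of "\<lambda>i. ?t i * ?c i"] by simp
  assume q: "q < l" "l - q \<le> card V - card Y" "?t q < ?p q"
  have "(\<Sum>i<l. ?t i * ?c i) < (\<Sum>i<l. ?p i * ?c i)"
  proof (rule sum_strict_mono_ex1)
    show "\<forall>i\<in>{..<l}. ?t i * ?c i \<le> ?p i * ?c i" using low by (auto intro: mult_right_mono)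
    have "?c q > 0" using q(2) by simp
    then show "\<exists>i\<in>{..<l}. ?t i * ?c i < ?p i * ?c i" using q by auto
  qed auto
  then show "card A + card B < card {F \<in> ksets V l. R (F \<inter> Y)} + e"
    using le T top split[of "\<lambda>i. ?t i * ?c i"] by simp
qed

section \<open>Shifted families\<close>

definition cross_intersecting :: "'a set set \<Rightarrow> 'a set set \<Rightarrow> bool" where
  "cross_intersecting A B \<longleftrightarrow> (\<forall>a\<in>A. \<forall>b\<in>B. a \<inter> b \<noteq> {})"

lemma cross_intersecting_commute: "cross_intersecting A B \<longleftrightarrow> cross_intersecting B A"
  unfolding cross_intersecting_def by blast

text \<open>The order is supplied by a rank function, since the point type has none. The ground set
  is a parameter because traces and links are shifted on smaller sets.\<close>

definition shifted :: "'a set \<Rightarrow> ('a \<Rightarrow> nat) \<Rightarrow> 'a set set \<Rightarrow> bool" where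
  "shifted V r A \<longleftrightarrow>
    (\<forall>F\<in>A. \<forall>j\<in>F. \<forall>i\<in>V. i \<notin> F \<longrightarrow> r i < r j \<longrightarrow> insert i (F - {j}) \<in> A)"

lemma shiftedD:
  "\<lbrakk>shifted V r A; F \<in> A; j \<in> F; i \<in> V; i \<notin> F; r i < r j\<rbrakk> \<Longrightarrow> insert i (F - {j}) \<in> A"
  unfolding shifted_def by blast

definition ranked :: "'a set \<Rightarrow> ('a \<Rightarrow> nat) \<Rightarrow> bool" where
  "ranked V r \<longleftrightarrow> bij_betw r V {..<card V}"

definition initial :: "'a set \<Rightarrow> ('a \<Rightarrow> nat) \<Rightarrow> nat \<Rightarrow> 'a set" where
  "initial V r m = {x \<in> V. r x < m}"

lemma initial_subset: "initial V r m \<subseteq> V"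
  unfolding initial_def by auto

lemma card_initial:
  assumes "ranked V r" "m \<le> card V"
  shows "card (initial V r m) = m" "ranked (initial V r m) r"
proof -
  have "bij_betw r (initial V r m) {..<m}"
    using assms unfolding ranked_def initial_def bij_betw_def inj_on_def image_def
    by (auto simp: set_eq_iff) (metis order_less_le_trans)
  moreover from this show "card (initial V r m) = m"
    using bij_betw_same_card[of r "initial V r m" "{..<m}"] by simp
  ultimately show "ranked (initial V r m) r"
    unfolding ranked_def by simp
qed

lemma card_exchange: "finite F \<Longrightarrow> j \<in> F \<Longrightarrow> i \<notin> F \<Longrightarrow> card (insert i (F - {j})) = card F"
  by (metis Diff_iff card_Suc_Diff1 card_insert_disjoint finite_Diff)

lemma sum_exchange_less:
  fixes r :: "'a \<Rightarrow> nat"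
  assumes "finite F" "j \<in> F" "i \<notin> F" "r i < r j"
  shows "sum r (insert i (F - {j})) < sum r F"
  using assms by (simp add: sum.remove[of F j])

lemma ex_arg_min_nat:
  fixes f :: "'b \<Rightarrow> nat"
  assumes "x \<in> A"
  obtains m where "m \<in> A" "\<And>y. y \<in> A \<Longrightarrow> f m \<le> f y"
  using assms ex_has_least_nat[of "\<lambda>x. x \<in> A" x f] by auto

lemma card_eq_Diff_nonempty:
  assumes "finite G" "card F = card G" "F \<noteq> G" "finite F"
  shows "F - G \<noteq> {}" "G - F \<noteq> {}"
  using assms by (metis Diff_eq_empty_iff card_subset_eq)+

text \<open>A member of least rank sum cannot miss a point of the segment: exchanging one of its
  later points for the missing one would lower the sum.\<close>

lemma shifted_initial_mem:
  assumes V: "finite V" "ranked V r" "l \<le> card V"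
    and A: "A \<subseteq> ksets V l" "shifted V r A" "A \<noteq> {}"
  shows "initial V r l \<in> A"
proof -
  obtain F0 where "F0 \<in> A" using A(3) by auto
  then obtain F where F: "F \<in> A" and min: "\<And>G. G \<in> A \<Longrightarrow> sum r F \<le> sum r G"
    by (rule ex_arg_min_nat[where f = "sum r"]) blast
  have Fk: "F \<subseteq> V" "card F = l" "finite F"
    using F A(1) V(1) unfolding ksets_def by (auto intro: finite_subset)
  have I: "initial V r l \<subseteq> V" "card (initial V r l) = l" "finite (initial V r l)"
    using card_initial[OF V(2,3)] initial_subset[of V r l] V(1) by (auto intro: finite_subset)
  have "F = initial V r l"
  proof (rule ccontr)
    assume ne: "F \<noteq> initial V r l"
    obtain j i where ij: "j \<in> F - initial V r l" "i \<in> initial V r l - F"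
      using card_eq_Diff_nonempty[OF I(3) _ ne Fk(3)] Fk I by auto
    then have "r i < r j" using Fk(1) unfolding initial_def by auto
    moreover have "i \<in> V" using ij I by auto
    ultimately have "insert i (F - {j}) \<in> A" "sum r (insert i (F - {j})) < sum r F"
      using ij F Fk shiftedD[OF A(2) F] sum_exchange_less[of F j i r] by auto
    then show False using min by force
  qed
  then show ?thesis using F by simp
qed

text \<open>Take a member \<open>F\<close> of least rank sum among those different from the initial
  segment. Any exchange lowering the sum must yield the segment itself, so \<open>F\<close> has just
  one point \<open>j\<close> outside it. Were the rank of \<open>j\<close> at least
  \<open>m\<close>, a point of rank below \<open>m\<close> outside the segment could replace
  \<open>j\<close> instead.\<close>

lemma shifted_second_mem:
  assumes V: "finite V" "ranked V r" "l < m" "m \<le> card V"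
    and A: "A \<subseteq> ksets V l" "shifted V r A" "2 \<le> card A"
  obtains Q where "Q \<in> A" "Q \<subseteq> initial V r m" "card (initial V r l \<union> Q) = l + 1"
proof -
  let ?I = "initial V r l"
  have I: "?I \<subseteq> V" "card ?I = l" "finite ?I"
    using card_initial[OF V(2)] initial_subset[of V r l] V by (auto intro: finite_subset)
  have "A \<noteq> {}" using A(3) by auto
  then have IA: "?I \<in> A" using shifted_initial_mem[of V r l A] V A by auto
  have "A - {?I} \<noteq> {}"
  proof
    assume "A - {?I} = {}"
    then have "A \<subseteq> {?I}" by auto
    then have "card A \<le> card {?I}" by (intro card_mono) auto
    then show False using A(3) by simp
  qed
  then obtain F0 where "F0 \<in> A - {?I}" by auto
  then obtain F where F: "F \<in> A - {?I}" and min: "\<And>G. G \<in> A - {?I} \<Longrightarrow> sum r F \<le> sum r G"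
    by (rule ex_arg_min_nat[where f = "sum r"]) blast
  have FA: "F \<in> ksets V l" using F A(1) by auto
  then have Fk: "F \<subseteq> V" "card F = l" "finite F"
    using ksets_finite_mem[OF V(1) FA] unfolding ksets_def by auto
  have ne: "F \<noteq> ?I" and "card F = card ?I" using Fk I F by auto
  then obtain j i where ij: "j \<in> F - ?I" "i \<in> ?I - F"
    using card_eq_Diff_nonempty[OF I(3) _ ne Fk(3)] by auto
  have rij: "r i < r j" using ij Fk(1) unfolding initial_def by auto
  have iV: "i \<in> V" using ij I by auto
  have "insert i (F - {j}) \<in> A" "sum r (insert i (F - {j})) < sum r F"
    using ij F Fk iV rij shiftedD[OF A(2), of F j i] sum_exchange_less[of F j i r] by auto
  then have eq: "insert i (F - {j}) = ?I" using min by force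
  then have U: "?I \<union> F = insert j ?I" using ij by auto
  have "r j < m"
  proof (rule ccontr)
    assume jm: "\<not> r j < m"
    have "?I \<subset> initial V r m"
    proof -
      have "card (initial V r m) = m" using card_initial V by blast
      moreover have "?I \<subseteq> initial V r m" using V(3) unfolding initial_def by auto
      ultimately show ?thesis using I V(3) by auto
    qed
    then obtain h where h: "h \<in> initial V r m" "h \<notin> ?I" by auto
    have hF: "h \<notin> F" using h eq jm ij unfolding initial_def by auto
    have "r h < r j" "h \<in> V" using h jm unfolding initial_def by auto
    then have "insert h (F - {j}) \<in> A" "sum r (insert h (F - {j})) < sum r F"
      using ij F Fk hF shiftedD[OF A(2), of F j h] sum_exchange_less[of F j h r] by auto
    moreover have "insert h (F - {j}) \<noteq> ?I" using h by auto
    ultimately show False using min by force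
  qed
  then have "F \<subseteq> initial V r m"
    using U V(3) ij Fk(1) eq unfolding initial_def by auto
  moreover have "card (?I \<union> F) = l + 1" using U I ij by simp
  ultimately show ?thesis using that F by auto
qed

text \<open>Descent on the size of \<open>a \<inter> b\<close>. If the common points all lie beyond
  the first \<open>2 * l\<close> points, then \<open>a \<union> b\<close>, having fewer than
  \<open>2 * l\<close> points, misses an early point \<open>t\<close>; exchanging a common point of
  \<open>a\<close> for \<open>t\<close> shrinks the intersection and keeps it away from the early
  points.\<close>

lemma shifted_cross_meet_initial:
  assumes V: "finite V" "ranked V r" "2 * l \<le> card V"
    and A: "A \<subseteq> ksets V l" "shifted V r A" and B: "B \<subseteq> ksets V l"
    and cross: "cross_intersecting A B"
  shows "a \<in> A \<Longrightarrow> b \<in> B \<Longrightarrow> a \<inter> b \<inter> initial V r (2 * l) \<noteq> {}"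
proof (induction "card (a \<inter> b)" arbitrary: a rule: less_induct)
  case less
  let ?Y = "initial V r (2 * l)"
  have Y: "card ?Y = 2 * l" "finite ?Y"
    using card_initial[OF V(2,3)] initial_subset[of V r "2*l"] V(1) by (auto intro: finite_subset)
  have ab: "a \<in> ksets V l" "b \<in> ksets V l" using less.prems A B by auto
  then have a: "a \<subseteq> V" "card a = l" "finite a" and b: "b \<subseteq> V" "card b = l" "finite b"
    using ab[THEN ksets_finite_mem[OF V(1)]] unfolding ksets_def by auto
  show ?case
  proof
    assume e: "a \<inter> b \<inter> ?Y = {}"
    have "a \<inter> b \<noteq> {}" using cross less.prems unfolding cross_intersecting_def by auto
    then obtain s where s: "s \<in> a" "s \<in> b" by auto
    have "s \<notin> ?Y" using s e by auto
    have "card (a \<union> b) < 2 * l"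
    proof -
      have "card (a \<inter> b) > 0" using s a by (auto simp: card_gt_0_iff)
      then show ?thesis using card_Un_Int[OF a(3) b(3)] a b by linarith
    qed
    then have "\<not> ?Y \<subseteq> a \<union> b" using Y a b by (metis card_mono finite_UnI linorder_not_le)
    then obtain t where t: "t \<in> ?Y" "t \<notin> a" "t \<notin> b" by auto
    have "r t < r s" "t \<in> V" using t \<open>s \<notin> ?Y\<close> s a(1) unfolding initial_def by auto
    then have a': "insert t (a - {s}) \<in> A" using shiftedD[OF A(2)] less.prems s t by auto
    have "insert t (a - {s}) \<inter> b = (a \<inter> b) - {s}" using t by auto
    then have "card (insert t (a - {s}) \<inter> b) < card (a \<inter> b)"
      using s a by (metis IntI card_Diff1_less finite_Int)
    then have "insert t (a - {s}) \<inter> b \<inter> ?Y \<noteq> {}" using less.hyps a' less.prems by blast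
    then show False using e t by auto
  qed
qed

lemma trace_shifted:
  assumes "finite V" "A \<subseteq> ksets V l" "shifted V r A"
  shows "shifted (initial V r m) r (trace (initial V r m) i A)"
  unfolding shifted_def
proof (intro ballI impI)
  let ?Y = "initial V r m"
  fix G j h assume G: "G \<in> trace ?Y i A" "j \<in> G" "h \<in> ?Y" "h \<notin> G" "r h < r j"
  then obtain F where F: "F \<in> A" "G = F \<inter> ?Y" and Gk: "G \<subseteq> ?Y" "card G = i"
    unfolding trace_def ksets_def by auto
  have "finite G" using F assms(1,2) unfolding ksets_def by (auto intro: finite_subset)
  have "insert h (F - {j}) \<in> A"
    using G F initial_subset[of V r m] by (intro shiftedD[OF assms(3)]) auto
  moreover have "insert h (F - {j}) \<inter> ?Y = insert h (G - {j})" using F G by auto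
  moreover have "card (insert h (G - {j})) = i"
    using card_exchange[OF \<open>finite G\<close>] G Gk by auto
  ultimately show "insert h (G - {j}) \<in> trace ?Y i A"
    using Gk G unfolding trace_def ksets_def by (auto intro!: image_eqI[where x = "insert h (F - {j})"])
qed

lemma trace_cross_intersecting:
  assumes "finite V" "ranked V r" "2 * l \<le> card V"
    and "A \<subseteq> ksets V l" "shifted V r A" "B \<subseteq> ksets V l" "cross_intersecting A B"
  shows "cross_intersecting (trace (initial V r (2 * l)) i A) (trace (initial V r (2 * l)) i' B)"
  unfolding cross_intersecting_def
proof (intro ballI)
  fix a b assume "a \<in> trace (initial V r (2 * l)) i A" "b \<in> trace (initial V r (2 * l)) i' B"
  then obtain F G where "F \<in> A" "G \<in> B"
    "a = F \<inter> initial V r (2 * l)" "b = G \<inter> initial V r (2 * l)"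
    unfolding trace_def by auto
  then show "a \<inter> b \<noteq> {}" using shifted_cross_meet_initial[OF assms, of F G] by auto
qed

lemma trace_subset: "trace Y i A \<subseteq> ksets Y i"
  unfolding trace_def by auto

text \<open>On \<open>2 * l\<close> points the complements of the members of \<open>B\<close> are
  again \<open>l\<close>-sets, and none of them lies in \<open>A\<close>.\<close>

lemma cross_intersecting_card_half:
  assumes "finite Y" "card Y = 2 * l" "A \<subseteq> ksets Y l" "B \<subseteq> ksets Y l" "cross_intersecting A B"
  shows "card A + card B \<le> (2 * l) choose l"
proof -
  let ?c = "\<lambda>F. Y - F"
  have fA: "finite A" "finite B" using assms finite_ksets by (metis finite_subset)+
  have inj: "inj_on ?c B"
    using assms(4) unfolding inj_on_def ksets_def by (metis (no_types, lifting) double_diff mem_Collect_eq subsetD subset_refl)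
  have "A \<inter> ?c ` B = {}" using assms(5) unfolding cross_intersecting_def by blast
  then have "card (A \<union> ?c ` B) = card A + card B"
    using fA inj by (simp add: card_Un_disjoint card_image)
  moreover have "A \<union> ?c ` B \<subseteq> ksets Y l"
  proof -
    have "Y - F \<in> ksets Y l" if "F \<in> B" for F
    proof -
      have "F \<subseteq> Y" "card F = l" using that assms(4) unfolding ksets_def by auto
      then have "card (Y - F) = l" using assms(1,2) by (simp add: card_Diff_subset finite_subset)
      then show ?thesis unfolding ksets_def by auto
    qed
    then show ?thesis using assms(3) by auto
  qed
  ultimately show ?thesis
    using card_mono[OF finite_ksets[OF assms(1)], of "A \<union> ?c ` B" l] assms(1,2)
    by (simp add: card_ksets)
qed

section \<open>Nonempty shifted cross-intersecting pairs\<close>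

lemma binomial_less_Suc: "1 \<le> i \<Longrightarrow> i \<le> l + 1 \<Longrightarrow> (l choose i) + 1 \<le> Suc l choose i"
proof -
  assume i: "1 \<le> i" "i \<le> l + 1"
  then obtain m where m: "i = Suc m" by (cases i) auto
  then have "l choose m > 0" using i by simp
  then show ?thesis using m by (simp add: Suc_le_eq)
qed

lemma cross_intersecting_subset_meet:
  assumes "cross_intersecting A B" "P \<in> B" "A \<subseteq> K"
  shows "A \<subseteq> {G \<in> K. G \<inter> P \<noteq> {}}"
  using assms unfolding cross_intersecting_def by auto

text \<open>A Hilton-Milner type bound; the model is one \<open>l\<close>-set \<open>P\<close>
  together with all \<open>l\<close>-sets meeting it. Traces on the first \<open>2 * l\<close>
  points are compared level by level with the sets meeting the initial segment. The lower levels are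
  again shifted cross-intersecting pairs, now of smaller sets, so induction on \<open>l\<close>
  applies to them.\<close>

theorem shifted_cross_intersecting_bound:
  assumes "finite V" "ranked V r" "2 * l \<le> card V"
    and "A \<subseteq> ksets V l" "shifted V r A" "A \<noteq> {}"
    and "B \<subseteq> ksets V l" "shifted V r B" "B \<noteq> {}"
    and "cross_intersecting A B"
  shows "card A + card B + ((card V - l) choose l) \<le> (card V choose l) + 1"
  using assms
proof (induction l arbitrary: V A B rule: less_induct)
  case (less l)
  note V = less.prems(1-3) and A = less.prems(4-6) and B = less.prems(7-9)
    and cross = less.prems(10)
  let ?Y = "initial V r (2 * l)" and ?P = "initial V r l"
  let ?R = "\<lambda>G. G \<inter> ?P \<noteq> {}"
  have Y: "card ?Y = 2 * l" "ranked ?Y r" "finite ?Y" "?Y \<subseteq> V"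
    using card_initial[OF V(2,3)] initial_subset[of V r "2*l"] V(1) by (auto intro: finite_subset)
  have P: "card ?P = l" "?P \<subseteq> ?Y" "?P \<subseteq> V"
    using card_initial[OF V(2)] V(3) unfolding initial_def by auto
  have PA: "?P \<in> A" and PB: "?P \<in> B"
    using V A B shifted_initial_mem[of V r l] by auto
  have trA: "shifted ?Y r (trace ?Y i A)" and trB: "shifted ?Y r (trace ?Y i B)" for i
    using trace_shifted V(1) A B by blast+
  have cr: "cross_intersecting (trace ?Y i A) (trace ?Y i' B)" for i i'
    using trace_cross_intersecting V A B cross by blast
  have Ptr: "?P \<in> trace ?Y l A" "?P \<in> trace ?Y l B"
    using PA PB P unfolding trace_def ksets_def by (auto intro!: image_eqI[of _ _ ?P])
  have fk: "finite {G \<in> ksets ?Y i. ?R G}" for i using finite_ksets[OF Y(3)] by auto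
  have R_card: "card {G \<in> ksets ?Y i. ?R G} + (l choose i) = (2 * l) choose i" for i
    using card_ksets_meet[OF Y(3) P(2), of i] Y P by simp
  have low: "card (trace ?Y i A) + card (trace ?Y i B) \<le> card {G \<in> ksets ?Y i. ?R G}"
    if i: "i < l" for i
  proof (cases "trace ?Y i A = {} \<or> trace ?Y i B = {}")
    case True
    \<comment> \<open>The initial segment is a trace of both families, so even when one side is
      empty the other consists of sets meeting it.\<close>
    have "trace ?Y i A \<subseteq> {G \<in> ksets ?Y i. ?R G}" "trace ?Y i B \<subseteq> {G \<in> ksets ?Y i. ?R G}"
      using cross_intersecting_subset_meet[OF cr[of i l] Ptr(2) trace_subset]
        cross_intersecting_subset_meet[OF cr[of l i, unfolded cross_intersecting_commute[of "trace ?Y l A"]]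
          Ptr(1) trace_subset] by auto
    then have "card (trace ?Y i A) \<le> card {G \<in> ksets ?Y i. ?R G}"
      "card (trace ?Y i B) \<le> card {G \<in> ksets ?Y i. ?R G}"
      using fk by (auto intro: card_mono)
    then show ?thesis using True by auto
  next
    case False
    have IH: "card (trace ?Y i A) + card (trace ?Y i B) + ((2 * l - i) choose i) \<le> ((2 * l) choose i) + 1"
      using less.IH[OF i Y(3,2) _ trace_subset trA _ trace_subset trB _ cr[of i i]] False i Y(1)
      by simp
    have "i \<noteq> 0"
    proof
      assume "i = 0"
      then have "trace ?Y i A \<subseteq> {{}}" using trace_subset[of ?Y 0 A] Y(3)
        finite_subset[OF _ Y(3)] unfolding ksets_def by auto
      then show False using False cr[of i i] unfolding cross_intersecting_def by blast
    qed
    \<comment> \<open>The induction hypothesis excludes \<open>(2 * l - i) choose i\<close> sets,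
      the target only \<open>l choose i\<close>; for \<open>i \<ge> 1\<close> the surplus pays for
      the additive 1 of the hypothesis.\<close>
    then have "(l choose i) + 1 \<le> Suc l choose i" using i by (intro binomial_less_Suc) auto
    also have "\<dots> \<le> (2 * l - i) choose i" using i by (intro binomial_right_mono) auto
    finally show ?thesis using IH R_card[of i] by linarith
  qed
  have "card (trace ?Y l A) + card (trace ?Y l B) \<le> (2 * l) choose l"
    using cross_intersecting_card_half[OF Y(3,1) trace_subset trace_subset cr] .
  \<comment> \<open>Inside \<open>?Y\<close> only the complement of \<open>?P\<close> is an
    \<open>l\<close>-set missing \<open>?P\<close>; this is the excess 1.\<close>
  then have top: "card (trace ?Y l A) + card (trace ?Y l B) \<le> card {G \<in> ksets ?Y l. ?R G} + 1"
    using R_card[of l] by simp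
  have "card A + card B \<le> card {F \<in> ksets V l. ?R (F \<inter> ?Y)} + 1"
    using trace_compare(1)[OF V(1) Y(4) A(1) B(1) low top] .
  moreover have "{F \<in> ksets V l. ?R (F \<inter> ?Y)} = {F \<in> ksets V l. F \<inter> ?P \<noteq> {}}"
    using P by blast
  ultimately show ?case using card_ksets_meet[OF V(1) P(3), of l] P(1) by simp
qed

text \<open>The size of a pair consisting of two \<open>l\<close>-sets sharing \<open>l - 1\<close> points and of all
  \<open>l\<close>-sets meeting both.\<close>

definition cross_bound :: "nat \<Rightarrow> nat \<Rightarrow> int" where
  "cross_bound M l = int (M choose l) - int ((M - l) choose l)
      - int ((M - l - 1) choose (l - 1)) + 2"

text \<open>Inclusion-exclusion subtracts \<open>(M - l) choose l\<close> twice and adds back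
  \<open>(M - l - 1) choose l\<close>; one application of Pascal's rule gives the form used in
  \<open>cross_bound\<close>.\<close>

lemma card_meet_both_eq_cross_bound:
  assumes "finite V" "P \<subseteq> V" "Q \<subseteq> V" "card P = l" "card Q = l" "card (P \<union> Q) = l + 1"
    and "1 \<le> l"
  shows "int (card {F \<in> ksets V l. F \<inter> P \<noteq> {} \<and> F \<inter> Q \<noteq> {}}) + 2 = cross_bound (card V) l"
proof -
  have "l + 1 \<le> card V" using assms by (metis card_mono le_sup_iff)
  then obtain m where m: "card V - l = Suc m" by (metis Suc_diff_le Suc_eq_plus1 diff_Suc_Suc)
  obtain l' where l: "l = Suc l'" using assms(7) by (cases l) auto
  have "(Suc m choose l) = (m choose l') + (m choose l)" using l by simp
  moreover have "card V - l - 1 = m" "card V - (l + 1) = m" using m by auto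
  ultimately show ?thesis
    using card_ksets_meet_both[OF assms(1-3), of l] m l assms(4-6) unfolding cross_bound_def
    by simp
qed

text \<open>Of the \<open>i\<close>-sets on \<open>2 * l\<close> points,
  \<open>2 * (l choose i) - ((l - 1) choose i)\<close> miss one of two given \<open>l\<close>-sets
  sharing \<open>l - 1\<close> points. So the bound for nonempty pairs stays within the number of
  sets meeting both. At \<open>l = 3\<close>, \<open>i = 2\<close> both sides are 7, and this
  equality is where the sporadic pairs come from.\<close>

lemma cross_bound_trace_aux:
  assumes "1 \<le> i" "i < l" "3 \<le> l"
  shows "2 * (l choose i) + 1 \<le> ((2 * l - i) choose i) + ((l - 1) choose i)"
    and "i = l - 1 \<Longrightarrow> 4 \<le> l \<Longrightarrow> 2 * (l choose i) + 1 < ((2 * l - i) choose i) + ((l - 1) choose i)"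
proof -
  show *: "2 * (l choose i) + 1 \<le> ((2 * l - i) choose i) + ((l - 1) choose i)"
  proof (cases "i = 1")
    case True
    then show ?thesis using assms by simp
  next
    case False
    obtain l' i' where l: "l = Suc l'" and i: "i = Suc i'"
      using assms by (metis not0_implies_Suc not_one_le_zero less_nat_zero_code)
    have "(l' choose i') + 1 \<le> l choose i'"
      using binomial_less_Suc[of i' l'] l i assms False by auto
    moreover have "Suc l choose i \<le> (2 * l - i) choose i"
      using assms by (intro binomial_right_mono) auto
    moreover have "Suc l choose i = (l choose i') + (l choose i)" using i by simp
    moreover have "l choose i = (l' choose i') + (l' choose i)" using i l by simp
    ultimately show ?thesis using l by simp
  qed
  assume i: "i = l - 1" "4 \<le> l"
  have "(2 * l - i) choose i = Suc l choose 2"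
    using i assms binomial_symmetric[of i "Suc l"] by (simp add: numeral_2_eq_2)
  also have "\<dots> = Suc l * l div 2" by (simp add: choose_two)
  also have "\<dots> > 2 * l"
  proof -
    have "5 * l \<le> Suc l * l" using i(2) by (intro mult_right_mono) auto
    then show ?thesis using i(2) by linarith
  qed
  finally have "2 * l < (2 * l - i) choose i" .
  moreover have "l choose i = l" using i by (metis assms(3) binomial_Suc_n Suc_diff_1 le_zero_eq not_gr_zero zero_neq_numeral)
  moreover have "(l - 1) choose i = 1" using i by simp
  ultimately show "2 * (l choose i) + 1 < ((2 * l - i) choose i) + ((l - 1) choose i)" by linarith
qed

text \<open>Pairs are edges of a graph. Every edge of \<open>B\<close> joins \<open>e\<close> to
  \<open>f\<close>, so \<open>B\<close> lies in a four-cycle. The whole cycle would leave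
  \<open>A\<close> only the two diagonals \<open>e\<close> and \<open>f\<close>, and any three edges
  of the cycle include two opposite ones.\<close>

lemma cross_pairs_disjoint:
  assumes "A \<subseteq> ksets V 2" "B \<subseteq> ksets V 2" "cross_intersecting A B" "3 \<le> card A" "3 \<le> card B"
    and "e \<in> A" "f \<in> A" "e \<inter> f = {}"
  shows "card B \<le> 3" "\<exists>g\<in>B. \<exists>h\<in>B. g \<inter> h = {}"
proof -
  obtain a b where ab: "e = {a, b}" "a \<noteq> b"
    using assms(1,6) unfolding ksets_def by (auto simp: card_2_iff)
  obtain c d where cd: "f = {c, d}" "c \<noteq> d"
    using assms(1,7) unfolding ksets_def by (auto simp: card_2_iff)
  have dist: "a \<noteq> c" "a \<noteq> d" "b \<noteq> c" "b \<noteq> d" using ab cd assms(8) by auto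
  let ?C = "{{a, c}, {b, d}, {a, d}, {b, c}}"
  have BC: "B \<subseteq> ?C"
  proof
    fix g assume g: "g \<in> B"
    then have "g \<inter> {a, b} \<noteq> {}" "g \<inter> {c, d} \<noteq> {}"
      using assms(3,6,7) ab cd unfolding cross_intersecting_def by blast+
    moreover obtain x y where "g = {x, y}" "x \<noteq> y"
      using assms(2) g unfolding ksets_def by (auto simp: card_2_iff)
    ultimately show "g \<in> ?C" using dist by auto
  qed
  show "card B \<le> 3"
  proof (rule ccontr)
    assume "\<not> card B \<le> 3"
    moreover have "card ?C \<le> 4" using card_length[of "[{a, c}, {b, d}, {a, d}, {b, c}]"] by simp
    ultimately have "B = ?C" using BC by (intro card_seteq) auto
    then have meet: "g \<inter> {a, c} \<noteq> {}" "g \<inter> {b, d} \<noteq> {}" "g \<inter> {a, d} \<noteq> {}" "g \<inter> {b, c} \<noteq> {}"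
      if "g \<in> A" for g
      using assms(3) that unfolding cross_intersecting_def by auto
    have "A \<subseteq> {{a, b}, {c, d}}"
    proof
      fix g assume g: "g \<in> A"
      obtain x y where "g = {x, y}" "x \<noteq> y"
        using assms(1) g unfolding ksets_def by (auto simp: card_2_iff)
      then show "g \<in> {{a, b}, {c, d}}" using meet[OF g] dist ab cd by auto
    qed
    then have "card A \<le> card {{a, b}, {c, d}}" by (intro card_mono) auto
    also have "\<dots> \<le> 2" using card_length[of "[{a, b}, {c, d}]"] by simp
    finally show False using assms(4) by simp
  qed
  show "\<exists>g\<in>B. \<exists>h\<in>B. g \<inter> h = {}"
  proof (rule ccontr)
    assume no: "\<not> ?thesis"
    have small: "\<not> B \<subseteq> {u, v}" for u v
    proof
      assume "B \<subseteq> {u, v}"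
      then have "card B \<le> card {u, v}" by (intro card_mono) auto
      also have "\<dots> \<le> 2" using card_length[of "[u, v]"] by simp
      finally show False using assms(5) by simp
    qed
    have "{a, c} \<notin> B \<or> {b, d} \<notin> B" "{a, d} \<notin> B \<or> {b, c} \<notin> B"
    proof -
      have "{a, c} \<inter> {b, d} = {}" "{a, d} \<inter> {b, c} = {}" using dist ab cd by auto
      then show "{a, c} \<notin> B \<or> {b, d} \<notin> B" "{a, d} \<notin> B \<or> {b, c} \<notin> B" using no by blast+
    qed
    then have "B \<subseteq> {{a, c}, {a, d}} \<or> B \<subseteq> {{a, c}, {b, c}} \<or> B \<subseteq> {{b, d}, {a, d}} \<or> B \<subseteq> {{b, d}, {b, c}}"
    proof -
      have "S \<subseteq> {w, x, y, z} \<Longrightarrow> w \<notin> S \<or> x \<notin> S \<Longrightarrow> y \<notin> S \<or> z \<notin> S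
        \<Longrightarrow> S \<subseteq> {w, y} \<or> S \<subseteq> {w, z} \<or> S \<subseteq> {x, y} \<or> S \<subseteq> {x, z}"
        for S :: "'a set set" and w x y z by blast
      from this[OF BC] show ?thesis
        using \<open>{a, c} \<notin> B \<or> {b, d} \<notin> B\<close> \<open>{a, d} \<notin> B \<or> {b, c} \<notin> B\<close> .
    qed
    then show False using small by blast
  qed
qed

text \<open>If one graph has disjoint edges, so has the other, and both have at most three edges.
  Otherwise \<open>A\<close> is a star or a triangle: a star with three edges forces its centre into
  every edge of \<open>B\<close>, and a triangle forces \<open>B\<close>, then \<open>A\<close>, to
  be that triangle.\<close>

lemma cross_pairs_bound:
  assumes "A \<subseteq> ksets V 2" "B \<subseteq> ksets V 2" "cross_intersecting A B" "3 \<le> card A" "3 \<le> card B"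
    and no_common: "\<not> (\<exists>z. \<forall>e\<in>A \<union> B. z \<in> e)"
  shows "card A + card B \<le> 6"
proof (cases "\<exists>e\<in>A. \<exists>f\<in>A. e \<inter> f = {}")
  case True
  then obtain e f where ef: "e \<in> A" "f \<in> A" "e \<inter> f = {}" by auto
  have "card B \<le> 3" and "\<exists>g\<in>B. \<exists>h\<in>B. g \<inter> h = {}"
    using cross_pairs_disjoint[OF assms(1-5) ef] by auto
  then obtain g h where "g \<in> B" "h \<in> B" "g \<inter> h = {}" by auto
  then have "card A \<le> 3"
    using cross_pairs_disjoint(1)[OF assms(2,1) _ assms(5,4)] assms(3) cross_intersecting_commute
    by blast
  then show ?thesis using \<open>card B \<le> 3\<close> by simp
next
  case False
  have "finite A" using assms(4) card.infinite by force
  obtain e where e: "e \<in> A" using assms(4) by fastforce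
  have "card (A - {e}) \<ge> 2" using assms(4) e \<open>finite A\<close> by simp
  then obtain f where f: "f \<in> A" "f \<noteq> e"
    by (metis Diff_iff all_not_in_conv card.empty insertI1 not_numeral_le_zero)
  obtain z where z: "z \<in> e" "z \<in> f" using False e f by auto
  obtain p where p: "e = {z, p}" "z \<noteq> p"
    using assms(1) e z unfolding ksets_def by (auto simp: card_2_iff)
  obtain q where q: "f = {z, q}" "z \<noteq> q"
    using assms(1) f z unfolding ksets_def by (auto simp: card_2_iff)
  have pq: "p \<noteq> q" using p q f by auto
  have pairs: "\<exists>x y. g = {x, y} \<and> x \<noteq> y" if "g \<in> A \<union> B" for g
    using assms(1,2) that unfolding ksets_def by (auto simp: card_2_iff)
  have meet: "x \<inter> y \<noteq> {}" if "x \<in> A" "y \<in> B" for x y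
    using assms(3) that unfolding cross_intersecting_def by blast
  show ?thesis
  proof (cases "\<forall>g\<in>A. z \<in> g")
    case True
    have "card (A - {e, f}) \<ge> 1" using assms(4) e f \<open>finite A\<close> by simp
    then obtain g where g: "g \<in> A" "g \<noteq> e" "g \<noteq> f" by (metis Diff_iff card.empty ex_in_conv insertCI not_one_le_zero)
    then obtain s where s: "g = {z, s}" "z \<noteq> s"
    proof -
      obtain x y where xy: "g = {x, y}" "x \<noteq> y" using pairs[of g] g(1) by blast
      have "z \<in> g" using True g(1) by blast
      then consider "z = x" | "z = y" using xy(1) by blast
      then show ?thesis
      proof cases
        case 1
        then show ?thesis using that[of y] xy by simp
      next
        case 2
        then show ?thesis using that[of x] xy by (simp add: insert_commute)
      qed
    qed
    have "z \<in> h" if hB: "h \<in> B" for h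
    proof (rule ccontr)
      assume "z \<notin> h"
      then have "p \<in> h" "q \<in> h" "s \<in> h"
        using meet[OF e hB] meet[OF f(1) hB] meet[OF g(1) hB] p(1) q(1) s(1) by auto
      moreover have "p \<noteq> s" "q \<noteq> s" using g(2,3) p(1) q(1) s(1) by blast+
      moreover obtain x y where "h = {x, y}" using pairs[of h] hB by blast
      ultimately show False using pq by blast
    qed
    then show ?thesis using True no_common by blast
  next
    case False
    then obtain g where g: "g \<in> A" "z \<notin> g" by auto
    have "g \<inter> e \<noteq> {}" "g \<inter> f \<noteq> {}"
      using \<open>\<not> (\<exists>e\<in>A. \<exists>f\<in>A. e \<inter> f = {})\<close> g(1) e f(1) by blast+
    then have "p \<in> g" "q \<in> g" using p(1) q(1) g(2) by auto
    moreover obtain x y where "g = {x, y}" using pairs[of g] g(1) by blast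
    ultimately have gpq: "g = {p, q}" using pq by blast
    let ?T = "{{z, p}, {z, q}, {p, q}}"
    have T3: "card ?T \<le> 3" using card_length[of "[{z, p}, {z, q}, {p, q}]"] by simp
    have inT: "h \<in> ?T" if "h \<inter> {z, p} \<noteq> {}" "h \<inter> {z, q} \<noteq> {}" "h \<inter> {p, q} \<noteq> {}"
      and hAB: "h \<in> A \<union> B" for h
    proof -
      obtain x y where "h = {x, y}" "x \<noteq> y" using pairs[OF hAB] by blast
      then show ?thesis using that(1-3) p(2) q(2) pq by auto
    qed
    have BT: "B \<subseteq> ?T"
    proof
      fix h assume h: "h \<in> B"
      show "h \<in> ?T"
        using meet[OF e h] meet[OF f(1) h] meet[OF g(1) h] h
        by (intro inT) (simp_all add: gpq p(1) q(1) Int_commute)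
    qed
    then have "card B \<le> 3" using T3 card_mono[of ?T B] by simp
    have BT': "B = ?T" using BT assms(5) T3 by (intro card_seteq) simp_all
    have "A \<subseteq> ?T"
    proof
      fix h assume h: "h \<in> A"
      show "h \<in> ?T" using h by (intro inT meet) (simp_all add: BT')
    qed
    then have "card A \<le> 3" using T3 card_mono[of ?T A] by simp
    then show ?thesis using \<open>card B \<le> 3\<close> by simp
  qed
qed

text \<open>For the strict part, a third member \<open>C\<close> of \<open>A\<close> is used: some
  \<open>(l - 1)\<close>-set in \<open>Y\<close> meets \<open>P\<close> and \<open>Q\<close> but
  avoids \<open>C\<close>, hence is no trace of \<open>B\<close>. In the case of equality this shows
  that neither family has an empty level \<open>l - 1\<close>.\<close>

lemma trace_meet_both:
  assumes V: "finite V" "ranked V r" "2 * l \<le> card V"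
    and A: "A \<subseteq> ksets V l" "shifted V r A" and B: "B \<subseteq> ksets V l"
    and cross: "cross_intersecting A B"
    and PQ: "P \<in> A" "Q \<in> A" "P \<subseteq> initial V r (2 * l)" "Q \<subseteq> initial V r (2 * l)"
  defines "Y \<equiv> initial V r (2 * l)"
  shows "card (trace Y i B) \<le> card {G \<in> ksets Y i. G \<inter> P \<noteq> {} \<and> G \<inter> Q \<noteq> {}}"
    and "\<lbrakk>3 \<le> card A; 3 \<le> l\<rbrakk> \<Longrightarrow>
      card (trace Y (l - 1) B) < card {G \<in> ksets Y (l - 1). G \<inter> P \<noteq> {} \<and> G \<inter> Q \<noteq> {}}"
proof -
  let ?R = "\<lambda>i. {G \<in> ksets Y i. G \<inter> P \<noteq> {} \<and> G \<inter> Q \<noteq> {}}"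
  have Y: "card Y = 2 * l" "finite Y" "Y \<subseteq> V"
    using card_initial[OF V(2,3)] initial_subset[of V r "2*l"] V(1)
    unfolding Y_def by (auto intro: finite_subset)
  have meet: "a \<inter> G \<noteq> {}" if G: "G \<in> trace Y i B" and a: "a \<in> A" for a G i
  proof -
    obtain b where "b \<in> B" "G = b \<inter> Y" using G unfolding trace_def by auto
    then show ?thesis
      using shifted_cross_meet_initial[OF V A B cross a] unfolding Y_def by auto
  qed
  have sub: "trace Y i B \<subseteq> ?R i" for i
    using meet PQ trace_subset[of Y i B] by blast
  have fin: "finite (?R i)" for i using finite_ksets[OF Y(2)] by auto
  show "card (trace Y i B) \<le> card (?R i)" using sub fin by (intro card_mono)
  assume A3: "3 \<le> card A" and l: "3 \<le> l"
  have "\<not> A \<subseteq> {P, Q}"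
  proof
    assume "A \<subseteq> {P, Q}"
    then have "card A \<le> card {P, Q}" by (intro card_mono) auto
    also have "\<dots> \<le> 2" using card_length[of "[P, Q]"] by simp
    finally show False using A3 by simp
  qed
  then obtain C where C: "C \<in> A" "C \<noteq> P" "C \<noteq> Q" by auto
  have "C \<in> ksets V l" using C A by auto
  then have Ck: "card C = l" "finite C"
    using ksets_finite_mem[OF V(1) \<open>C \<in> ksets V l\<close>] unfolding ksets_def by auto
  have "card P = l" "card Q = l" using PQ A unfolding ksets_def by auto
  then have "\<not> P \<subseteq> C" "\<not> Q \<subseteq> C" using C Ck card_subset_eq[OF Ck(2)] by metis+
  then obtain p q where p: "p \<in> P" "p \<notin> C" and q: "q \<in> Q" "q \<notin> C" by auto
  have pqY: "p \<in> Y" "q \<in> Y" using p q PQ unfolding Y_def by auto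
  \<comment> \<open>\<open>W\<close> is built inside \<open>Y - C\<close> around a point of
    \<open>P\<close> and a point of \<open>Q\<close>; these two points fit because
    \<open>l - 1 \<ge> 2\<close>.\<close>
  have 1: "l - 1 \<le> card (Y - C)"
    using Y Ck diff_card_le_card_Diff[OF Ck(2), of Y] by simp
  have 2: "card {p, q} \<le> l - 1" using card_length[of "[p, q]"] l by simp
  have 3: "{p, q} \<subseteq> Y - C" using pqY p q by auto
  obtain W where W: "{p, q} \<subseteq> W" "W \<subseteq> Y - C" "card W = l - 1"
    using exists_subset_between[OF 2 1 3] Y(2) by blast
  have "W \<inter> P \<noteq> {}" "W \<inter> Q \<noteq> {}" "W \<subseteq> Y" "C \<inter> W = {}" using W(1,2) p(1) q(1) by auto
  then have "W \<in> ?R (l - 1)" using W(3) unfolding ksets_def by simp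
  moreover have "W \<notin> trace Y (l - 1) B" using meet[of W "l - 1" C] C(1) \<open>C \<inter> W = {}\<close> by blast
  ultimately have "trace Y (l - 1) B \<subset> ?R (l - 1)" using sub by blast
  then show "card (trace Y (l - 1) B) < card (?R (l - 1))" using fin by (intro psubset_card_mono)
qed

section \<open>Sporadic pairs of families of triples\<close>

lemma card_ksets_superset:
  assumes "finite V" "S \<subseteq> V" "card S \<le> k"
  shows "card {F \<in> ksets V k. S \<subseteq> F} = (card V - card S) choose (k - card S)"
proof -
  have "finite S" using assms finite_subset by blast
  have "{F \<in> ksets V k. S \<subseteq> F} = {F \<in> ksets V k. F \<inter> S \<in> {S}}" by auto
  moreover have "card \<dots> = 1 * ((card V - card S) choose (k - card S))"
    using assms by (subst card_ksets_trace[where i = "card S"]) (auto simp: ksets_def)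
  ultimately show ?thesis by simp
qed

text \<open>The two right-hand sides are the sizes of the two kinds of sporadic pairs: two stars
  with the same centre, and the triples containing an edge together with the triples meeting
  it.\<close>

lemma cross_bound_3:
  assumes "5 \<le> M"
  shows "cross_bound M 3 = 2 * int ((M - 1) choose 2)"
    and "cross_bound M 3 = int (M - 2) + int (M choose 3) - int ((M - 2) choose 3)"
proof -
  obtain m where m: "M = m + 5" using assms by (metis add.commute le_Suc_ex)
  have c2: "int (x choose 2) * 2 = int x * (int x - 1)" for x
  proof (induction x)
    case (Suc x)
    have "(Suc x choose 2) = x + (x choose 2)" by (simp add: numeral_2_eq_2)
    then show ?case using Suc by (simp add: algebra_simps)
  qed simp
  have s3: "Suc x choose 3 = (x choose 2) + (x choose 3)" for x
    by (simp add: numeral_3_eq_3 numeral_2_eq_2)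
  have s2: "Suc x choose 2 = x + (x choose 2)" for x by (simp add: numeral_2_eq_2)
  have e: "m + 5 = Suc (Suc (Suc (Suc (Suc m))))" "m + 4 = Suc (Suc (Suc (Suc m)))"
    "m + 3 = Suc (Suc (Suc m))" "m + 2 = Suc (Suc m)" "m + 1 = Suc m" by auto
  have d: "m + 5 - 1 = m + 4" "m + 5 - 3 = m + 2" "m + 5 - 3 - 1 = m + 1" "m + 5 - 2 = m + 3" by auto
  show "cross_bound M 3 = 2 * int ((M - 1) choose 2)"
    unfolding cross_bound_def m d using c2[of m] by (simp add: e s2 s3 del: binomial_Suc_Suc)
  show "cross_bound M 3 = int (M - 2) + int (M choose 3) - int ((M - 2) choose 3)"
    unfolding cross_bound_def m d using c2[of m] by (simp add: e s2 s3 del: binomial_Suc_Suc)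
qed

text \<open>The links, at a two-element cover, of the families \<open>G\<^sub>2\<close> and \<open>G\<^sub>3\<close> for \<open>k = 4\<close>.\<close>

definition sporadic_pair :: "'a set \<Rightarrow> 'a set set \<Rightarrow> 'a set set \<Rightarrow> bool" where
  "sporadic_pair V A B \<longleftrightarrow>
    (\<exists>z\<in>V. A = {F \<in> ksets V 3. z \<in> F} \<and> B = {F \<in> ksets V 3. z \<in> F}) \<or>
    (\<exists>z\<in>V. \<exists>w\<in>V. z \<noteq> w \<and>
      (A = {F \<in> ksets V 3. {z, w} \<subseteq> F} \<and> B = {F \<in> ksets V 3. F \<inter> {z, w} \<noteq> {}} \<or>
       B = {F \<in> ksets V 3. {z, w} \<subseteq> F} \<and> A = {F \<in> ksets V 3. F \<inter> {z, w} \<noteq> {}}))"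

lemma sporadic_pair_sym: "sporadic_pair V A B \<Longrightarrow> sporadic_pair V B A"
  unfolding sporadic_pair_def by blast

text \<open>Equality in the size bound turns containment into equality, so that later arguments need
  to establish containment only.\<close>

lemma sporadic_star:
  assumes "finite V" "5 \<le> card V" "z \<in> V"
    and "A \<subseteq> {F \<in> ksets V 3. z \<in> F}" "B \<subseteq> {F \<in> ksets V 3. z \<in> F}"
    and "int (card A + card B) = cross_bound (card V) 3"
  shows "sporadic_pair V A B"
proof -
  let ?S = "{F \<in> ksets V 3. z \<in> F}"
  have S: "card ?S = (card V - 1) choose 2"
    using card_ksets_superset[of V "{z}" 3] assms by simp
  have "card A + card B = card ?S + card ?S"
    using assms(6) cross_bound_3(1)[OF assms(2)] S by linarith
  moreover have fin: "finite ?S" using finite_ksets[OF assms(1)] by auto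
  have "card A \<le> card ?S" "card B \<le> card ?S" using fin assms by (auto intro: card_mono)
  ultimately have "card A = card ?S" "card B = card ?S" by linarith+
  then have "A = ?S" "B = ?S" using assms fin card_subset_eq by blast+
  then show ?thesis using assms(3) unfolding sporadic_pair_def by blast
qed

lemma sporadic_edge:
  assumes "finite V" "5 \<le> card V" "z \<in> V" "w \<in> V" "z \<noteq> w"
    and "A \<subseteq> {F \<in> ksets V 3. {z, w} \<subseteq> F}" "B \<subseteq> {F \<in> ksets V 3. F \<inter> {z, w} \<noteq> {}}"
    and "int (card A + card B) = cross_bound (card V) 3"
  shows "sporadic_pair V A B"
proof -
  let ?S = "{F \<in> ksets V 3. {z, w} \<subseteq> F}" and ?T = "{F \<in> ksets V 3. F \<inter> {z, w} \<noteq> {}}"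
  have S: "card ?S = card V - 2"
    using card_ksets_superset[of V "{z, w}" 3] assms by simp
  have c2: "card {z, w} = 2" using assms(5) by simp
  have T: "card ?T + ((card V - 2) choose 3) = card V choose 3"
    using card_ksets_meet[of V "{z, w}" 3, unfolded c2] assms(1,3,4) by blast
  have "card A + card B = card ?S + card ?T"
    using assms(8) cross_bound_3(2)[OF assms(2)] S T by linarith
  moreover have fin: "finite ?S" "finite ?T" using finite_ksets[OF assms(1)] by auto
  have "card A \<le> card ?S" "card B \<le> card ?T" using fin assms by (auto intro: card_mono)
  ultimately have "card A = card ?S" "card B = card ?T" by linarith+
  then have "A = ?S" "B = ?T" using assms fin card_subset_eq by blast+
  then show ?thesis using assms(3-5) unfolding sporadic_pair_def by blast
qed

text \<open>Without \<open>z\<close>, the triple would have to contain the five other points. This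
  lifts information about traces of size two to whole members.\<close>

lemma cross_three_common_element:
  assumes "finite Y" "card Y = 6" "z \<in> Y" "card a = 3"
    and "\<And>y. y \<in> Y - {z} \<Longrightarrow> a \<inter> {z, y} \<noteq> {}"
  shows "z \<in> a"
proof (rule ccontr)
  assume "z \<notin> a"
  then have "Y - {z} \<subseteq> a" using assms(5) by auto
  moreover have "finite a" using assms(4) card.infinite by force
  ultimately have "card (Y - {z}) \<le> card a" by (intro card_mono)
  then show False using assms by simp
qed

text \<open>Of the 15 pairs in six points exactly 9 meet a given pair \<open>e\<close>, so the
  traces of \<open>B\<close> of size two are all of these, which forces \<open>e\<close> into every
  member of \<open>A\<close>. The member of \<open>A\<close> with trace \<open>e\<close> has its
  third point outside the six points; shifting that point to each of the other four shows that a
  member of \<open>B\<close> missing \<open>e\<close> would contain four points.\<close>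

lemma sporadic_of_single_trace:
  assumes V: "finite V" "ranked V r" "7 \<le> card V"
    and A: "A \<subseteq> ksets V 3" "shifted V r A" and B: "B \<subseteq> ksets V 3"
    and cross: "cross_intersecting A B"
    and tr: "card (trace (initial V r 6) 2 A) = 1" "9 \<le> card (trace (initial V r 6) 2 B)"
    and eq: "int (card A + card B) = cross_bound (card V) 3"
  shows "sporadic_pair V A B"
proof -
  let ?Y = "initial V r 6"
  have Y: "card ?Y = 6" "finite ?Y" "?Y \<subseteq> V"
    using card_initial[OF V(2), of 6] initial_subset[of V r 6] V by (auto intro: finite_subset)
  have meet: "a \<inter> b \<inter> ?Y \<noteq> {}" if "a \<in> A" "b \<in> B" for a b
    using shifted_cross_meet_initial[OF V(1,2) _ A B cross that] V(3) by simp
  obtain e where e: "trace ?Y 2 A = {e}" using tr(1) card_1_singletonE by blast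
  then have "e \<in> trace ?Y 2 A" by simp
  then obtain a0 where a0: "a0 \<in> A" "e = a0 \<inter> ?Y" and ek: "e \<subseteq> ?Y" "card e = 2"
    unfolding trace_def ksets_def by auto
  obtain z w where zw: "e = {z, w}" "z \<noteq> w" using ek(2) by (auto simp: card_2_iff)
  have zwY: "z \<in> ?Y" "w \<in> ?Y" using zw ek by auto
  have B2: "trace ?Y 2 B = {G \<in> ksets ?Y 2. G \<inter> e \<noteq> {}}"
  proof (rule card_seteq)
    show "finite {G \<in> ksets ?Y 2. G \<inter> e \<noteq> {}}" using finite_ksets[OF Y(2)] by auto
    show "trace ?Y 2 B \<subseteq> {G \<in> ksets ?Y 2. G \<inter> e \<noteq> {}}"
      using meet[OF a0(1)] unfolding trace_def a0(2) by blast
    have "card {G \<in> ksets ?Y 2. G \<inter> e \<noteq> {}} + ((6 - 2) choose 2) = 6 choose 2"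
      using card_ksets_meet[OF Y(2) ek(1), of 2] Y(1) ek(2) by simp
    then show "card {G \<in> ksets ?Y 2. G \<inter> e \<noteq> {}} \<le> card (trace ?Y 2 B)"
      using tr(2) by (simp add: choose_two)
  qed
  have meetB2: "a \<inter> G \<noteq> {}" if "a \<in> A" "G \<in> trace ?Y 2 B" for a G
    using meet that unfolding trace_def by blast
  have A3: "card a = 3" if "a \<in> A" for a using that A unfolding ksets_def by auto
  have inA: "x \<in> a" if x: "x \<in> e" and a: "a \<in> A" for a x
  proof (rule cross_three_common_element[OF Y(2,1) _ A3[OF a]])
    show "x \<in> ?Y" using x ek by auto
    fix y assume "y \<in> ?Y - {x}"
    then have "{x, y} \<in> trace ?Y 2 B" using x ek unfolding B2 ksets_def by auto
    then show "a \<inter> {x, y} \<noteq> {}" by (rule meetB2[OF a])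
  qed
  have A_sub: "A \<subseteq> {F \<in> ksets V 3. {z, w} \<subseteq> F}" using inA zw A by auto
  have "\<not> a0 \<subseteq> ?Y" using a0 A3[OF a0(1)] ek by (metis Int_absorb2 numeral_eq_iff semiring_norm(88,89))
  then obtain x where x: "x \<in> a0" "x \<notin> ?Y" by auto
  have a0x: "a0 - {x} = e"
  proof -
    have "finite a0" using A3[OF a0(1)] card.infinite by force
    then have "card (a0 - {x}) = 2" using A3[OF a0(1)] x by simp
    moreover have "e \<subseteq> a0 - {x}" using a0 x by auto
    ultimately show ?thesis using ek(2) \<open>finite a0\<close> by (metis card_subset_eq finite_Diff)
  qed
  have B_meet: "b \<inter> {z, w} \<noteq> {}" if b: "b \<in> B" for b
  proof
    assume no: "b \<inter> {z, w} = {}"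
    have "y \<in> b" if y: "y \<in> ?Y - e" for y
    proof -
      have "r y < r x" using x y A a0 unfolding initial_def ksets_def by fastforce
      moreover have "y \<notin> a0" using y a0 by auto
      ultimately have "insert y e \<in> A" using shiftedD[OF A(2) a0(1) x(1), of y] y Y a0x by auto
      then have "insert y e \<inter> b \<noteq> {}" using cross b unfolding cross_intersecting_def by blast
      then show ?thesis using no zw by auto
    qed
    then have "?Y - e \<subseteq> b" by auto
    moreover have "card (?Y - e) = 4" using Y ek by (simp add: card_Diff_subset finite_subset)
    moreover have "card b = 3" using b B unfolding ksets_def by auto
    moreover have "finite b" using \<open>card b = 3\<close> card.infinite by force
    ultimately show False using card_mono[of b "?Y - e"] by simp
  qed
  have "B \<subseteq> {F \<in> ksets V 3. F \<inter> {z, w} \<noteq> {}}" using B_meet B by auto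
  then show ?thesis
    using sporadic_edge[OF V(1) _ _ _ zw(2) A_sub _ eq] V(3) zwY Y(3) by auto
qed

text \<open>Sizes 2 and 8 are impossible, as at most \<open>15 - 6 - 6 + 3 = 6\<close> pairs meet
  two distinct pairs. With sizes at least 3, a total above 6 forces a common point, and two stars on
  six points have just the 10 edges required.\<close>

lemma cross_pairs_on_six:
  assumes "finite Y" "card Y = 6" "A \<subseteq> ksets Y 2" "B \<subseteq> ksets Y 2" "cross_intersecting A B"
    and "2 \<le> card A" "2 \<le> card B" "card A + card B = 10"
  obtains z where "z \<in> Y" "A = {F \<in> ksets Y 2. z \<in> F}" "B = {F \<in> ksets Y 2. z \<in> F}"
proof -
  have two: False if AB: "A' \<subseteq> ksets Y 2" "B' \<subseteq> ksets Y 2" "cross_intersecting A' B'"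
    "card A' = 2" "card B' = 8" for A' B'
  proof -
    obtain P Q where PQ: "A' = {P, Q}" "P \<noteq> Q" using AB(4) by (auto simp: card_2_iff)
    then have P: "P \<subseteq> Y" "card P = 2" and Q: "Q \<subseteq> Y" "card Q = 2"
      using AB(1) unfolding ksets_def by auto
    have fPQ: "finite P" "finite Q" using P Q assms(1) by (auto intro: finite_subset)
    have "card (P \<union> Q) \<ge> 3"
    proof (rule ccontr)
      assume "\<not> 3 \<le> card (P \<union> Q)"
      then have "P = P \<union> Q" "Q = P \<union> Q"
        using P Q fPQ by (intro card_seteq; simp)+
      then show False using PQ by auto
    qed
    then have "(6 - card (P \<union> Q)) choose 2 \<le> 3 choose 2" by (intro binomial_right_mono) auto
    then have "card {F \<in> ksets Y 2. F \<inter> P \<noteq> {} \<and> F \<inter> Q \<noteq> {}} \<le> 6"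
      using card_ksets_meet_both[OF assms(1) P(1) Q(1), of 2] P Q assms(2) by (simp add: choose_two)
    moreover have "B' \<subseteq> {F \<in> ksets Y 2. F \<inter> P \<noteq> {} \<and> F \<inter> Q \<noteq> {}}"
      using AB(2,3) PQ unfolding cross_intersecting_def by (auto simp: Int_commute)
    then have "card B' \<le> card {F \<in> ksets Y 2. F \<inter> P \<noteq> {} \<and> F \<inter> Q \<noteq> {}}"
      using finite_ksets[OF assms(1)] by (intro card_mono) auto
    ultimately show False using AB(5) by simp
  qed
  have "card A \<noteq> 2" using two[OF assms(3-5)] assms(8) by auto
  moreover have "card B \<noteq> 2"
    using two[OF assms(4,3) assms(5)[unfolded cross_intersecting_commute[of A B]]] assms(8) by auto
  ultimately have "\<exists>z. \<forall>e\<in>A \<union> B. z \<in> e"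
    using cross_pairs_bound[OF assms(3-5)] assms(6-8) by fastforce
  then obtain z where z: "\<forall>e\<in>A \<union> B. z \<in> e" by auto
  have "A \<noteq> {}" using assms(6) by auto
  then have zY: "z \<in> Y" using z assms(3) unfolding ksets_def by auto
  let ?S = "{F \<in> ksets Y 2. z \<in> F}"
  have "card ?S = 5" using card_ksets_superset[OF assms(1), of "{z}" 2] zY assms(2) by simp
  moreover have fin: "finite ?S" using finite_ksets[OF assms(1)] by auto
  moreover have sub: "A \<subseteq> ?S" "B \<subseteq> ?S" using z assms(3,4) by auto
  moreover have "card A \<le> card ?S" "card B \<le> card ?S" using fin sub by (auto intro: card_mono)
  ultimately have "card A = card ?S" "card B = card ?S" using assms(8) by linarith+
  then have "A = ?S" "B = ?S" using sub fin card_subset_eq by blast+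
  then show ?thesis using that zY by blast
qed


text \<open>Traces are compared with the sets meeting both the initial segment and a second member
  one exchange away. Below level \<open>l\<close>, either one side is empty and
  \<open>trace_meet_both\<close> applies, or the bound for nonempty pairs does. Equality forces
  tightness at level \<open>l - 1\<close>, which \<open>cross_bound_trace_aux\<close> permits only
  for \<open>l = 3\<close>; there the traces of size two identify the pair.\<close>

theorem shifted_cross_bound_large:
  assumes V: "finite V" "ranked V r" "3 \<le> l" "2 * l < card V"
    and A: "A \<subseteq> ksets V l" "shifted V r A" "3 \<le> card A"
    and B: "B \<subseteq> ksets V l" "shifted V r B" "3 \<le> card B"
    and cross: "cross_intersecting A B"
  shows "int (card A + card B) \<le> cross_bound (card V) l"
    and "int (card A + card B) = cross_bound (card V) l \<Longrightarrow> l = 3 \<and> sporadic_pair V A B"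
proof -
  have V3: "2 * l \<le> card V" using V by simp
  have cross': "cross_intersecting B A" using cross cross_intersecting_commute by blast
  let ?Y = "initial V r (2 * l)" and ?P = "initial V r l"
  have Y: "card ?Y = 2 * l" "ranked ?Y r" "finite ?Y" "?Y \<subseteq> V"
    using card_initial[OF V(2) V3] initial_subset[of V r "2*l"] V(1) by (auto intro: finite_subset)
  have P: "card ?P = l" "?P \<subseteq> ?Y" "?P \<subseteq> V"
    using card_initial[OF V(2)] V3 unfolding initial_def by auto
  have ne: "A \<noteq> {}" "B \<noteq> {}" using A(3) B(3) by auto
  have PA: "?P \<in> A" and PB: "?P \<in> B"
    using V V3 A B ne shifted_initial_mem[of V r l] by auto
  have "l < 2 * l" "2 \<le> card A" "2 \<le> card B" using V A B by auto
  then obtain QA QB where QA: "QA \<in> A" "QA \<subseteq> ?Y" "card (?P \<union> QA) = l + 1"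
    and QB: "QB \<in> B" "QB \<subseteq> ?Y" "card (?P \<union> QB) = l + 1"
    using shifted_second_mem[OF V(1,2) _ V3 A(1,2)] shifted_second_mem[OF V(1,2) _ V3 B(1,2)]
    by metis
  have Ql: "card QA = l" "card QB = l" using QA QB A B unfolding ksets_def by auto
  let ?R = "\<lambda>G. G \<inter> ?P \<noteq> {} \<and> G \<inter> QA \<noteq> {}"
  have R_card: "card {G \<in> ksets ?Y i. ?R G} + 2 * (l choose i)
      = ((2 * l) choose i) + ((l - 1) choose i)" for i
    using card_ksets_meet_both[OF Y(3) P(2) QA(2), of i] Y P QA Ql by simp
  \<comment> \<open>The traces of \<open>A\<close> are restricted by \<open>QB\<close> and those of
    \<open>B\<close> by \<open>QA\<close>; both restrictions leave equally many sets, so one target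
    serves both families.\<close>
  have R_card': "card {G \<in> ksets ?Y i. G \<inter> ?P \<noteq> {} \<and> G \<inter> QB \<noteq> {}} = card {G \<in> ksets ?Y i. ?R G}" for i
    using card_ksets_meet_both[OF Y(3) P(2) QB(2), of i] Y P QB Ql R_card[of i] by simp
  note mA = trace_meet_both[OF V(1,2) V3 A(1,2) B(1) cross PA QA(1) P(2) QA(2)]
  note mB = trace_meet_both[OF V(1,2) V3 B(1,2) A(1) cross' PB QB(1) P(2) QB(2), unfolded R_card']
  have cr: "cross_intersecting (trace ?Y i A) (trace ?Y i' B)" for i i'
    using trace_cross_intersecting[OF V(1,2) V3 A(1,2) B(1) cross] .
  have both: "1 \<le> i" "card (trace ?Y i A) + card (trace ?Y i B) + ((2 * l - i) choose i) \<le> ((2 * l) choose i) + 1"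
    if i: "i < l" and n: "trace ?Y i A \<noteq> {}" "trace ?Y i B \<noteq> {}" for i
  proof -
    show "card (trace ?Y i A) + card (trace ?Y i B) + ((2 * l - i) choose i) \<le> ((2 * l) choose i) + 1"
      using shifted_cross_intersecting_bound[OF Y(3,2) _ trace_subset trace_shifted[OF V(1) A(1,2)] n(1)
        trace_subset trace_shifted[OF V(1) B(1,2)] n(2) cr] i Y(1) by simp
    have "{} \<notin> trace ?Y i A" using cr[of i i] n(2) unfolding cross_intersecting_def by auto
    moreover obtain G where "G \<in> trace ?Y i A" using n(1) by auto
    moreover then have "G \<subseteq> ?Y" "card G = i" unfolding trace_def ksets_def by auto
    moreover then have "finite G" using Y(3) finite_subset by blast
    ultimately show "1 \<le> i" by (metis One_nat_def Suc_leI card_gt_0_iff)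
  qed
  have low: "card (trace ?Y i A) + card (trace ?Y i B) \<le> card {G \<in> ksets ?Y i. ?R G}"
    if i: "i < l" for i
  proof (cases "trace ?Y i A = {} \<or> trace ?Y i B = {}")
    case True
    then show ?thesis using mA(1)[of i] mB(1)[of i] by auto
  next
    case False
    then show ?thesis
      using both[OF i] cross_bound_trace_aux(1)[OF _ i V(3)] R_card[of i] by linarith
  qed
  have "card (trace ?Y l A) + card (trace ?Y l B) \<le> (2 * l) choose l"
    using cross_intersecting_card_half[OF Y(3,1) trace_subset trace_subset cr] .
  then have top: "card (trace ?Y l A) + card (trace ?Y l B) \<le> card {G \<in> ksets ?Y l. ?R G} + 2"
    using R_card[of l] V(3) by simp
  have T: "{F \<in> ksets V l. ?R (F \<inter> ?Y)} = {F \<in> ksets V l. F \<inter> ?P \<noteq> {} \<and> F \<inter> QA \<noteq> {}}"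
    using P QA by blast
  have bound: "int (card {F \<in> ksets V l. ?R (F \<inter> ?Y)}) + 2 = cross_bound (card V) l"
    unfolding T using card_meet_both_eq_cross_bound[OF V(1) P(3) _ P(1) Ql(1) QA(3)] QA(2) Y(4) V(3)
    by auto
  note cmp = trace_compare[where R = ?R, OF V(1) Y(4) A(1) B(1) low top]
  show "int (card A + card B) \<le> cross_bound (card V) l" using cmp(1) bound by linarith
  assume eq: "int (card A + card B) = cross_bound (card V) l"
  \<comment> \<open>Level \<open>l - 1\<close> has weight \<open>card V - 2 * l\<close>, which is
    positive, so a deficit there would contradict equality.\<close>
  have "\<not> card (trace ?Y (l - 1) A) + card (trace ?Y (l - 1) B) < card {G \<in> ksets ?Y (l - 1). ?R G}"
  proof -
    have "l - (l - 1) \<le> card V - card ?Y" "l - 1 < l" using V Y(1) by linarith+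
    then show ?thesis using cmp(2)[of "l - 1"] eq bound by linarith
  qed
  then have tight: "card (trace ?Y (l - 1) A) + card (trace ?Y (l - 1) B) = card {G \<in> ksets ?Y (l - 1). ?R G}"
    using low[of "l - 1"] V(3) by simp
  \<comment> \<open>If one side were empty, the other would have to fill the target alone, against
    the strict part of \<open>trace_meet_both\<close>.\<close>
  have n: "trace ?Y (l - 1) A \<noteq> {}" "trace ?Y (l - 1) B \<noteq> {}"
    using mA(2)[OF A(3) V(3)] mB(2)[OF B(3) V(3)] tight by auto
  have "\<not> 4 \<le> l"
    using both[OF _ n] cross_bound_trace_aux(2)[of "l - 1" l] R_card[of "l - 1"] V(3) tight by auto
  then have l: "l = 3" using V(3) by simp
  have R10: "card {G \<in> ksets ?Y 2. ?R G} = 10" using R_card[of 2] l by (simp add: choose_two)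
  let ?A2 = "trace (initial V r 6) 2 A" and ?B2 = "trace (initial V r 6) 2 B"
  have t10: "card ?A2 + card ?B2 = 10" using tight R10 l by simp
  have fin2: "finite ?A2" "finite ?B2"
    using finite_subset[OF trace_subset finite_ksets[OF Y(3)]] l by auto
  then have pos: "1 \<le> card ?A2" "1 \<le> card ?B2" using n l by (auto simp: Suc_le_eq card_gt_0_iff)
  have V7: "7 \<le> card V" using V(4) l by simp
  note A' = A[unfolded l] and B' = B[unfolded l] and eq' = eq[unfolded l]
  have "sporadic_pair V A B"
  proof -
    consider "card ?A2 = 1" | "card ?B2 = 1" | "2 \<le> card ?A2" "2 \<le> card ?B2" using pos by linarith
    then show ?thesis
    proof cases
      case 1
      then show ?thesis
        using sporadic_of_single_trace[OF V(1,2) V7 A'(1,2) B'(1) cross] t10 eq' by simp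
    next
      case 2
      then have "sporadic_pair V B A"
        using sporadic_of_single_trace[OF V(1,2) V7 B'(1,2) A'(1) cross'] t10 eq' by (simp add: add.commute)
      then show ?thesis by (rule sporadic_pair_sym)
    next
      case 3
      have Y6: "finite (initial V r 6)" "card (initial V r 6) = 6" using Y l by auto
      have cr2: "cross_intersecting ?A2 ?B2" using cr[of 2 2] l by simp
      obtain z where z: "z \<in> initial V r 6" "?A2 = {F \<in> ksets (initial V r 6) 2. z \<in> F}"
        "?B2 = {F \<in> ksets (initial V r 6) 2. z \<in> F}"
        using cross_pairs_on_six[OF Y6 trace_subset trace_subset cr2 3 t10] by blast
      have meet: "a \<inter> b \<inter> initial V r 6 \<noteq> {}" if "a \<in> A" "b \<in> B" for a b
        using shifted_cross_meet_initial[OF V(1,2) V3 A(1,2) B(1) cross that] l by simp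
      have mem: "{z, y} \<in> {F \<in> ksets (initial V r 6) 2. z \<in> F}" if "y \<in> initial V r 6 - {z}" for y
        using that z(1) unfolding ksets_def by auto
      have "z \<in> a" if a: "a \<in> A" for a
      proof (rule cross_three_common_element[OF Y6 z(1)])
        show "card a = 3" using a A' unfolding ksets_def by auto
        fix y assume "y \<in> initial V r 6 - {z}"
        then have "{z, y} \<in> ?B2" using mem z(3) by simp
        then show "a \<inter> {z, y} \<noteq> {}" using meet[OF a] unfolding trace_def by blast
      qed
      moreover have "z \<in> b" if b: "b \<in> B" for b
      proof (rule cross_three_common_element[OF Y6 z(1)])
        show "card b = 3" using b B' unfolding ksets_def by auto
        fix y assume "y \<in> initial V r 6 - {z}"
        then have "{z, y} \<in> ?A2" using mem z(2) by simp
        then show "b \<inter> {z, y} \<noteq> {}" using meet[OF _ b] unfolding trace_def by blast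
      qed
      ultimately have "A \<subseteq> {F \<in> ksets V 3. z \<in> F}" "B \<subseteq> {F \<in> ksets V 3. z \<in> F}"
        using A' B' by auto
      moreover have "z \<in> V" using z(1) initial_subset[of V r 6] by auto
      ultimately show ?thesis using sporadic_star[OF V(1) _ _ _ _ eq'] V7 by auto
    qed
  qed
  then show "l = 3 \<and> sporadic_pair V A B" using l by simp
qed


section \<open>Compression\<close>

text \<open>The classical shift of \<open>j\<close> to \<open>i\<close>. A member stays put when its
  image is already present, which is what makes the map injective on \<open>A\<close>.\<close>

definition compress :: "'a \<Rightarrow> 'a \<Rightarrow> 'a set set \<Rightarrow> 'a set set" where
  "compress i j A =
    (\<lambda>F. if j \<in> F \<and> i \<notin> F \<and> insert i (F - {j}) \<notin> A then insert i (F - {j}) else F) ` A"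

lemma exchange_inverse:
  assumes "j \<in> F" "i \<notin> F"
  shows "insert j (insert i (F - {j}) - {i}) = F"
  using assms by auto

lemma mem_compress_iff:
  assumes "i \<noteq> j"
  shows "F \<in> compress i j A \<longleftrightarrow>
    (if i \<in> F \<and> j \<notin> F then F \<in> A \<or> insert j (F - {i}) \<in> A
     else if j \<in> F \<and> i \<notin> F then F \<in> A \<and> insert i (F - {j}) \<in> A
     else F \<in> A)"
    (is "_ \<longleftrightarrow> ?R")
proof
  assume "F \<in> compress i j A"
  then obtain G where G: "G \<in> A"
    "F = (if j \<in> G \<and> i \<notin> G \<and> insert i (G - {j}) \<notin> A then insert i (G - {j}) else G)"
    unfolding compress_def by auto
  show ?R
  proof (cases "j \<in> G \<and> i \<notin> G \<and> insert i (G - {j}) \<notin> A")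
    case True
    then have "F = insert i (G - {j})" using G by simp
    moreover from this have "insert j (F - {i}) = G" using True exchange_inverse[of j G i] by simp
    ultimately show ?thesis using True G assms by simp
  next
    case False
    then have "F = G" using G by auto
    then show ?thesis using False G by auto
  qed
next
  assume R: ?R
  show "F \<in> compress i j A"
  proof (cases "F \<in> A")
    case True
    then show ?thesis using R unfolding compress_def by (intro image_eqI[of _ _ F]) (auto split: if_splits)
  next
    case False
    then have F: "i \<in> F" "j \<notin> F" "insert j (F - {i}) \<in> A" using R by (auto split: if_splits)
    have "insert i (insert j (F - {i}) - {j}) = F" using F(1,2) exchange_inverse[of i F j] by simp
    then show ?thesis using F False assms unfolding compress_def
      by (intro image_eqI[of _ _ "insert j (F - {i})"]) auto
  qed
qed

lemma inj_on_compress: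
  "inj_on (\<lambda>F. if j \<in> F \<and> i \<notin> F \<and> insert i (F - {j}) \<notin> A then insert i (F - {j}) else F) A"
proof (rule inj_onI)
  let ?f = "\<lambda>F. if j \<in> F \<and> i \<notin> F \<and> insert i (F - {j}) \<notin> A then insert i (F - {j}) else F"
  fix F G assume FG: "F \<in> A" "G \<in> A" "?f F = ?f G"
  show "F = G"
  proof (cases "?f F = F")
    case True
    then show ?thesis using FG by (auto split: if_splits)
  next
    case False
    then have F: "j \<in> F" "i \<notin> F" "insert i (F - {j}) \<notin> A" "?f F = insert i (F - {j})"
      by (auto split: if_splits)
    then have G: "j \<in> G" "i \<notin> G" "insert i (G - {j}) = insert i (F - {j})"
      using FG by (auto split: if_splits)
    then show ?thesis using exchange_inverse[OF F(1,2)] exchange_inverse[OF G(1,2)] by simp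
  qed
qed

lemma card_compress: "card (compress i j A) = card A"
  unfolding compress_def by (rule card_image[OF inj_on_compress])

lemma compress_ksets:
  assumes "finite V" "i \<in> V" "A \<subseteq> ksets V l"
  shows "compress i j A \<subseteq> ksets V l"
proof
  fix F assume "F \<in> compress i j A"
  then obtain G where G: "G \<in> A" "F = G \<or> j \<in> G \<and> i \<notin> G \<and> F = insert i (G - {j})"
    unfolding compress_def by auto
  then have k: "G \<in> ksets V l" using assms(3) by auto
  have "insert i (G - {j}) \<in> ksets V l" if "j \<in> G" "i \<notin> G"
    using card_exchange[OF ksets_finite_mem[OF assms(1) k] that] k assms(2)
    unfolding ksets_def by auto
  then show "F \<in> ksets V l" using G k by auto
qed

text \<open>Only a moved set \<open>a'\<close> is critical. If \<open>b'\<close> missed it, then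
  \<open>b'\<close> would miss \<open>i\<close>, hence be an unmoved member of \<open>B\<close>. It
  must meet the preimage of \<open>a'\<close>, which can happen only in \<open>j\<close>; but then
  \<open>b'\<close> stayed because its own image is in \<open>B\<close>, and that image misses the
  preimage of \<open>a'\<close>.\<close>

lemma compress_cross_intersecting:
  assumes "i \<noteq> j" "cross_intersecting A B"
  shows "cross_intersecting (compress i j A) (compress i j B)"
proof -
  have half: "a' \<inter> b' \<noteq> {}"
    if AB: "cross_intersecting A B" and a': "a' \<in> compress i j A" "a' \<notin> A"
      and b': "b' \<in> compress i j B" for A B a' b'
  proof
    assume e: "a' \<inter> b' = {}"
    have a: "i \<in> a'" "j \<notin> a'" "insert j (a' - {i}) \<in> A"
      using a' mem_compress_iff[OF assms(1)] by (auto split: if_splits)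
    then have "i \<notin> b'" using e by auto
    then have b: "b' \<in> B" "j \<in> b' \<Longrightarrow> insert i (b' - {j}) \<in> B"
      using b' mem_compress_iff[OF assms(1), of b' B] by (auto split: if_splits)
    have "insert j (a' - {i}) \<inter> b' \<noteq> {}" using AB a(3) b(1) unfolding cross_intersecting_def by blast
    then have "j \<in> b'" using e by auto
    then have "insert j (a' - {i}) \<inter> insert i (b' - {j}) \<noteq> {}"
      using AB a(3) b(2) unfolding cross_intersecting_def by blast
    then show False using e assms(1) by auto
  qed
  show ?thesis
    unfolding cross_intersecting_def
  proof (intro ballI)
    fix a b assume ab: "a \<in> compress i j A" "b \<in> compress i j B"
    consider "a \<in> A" "b \<in> B" | "a \<notin> A" | "b \<notin> B" by auto
    then show "a \<inter> b \<noteq> {}"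
    proof cases
      case 1
      then show ?thesis using assms(2) unfolding cross_intersecting_def by blast
    next
      case 2
      then show ?thesis using half[OF assms(2) ab(1) _ ab(2)] by blast
    next
      case 3
      then show ?thesis
        using half[OF assms(2)[unfolded cross_intersecting_commute[of A]] ab(2) _ ab(1)]
        by (simp add: Int_commute)
    qed
  qed
qed

definition weight :: "('a \<Rightarrow> nat) \<Rightarrow> 'a set set \<Rightarrow> nat" where
  "weight r A = (\<Sum>F\<in>A. sum r F)"

lemma weight_compress:
  assumes V: "finite V" "A \<subseteq> ksets V l" and ij: "r i < r j"
  shows "weight r (compress i j A) \<le> weight r A"
    and "\<lbrakk>F \<in> A; j \<in> F; i \<notin> F; insert i (F - {j}) \<notin> A\<rbrakk>
      \<Longrightarrow> weight r (compress i j A) < weight r A"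
proof -
  let ?f = "\<lambda>F. if j \<in> F \<and> i \<notin> F \<and> insert i (F - {j}) \<notin> A then insert i (F - {j}) else F"
  have eq: "weight r (compress i j A) = (\<Sum>F\<in>A. sum r (?f F))"
    unfolding weight_def compress_def using sum.reindex[OF inj_on_compress, of "sum r" j i A]
    by (simp add: comp_def)
  have finA: "finite A" using V finite_ksets finite_subset by blast
  have less: "sum r (insert i (F - {j})) < sum r F" if "F \<in> A" "j \<in> F" "i \<notin> F" for F
    using sum_exchange_less[OF _ that(2,3) ij] ksets_finite_mem[OF V(1)] V(2) that(1) by blast
  have le: "sum r (?f F) \<le> sum r F" if "F \<in> A" for F
    using less[OF that] by (auto intro: less_imp_le)
  show "weight r (compress i j A) \<le> weight r A"
    unfolding eq unfolding weight_def by (rule sum_mono) (rule le)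
  assume F: "F \<in> A" "j \<in> F" "i \<notin> F" "insert i (F - {j}) \<notin> A"
  show "weight r (compress i j A) < weight r A"
    unfolding eq unfolding weight_def
  proof (rule sum_strict_mono_ex1[OF finA])
    show "\<forall>x\<in>A. sum r (?f x) \<le> sum r x" using le by blast
    show "\<exists>x\<in>A. sum r (?f x) < sum r x" using F less[of F] by (intro bexI[of _ F]) auto
  qed
qed

section \<open>Undoing a compression that produces a sporadic pair\<close>

lemma compress_cases:
  assumes "F \<in> A"
  shows "F \<in> compress i j A \<or> j \<in> F \<and> i \<notin> F \<and> insert i (F - {j}) \<in> compress i j A"
  using assms unfolding compress_def by auto

text \<open>Each such \<open>e\<close> thus carries one of two colours, \<open>i\<close> or
  \<open>j\<close>, telling which extension belonged to the family before compression. Undoing a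
  compression means showing that the colouring is constant.\<close>

lemma compress_exactly_one:
  assumes "i \<noteq> j" "i \<notin> e" "j \<notin> e"
    and "insert i e \<in> compress i j A" "insert j e \<notin> compress i j A"
  shows "insert i e \<in> A \<longleftrightarrow> insert j e \<notin> A"
proof -
  have "insert j (insert i e - {i}) = insert j e" "insert i (insert j e - {j}) = insert i e"
    using assms by auto
  then show ?thesis
    using mem_compress_iff[OF assms(1), of "insert i e" A] mem_compress_iff[OF assms(1), of "insert j e" A]
      assms by auto
qed

lemma ksets_remove:
  assumes "finite V" "F \<in> ksets V (Suc k)" "x \<in> F" "y \<notin> F"
  shows "F - {x} \<in> ksets (V - {x, y}) k"
  using assms ksets_finite_mem[OF assms(1,2)] unfolding ksets_def by auto

lemma ksets_add:
  assumes "finite V" "e \<in> ksets (V - {x, y}) k" "x \<in> V"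
  shows "insert x e \<in> ksets V (Suc k)"
proof -
  have "finite e" using ksets_finite_mem[OF _ assms(2)] assms(1) by simp
  moreover have "x \<notin> e" using assms(2) unfolding ksets_def by auto
  ultimately show ?thesis using assms unfolding ksets_def by auto
qed

lemma subset_CollectI: "A \<subseteq> K \<Longrightarrow> (\<And>F. F \<in> A \<Longrightarrow> P F) \<Longrightarrow> A \<subseteq> {F \<in> K. P F}"
  by auto

text \<open>Only the centre \<open>z = i\<close> is critical. Then each pair outside
  \<open>i\<close>, \<open>j\<close> has a colour in \<open>A\<close> and one in \<open>B\<close>,
  and cross-intersection makes disjoint pairs agree across the two families. On at least five
  remaining points any two pairs are linked by a chain of disjoint ones, so all colours coincide,
  and the common colour is the centre of both families.\<close>

lemma uncompress_star:
  assumes V: "finite V" "7 \<le> card V" and ij: "i \<in> V" "j \<in> V" "i \<noteq> j"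
    and A: "A \<subseteq> ksets V 3" and B: "B \<subseteq> ksets V 3" and cross: "cross_intersecting A B"
    and cA: "compress i j A = {F \<in> ksets V 3. z \<in> F}"
    and cB: "compress i j B = {F \<in> ksets V 3. z \<in> F}"
  shows "\<exists>z'\<in>{z, j}. A \<subseteq> {F \<in> ksets V 3. z' \<in> F} \<and> B \<subseteq> {F \<in> ksets V 3. z' \<in> F}"
proof (cases "z = i")
  case False
  have "C \<subseteq> {F \<in> ksets V 3. z \<in> F}" if "C \<subseteq> ksets V 3" "compress i j C = {F \<in> ksets V 3. z \<in> F}" for C
    using compress_cases[of _ C i j] that False by fastforce
  then show ?thesis using A B cA cB by blast
next
  case True
  define E where "E = ksets (V - {i, j}) 2"
  define good where "good C \<longleftrightarrow> C \<subseteq> ksets V 3 \<and> compress i j C = {F \<in> ksets V 3. i \<in> F}" for C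
  have gA: "good A" "good B" using A B cA cB True unfolding good_def by auto
  have E: "e \<subseteq> V - {i, j}" "card e = 2" "finite e" "i \<notin> e" "j \<notin> e" if "e \<in> E" for e
    using that ksets_finite_mem[of "V - {i, j}" e 2] V(1) unfolding E_def ksets_def by auto
  have one: "insert i e \<in> C \<longleftrightarrow> insert j e \<notin> C" if "good C" "e \<in> E" for C e
  proof (rule compress_exactly_one[OF ij(3)])
    have "insert i e \<in> ksets V 3" using ksets_add[OF V(1), of e i j 2] that(2) ij unfolding E_def by simp
    then show "insert i e \<in> compress i j C" using that(1) unfolding good_def by auto
    show "insert j e \<notin> compress i j C" using that E[OF that(2)] ij unfolding good_def by auto
  qed (use E[OF that(2)] in auto)
  have step: "insert j f \<in> D"
    if "good D" "cross_intersecting C D" "e \<in> E" "f \<in> E" "e \<inter> f = {}" "insert j e \<in> C" for C D e f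
  proof (rule ccontr)
    assume "insert j f \<notin> D"
    then have "insert i f \<in> D" using one[OF that(1,4)] by blast
    then have "insert j e \<inter> insert i f \<noteq> {}" using that(2,6) unfolding cross_intersecting_def by blast
    then show False using that(5) E[OF that(3)] E[OF that(4)] ij by auto
  qed
  have V': "card (V - {i, j}) \<ge> 5" using V ij by simp
  have near: "insert j f \<in> C"
    if "good C" "good D" "cross_intersecting C D" "e \<in> E" "f \<in> E" "card (e \<union> f) \<le> 3" "insert j e \<in> C" for C D e f
  proof -
    have "card (V - {i, j} - (e \<union> f)) \<ge> 2"
      using V' that(6) E[OF that(4)] E[OF that(5)] V(1)
        diff_card_le_card_Diff[of "e \<union> f" "V - {i, j}"] by simp
    then obtain g where g: "g \<subseteq> V - {i, j} - (e \<union> f)" "card g = 2"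
      using obtain_subset_with_card_n by metis
    then have gE: "g \<in> E" "e \<inter> g = {}" "g \<inter> f = {}" unfolding E_def ksets_def by auto
    have "insert j g \<in> D" using step[OF that(2,3,4) gE(1,2) that(7)] .
    then show ?thesis
      using step[OF that(1) _ gE(1) that(5) gE(3)] that(3) cross_intersecting_commute by blast
  qed
  have all: "insert j f \<in> C"
    if C: "good C" "good D" "cross_intersecting C D" and e: "e \<in> E" "insert j e \<in> C" and f: "f \<in> E" for C D e f
  proof (cases "e \<inter> f = {}")
    case False
    then have "card (e \<inter> f) \<ge> 1" using E[OF e(1)] by (simp add: Suc_le_eq card_gt_0_iff)
    then have "card (e \<union> f) \<le> 3"
      using card_Un_Int[OF E(3)[OF e(1)] E(3)[OF f]] E(2)[OF e(1)] E(2)[OF f] by linarith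
    then show ?thesis using near[OF C e(1) f _ e(2)] by blast
  next
    case True
    obtain x x' where x: "e = {x, x'}" using E(2)[OF e(1)] by (auto simp: card_2_iff)
    obtain y y' where y: "f = {y, y'}" using E(2)[OF f] by (auto simp: card_2_iff)
    have "x \<noteq> y" using True x y by auto
    \<comment> \<open>A pair with one point from each of two disjoint pairs overlaps both, so
      \<open>near\<close> applies twice.\<close>
    have h: "{x, y} \<in> E" using E(1)[OF e(1)] E(1)[OF f] x y \<open>x \<noteq> y\<close> unfolding E_def ksets_def by auto
    have "e \<union> {x, y} = {x, x', y}" "{x, y} \<union> f = {x, y, y'}" using x y by auto
    then have "card (e \<union> {x, y}) \<le> 3" "card ({x, y} \<union> f) \<le> 3"
      using card_length[of "[x, x', y]"] card_length[of "[x, y, y']"] by simp_all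
    then show ?thesis using near[OF C e(1) h _ e(2)] near[OF C h f] by blast
  qed
  have star: "C \<subseteq> {F \<in> ksets V 3. u \<in> F}"
    if C: "good C" "\<And>e. e \<in> E \<Longrightarrow> insert v e \<notin> C" and uv: "{u, v} = {i, j}" for C u v
  proof (rule subset_CollectI)
    show Ck: "C \<subseteq> ksets V 3" using C(1) unfolding good_def by blast
    fix F assume F: "F \<in> C"
    then have Fk: "F \<in> ksets V (Suc 2)" using Ck by auto
    show "u \<in> F"
    proof (rule ccontr)
      assume u: "u \<notin> F"
      have "i \<in> F \<or> j \<in> F" using compress_cases[OF F, of i j] C(1) unfolding good_def by auto
      then have v: "v \<in> F" using u uv by (auto simp: doubleton_eq_iff)
      have "V - {v, u} = V - {i, j}" using uv by (auto simp: doubleton_eq_iff)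
      then have "F - {v} \<in> E" using ksets_remove[OF V(1) Fk v u] unfolding E_def by simp
      then show False using C(2)[of "F - {v}"] F v by (simp add: insert_absorb)
    qed
  qed
  have cross': "cross_intersecting B A" using cross cross_intersecting_commute by blast
  have transfer: "\<forall>e\<in>E. insert j e \<in> D"
    if C: "good C" "good D" "cross_intersecting C D" "cross_intersecting D C" and e: "e \<in> E" "insert j e \<in> C" for C D e
  proof -
    have "card (V - {i, j} - e) \<ge> 2"
      using V' E[OF e(1)] diff_card_le_card_Diff[of e "V - {i, j}"] by simp
    then obtain g where g: "g \<subseteq> V - {i, j} - e" "card g = 2"
      using obtain_subset_with_card_n by metis
    then have gE: "g \<in> E" "e \<inter> g = {}" unfolding E_def ksets_def by auto
    have "insert j g \<in> D" using step[OF C(2,3) e(1) gE e(2)] .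
    then show ?thesis using all[OF C(2,1,4) gE(1)] by blast
  qed
  show ?thesis
  proof (cases "(\<exists>e\<in>E. insert j e \<in> A) \<or> (\<exists>e\<in>E. insert j e \<in> B)")
    case True
    then have "(\<forall>e\<in>E. insert j e \<in> A) \<and> (\<forall>e\<in>E. insert j e \<in> B)"
      using transfer[OF gA cross cross'] transfer[OF gA(2,1) cross' cross] all[OF gA cross]
        all[OF gA(2,1) cross'] by blast
    then have "A \<subseteq> {F \<in> ksets V 3. j \<in> F}" "B \<subseteq> {F \<in> ksets V 3. j \<in> F}"
      using star[of A i j] star[of B i j] one gA by blast+
    then show ?thesis by blast
  next
    case False
    then have "A \<subseteq> {F \<in> ksets V 3. i \<in> F}" "B \<subseteq> {F \<in> ksets V 3. i \<in> F}"
      using star[of A j i] star[of B j i] gA by blast+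
    then show ?thesis using \<open>z = i\<close> by blast
  qed
qed


text \<open>For \<open>j \<noteq> w\<close> the third points \<open>x\<close> of the triples of
  \<open>A\<close> are coloured by \<open>i\<close> or \<open>j\<close>. Given two colours, a pair
  avoiding \<open>w\<close> and a point of each colour, extended by \<open>i\<close> or
  \<open>j\<close>, lies in \<open>B\<close> and misses a triple of \<open>A\<close> of the opposite
  colour. With the single colour \<open>u\<close>, a member of \<open>B\<close> missing
  \<open>u\<close> and \<open>w\<close> leaves some \<open>x\<close> free, and the triple of
  \<open>u\<close>, \<open>w\<close>, \<open>x\<close> would miss it.\<close>

lemma uncompress_edge_at:
  assumes V: "finite V" "7 \<le> card V" and ij: "i \<in> V" "j \<in> V" "i \<noteq> j" and w: "w \<in> V" "w \<noteq> i"
    and A: "A \<subseteq> ksets V 3" and B: "B \<subseteq> ksets V 3" and cross: "cross_intersecting A B"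
    and cA: "compress i j A = {F \<in> ksets V 3. {i, w} \<subseteq> F}"
    and cB: "compress i j B = {F \<in> ksets V 3. F \<inter> {i, w} \<noteq> {}}"
  shows "\<exists>x\<in>{i, j}. x \<noteq> w \<and> A \<subseteq> {F \<in> ksets V 3. {x, w} \<subseteq> F} \<and> B \<subseteq> {F \<in> ksets V 3. F \<inter> {x, w} \<noteq> {}}"
proof (cases "j = w")
  case True
  have 1: "{i, w} \<subseteq> F" if "F \<in> A" for F
    using compress_cases[OF that, of i j] cA True ij by auto
  have 2: "F \<inter> {i, w} \<noteq> {}" if "F \<in> B" for F
    using compress_cases[OF that, of i j] cB True by auto
  show ?thesis
    using subset_CollectI[OF A 1] subset_CollectI[OF B 2] w(2) by (intro bexI[of _ i]) simp_all
next
  case False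
  let ?V = "V - {i, j, w}"
  have "card {i, j, w} = 3" using ij w False by simp
  then have V': "card ?V \<ge> 4" using V ij w by (simp add: card_Diff_subset)
  have oneA: "{i, w, x} \<in> A \<longleftrightarrow> {j, w, x} \<notin> A" if x: "x \<in> ?V" for x
  proof (rule compress_exactly_one[OF ij(3)])
    show "{i, w, x} \<in> compress i j A" using x w ij unfolding cA ksets_def by auto
    show "{j, w, x} \<notin> compress i j A" using x w ij unfolding cA by auto
  qed (use x w False in auto)
  have oneB: "insert i e \<in> B \<longleftrightarrow> insert j e \<notin> B" if e: "e \<in> ksets ?V 2" for e
  proof (rule compress_exactly_one[OF ij(3)])
    have e': "e \<subseteq> ?V" "card e = 2" using e unfolding ksets_def by auto
    then have "finite e" "i \<notin> e" using V(1) by (auto intro: finite_subset)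
    then show "insert i e \<in> compress i j B" using e' ij unfolding cB ksets_def by auto
    show "insert j e \<notin> compress i j B" using e' w ij False unfolding cB by auto
  qed (use e in \<open>auto simp: ksets_def\<close>)
  have meet: "a \<inter> b \<noteq> {}" if "a \<in> A" "b \<in> B" for a b
    using cross that unfolding cross_intersecting_def by blast
  have Ak: "card F = 3" "F \<subseteq> V" "finite F" if "F \<in> A" for F
    using that A V(1) ksets_finite_mem[OF V(1), of F 3] unfolding ksets_def by blast+
  have Bk: "card F = 3" "F \<subseteq> V" "finite F" if "F \<in> B" for F
    using that B V(1) ksets_finite_mem[OF V(1), of F 3] unfolding ksets_def by blast+
  have third: "\<exists>x\<in>?V. F = {y, w, x}" if "F \<subseteq> V" "card F = 3" "finite F" "y \<in> F" "w \<in> F" "y' \<notin> F" "y \<noteq> w" "{y, y'} = {i, j}" for F y y'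
  proof -
    have "card (F - {y, w}) = 1" using that by (simp add: card_Diff_subset)
    then obtain x where x: "F - {y, w} = {x}" using card_1_singletonE by blast
    then have "F = {y, w, x}" "x \<notin> {y, w}" "x \<in> F" using that by blast+
    moreover have "x \<in> ?V" using \<open>x \<in> F\<close> \<open>x \<notin> {y, w}\<close> that by blast
    ultimately show ?thesis by blast
  qed
  have rest: "F - {y} \<in> ksets ?V 2" if "F \<subseteq> V" "card F = 3" "finite F" "y \<in> F" "w \<notin> F" "y' \<notin> F" "{y, y'} = {i, j}" for F y y'
  proof -
    have "card (F - {y}) = 2" using that by simp
    moreover have "F - {y} \<subseteq> ?V" using that by blast
    ultimately show ?thesis unfolding ksets_def by simp
  qed
  have outside: "\<exists>x\<in>?V. x \<notin> e" if "e \<in> ksets ?V 2" for e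
  proof -
    have "e \<noteq> ?V" using that V' unfolding ksets_def by auto
    then show ?thesis using that unfolding ksets_def by blast
  qed
  have half: ?thesis
    if all: "\<And>x. x \<in> ?V \<Longrightarrow> {u, w, x} \<in> A \<and> {v, w, x} \<notin> A"
      and uv: "{u, v} = {i, j}" "{v, u} = {i, j}" "u \<in> {i, j}" "u \<noteq> w" "v \<noteq> w" for u v
  proof -
    have a: "{u, w} \<subseteq> F" if F: "F \<in> A" for F
    proof (rule ccontr)
      assume no: "\<not> {u, w} \<subseteq> F"
      have "w \<in> F" "i \<in> F \<or> j \<in> F" using compress_cases[OF F, of i j] cA w by auto
      then have "v \<in> F" "u \<notin> F" using no uv(1) by (auto simp: doubleton_eq_iff)
      then obtain x where "x \<in> ?V" "F = {v, w, x}"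
        using third[OF Ak(2,1,3)[OF F] _ \<open>w \<in> F\<close> _ uv(5,2)] by blast
      then show False using all F by blast
    qed
    have b: "F \<inter> {u, w} \<noteq> {}" if F: "F \<in> B" for F
    proof
      assume no: "F \<inter> {u, w} = {}"
      have "i \<in> F \<or> j \<in> F \<or> w \<in> F" using compress_cases[OF F, of i j] cB by auto
      then have "v \<in> F" "w \<notin> F" "u \<notin> F" using no uv(1) by (auto simp: doubleton_eq_iff)
      then have "F - {v} \<in> ksets ?V 2" using rest[OF Bk(2,1,3)[OF F] _ _ _ uv(2)] by blast
      then obtain x where x: "x \<in> ?V" "x \<notin> F - {v}" using outside by blast
      then have "{u, w, x} \<inter> F \<noteq> {}" using meet[OF _ F] all by blast
      moreover have "x \<noteq> v" using x(1) uv(1) by (auto simp: doubleton_eq_iff)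
      ultimately show False using no x(2) by auto
    qed
    show ?thesis
      using subset_CollectI[OF A a] subset_CollectI[OF B b] uv(3,4) by (intro bexI[of _ u]) simp_all
  qed
  consider "\<forall>x\<in>?V. {i, w, x} \<in> A" | "\<forall>x\<in>?V. {j, w, x} \<in> A"
    | x y where "x \<in> ?V" "y \<in> ?V" "{i, w, x} \<in> A" "{j, w, y} \<in> A" using oneA by blast
  then show ?thesis
  proof cases
    case 1
    then show ?thesis using half[of i j] oneA w(2) False by (simp add: insert_commute)
  next
    case 2
    then show ?thesis using half[of j i] oneA w(2) False by (simp add: insert_commute)
  next
    case (3 x y)
    have "card {x, y} \<le> 2" using card_length[of "[x, y]"] by simp
    then have "card (?V - {x, y}) \<ge> 2"
      using V' diff_card_le_card_Diff[of "{x, y}" ?V] by simp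
    then obtain e where e: "e \<subseteq> ?V - {x, y}" "card e = 2" using obtain_subset_with_card_n by metis
    then have "e \<in> ksets ?V 2" unfolding ksets_def by auto
    then consider "insert i e \<in> B" | "insert j e \<in> B" using oneB by blast
    then show ?thesis
    proof cases
      case 1
      then show ?thesis using meet[OF 3(4) 1] e 3 ij w by auto
    next
      case 2
      then show ?thesis using meet[OF 3(3) 2] e 3 ij w False by auto
    qed
  qed
qed

lemma sporadic_uncompress:
  assumes V: "finite V" "7 \<le> card V" and ij: "i \<in> V" "j \<in> V" "i \<noteq> j"
    and A: "A \<subseteq> ksets V 3" and B: "B \<subseteq> ksets V 3" and cross: "cross_intersecting A B"
    and eq: "int (card A + card B) = cross_bound (card V) 3"
    and sp: "sporadic_pair V (compress i j A) (compress i j B)"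
  shows "sporadic_pair V A B"
proof -
  have V5: "5 \<le> card V" using V by simp
  have edge: "sporadic_pair V C D"
    if C: "C \<subseteq> ksets V 3" and D: "D \<subseteq> ksets V 3" and cr: "cross_intersecting C D"
      and eq: "int (card C + card D) = cross_bound (card V) 3"
      and zw: "z \<in> V" "w \<in> V" "z \<noteq> w"
      and cC: "compress i j C = {F \<in> ksets V 3. {z, w} \<subseteq> F}"
      and cD: "compress i j D = {F \<in> ksets V 3. F \<inter> {z, w} \<noteq> {}}" for C D z w
  proof -
    consider "i \<noteq> z" "i \<noteq> w" | "i = z" | "i = w" by blast
    then show ?thesis
    proof cases
      case 1
      have c: "{z, w} \<subseteq> F" if "F \<in> C" for F
        using compress_cases[OF that, of i j] cC 1 by auto
      have d: "F \<inter> {z, w} \<noteq> {}" if "F \<in> D" for F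
        using compress_cases[OF that, of i j] cD 1 by auto
      show ?thesis
        by (rule sporadic_edge[OF V(1) V5 zw subset_CollectI[OF C c] subset_CollectI[OF D d] eq])
    next
      case 2
      obtain x where x: "x \<in> {i, j}" "x \<noteq> w" "C \<subseteq> {F \<in> ksets V 3. {x, w} \<subseteq> F}"
        "D \<subseteq> {F \<in> ksets V 3. F \<inter> {x, w} \<noteq> {}}"
        using uncompress_edge_at[OF V ij zw(2) _ C D cr cC[folded 2] cD[folded 2]] 2 zw(3) by auto
      have "x \<in> V" using x(1) ij by auto
      then show ?thesis by (rule sporadic_edge[OF V(1) V5 _ zw(2) x(2,3,4) eq])
    next
      case 3
      have wz: "{z, w} = {i, z}" using 3 by auto
      obtain x where x: "x \<in> {i, j}" "x \<noteq> z" "C \<subseteq> {F \<in> ksets V 3. {x, z} \<subseteq> F}"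
        "D \<subseteq> {F \<in> ksets V 3. F \<inter> {x, z} \<noteq> {}}"
        using uncompress_edge_at[OF V ij zw(1) _ C D cr cC[unfolded wz] cD[unfolded wz]] 3 zw(3) by auto
      have "x \<in> V" using x(1) ij by auto
      then show ?thesis by (rule sporadic_edge[OF V(1) V5 _ zw(1) x(2,3,4) eq])
    qed
  qed
  have "sporadic_pair V A B" if "sporadic_pair V (compress i j A) (compress i j B)"
    using that unfolding sporadic_pair_def[of V "compress i j A"]
  proof (elim disjE bexE conjE)
    fix z assume z: "z \<in> V" and c: "compress i j A = {F \<in> ksets V 3. z \<in> F}" "compress i j B = {F \<in> ksets V 3. z \<in> F}"
    obtain z' where z': "z' \<in> {z, j}" and AB: "A \<subseteq> {F \<in> ksets V 3. z' \<in> F}" "B \<subseteq> {F \<in> ksets V 3. z' \<in> F}"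
      using uncompress_star[OF V ij A B cross c] by blast
    have "z' \<in> V" using z' z ij by auto
    then have "sporadic_pair V A B" using sporadic_star[OF V(1) V5 _ AB eq] by simp
    then show ?thesis .
  next
    fix z w assume zw: "z \<in> V" "w \<in> V" "z \<noteq> w"
      and c: "compress i j A = {F \<in> ksets V 3. {z, w} \<subseteq> F}" "compress i j B = {F \<in> ksets V 3. F \<inter> {z, w} \<noteq> {}}"
    show ?thesis using edge[OF A B cross eq zw c] .
  next
    fix z w assume zw: "z \<in> V" "w \<in> V" "z \<noteq> w"
      and c: "compress i j B = {F \<in> ksets V 3. {z, w} \<subseteq> F}" "compress i j A = {F \<in> ksets V 3. F \<inter> {z, w} \<noteq> {}}"
    have "cross_intersecting B A" "int (card B + card A) = cross_bound (card V) 3"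
      using cross eq cross_intersecting_commute[of A B] by (simp_all add: add.commute)
    from edge[OF B A this zw c] show ?thesis by (rule sporadic_pair_sym)
  qed
  then show ?thesis using sp .
qed

section \<open>From shifted pairs to arbitrary cross-intersecting pairs\<close>

lemma ranked_exists:
  assumes "finite V"
  obtains r where "ranked V r"
  using ex_bij_betw_finite_nat[OF assms] unfolding ranked_def by (auto simp: atLeast0LessThan)

text \<open>The same compression is applied to both families, as cross-intersection requires. It
  increases neither weight, and a violation of shiftedness in either family provides a compression
  that lowers the total.\<close>

lemma compress_weight_pair_induct:
  assumes V: "finite V" and A: "A \<subseteq> ksets V l" and B: "B \<subseteq> ksets V l"
    and base: "\<And>A B. \<lbrakk>A \<subseteq> ksets V l; B \<subseteq> ksets V l; shifted V r A; shifted V r B\<rbrakk> \<Longrightarrow> P A B"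
    and step: "\<And>i j A B. \<lbrakk>A \<subseteq> ksets V l; B \<subseteq> ksets V l; i \<in> V; j \<in> V; r i < r j;
      P (compress i j A) (compress i j B)\<rbrakk> \<Longrightarrow> P A B"
  shows "P A B"
  using A B
proof (induction "weight r A + weight r B" arbitrary: A B rule: less_induct)
  case less
  note A = less.prems(1) and B = less.prems(2)
  show ?case
  proof (cases "shifted V r A \<and> shifted V r B")
    case True
    then show ?thesis using base A B by blast
  next
    case False
    have bad: "\<exists>i j. i \<in> V \<and> j \<in> V \<and> r i < r j \<and> weight r (compress i j C) < weight r C"
      if C: "C \<subseteq> ksets V l" "\<not> shifted V r C" for C
    proof -
      obtain F i j where F: "F \<in> C" "j \<in> F" "i \<in> V" "i \<notin> F" "r i < r j" "insert i (F - {j}) \<notin> C"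
        using C(2) unfolding shifted_def by blast
      moreover have "j \<in> V" using F C(1) unfolding ksets_def by auto
      ultimately show ?thesis using weight_compress(2)[OF V C(1) F(5,1,2,4,6)] by blast
    qed
    have "\<exists>i j. i \<in> V \<and> j \<in> V \<and> r i < r j \<and>
      weight r (compress i j A) + weight r (compress i j B) < weight r A + weight r B"
    proof (cases "shifted V r A")
      case True
      then obtain i j where "i \<in> V" "j \<in> V" "r i < r j" "weight r (compress i j B) < weight r B"
        using bad[OF B] False by blast
      moreover then have "weight r (compress i j A) \<le> weight r A" using weight_compress(1)[OF V A] by blast
      ultimately show ?thesis by (metis add_le_less_mono)
    next
      case False
      then obtain i j where "i \<in> V" "j \<in> V" "r i < r j" "weight r (compress i j A) < weight r A"
        using bad[OF A] by blast
      moreover then have "weight r (compress i j B) \<le> weight r B" using weight_compress(1)[OF V B] by blast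
      ultimately show ?thesis by (metis add_less_le_mono)
    qed
    then obtain i j where ij: "i \<in> V" "j \<in> V" "r i < r j"
      "weight r (compress i j A) + weight r (compress i j B) < weight r A + weight r B" by blast
    have "P (compress i j A) (compress i j B)"
      using less.hyps[OF ij(4)] compress_ksets[OF V ij(1)] A B by blast
    then show ?thesis using step[OF A B ij(1-3)] by blast
  qed
qed

text \<open>All hypotheses survive compression, sizes being unchanged. In the case of equality the
  structure found after compressing is carried back by \<open>sporadic_uncompress\<close>.\<close>

lemma cross_bound_large:
  assumes V: "finite V" "3 \<le> l" "2 * l < card V"
    and A: "A \<subseteq> ksets V l" "3 \<le> card A"
    and B: "B \<subseteq> ksets V l" "3 \<le> card B"
    and cross: "cross_intersecting A B"
  shows "int (card A + card B) \<le> cross_bound (card V) l \<and>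
    (int (card A + card B) = cross_bound (card V) l \<longrightarrow> l = 3 \<and> sporadic_pair V A B)"
proof -
  obtain r where r: "ranked V r" using ranked_exists[OF V(1)] .
  let ?Q = "\<lambda>A B. int (card A + card B) \<le> cross_bound (card V) l \<and>
    (int (card A + card B) = cross_bound (card V) l \<longrightarrow> l = 3 \<and> sporadic_pair V A B)"
  have "3 \<le> card A \<longrightarrow> 3 \<le> card B \<longrightarrow> cross_intersecting A B \<longrightarrow> ?Q A B"
  proof (rule compress_weight_pair_induct[OF V(1) A(1) B(1), where r = r], goal_cases)
    case (1 A B)
    then show ?case
      using shifted_cross_bound_large[OF V(1) r V(2,3), of A B] by blast
  next
    case (2 i j A B)
    show ?case
    proof (intro impI)
      assume AB: "3 \<le> card A" "3 \<le> card B" "cross_intersecting A B"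
      have ne: "i \<noteq> j" using 2(5) by auto
      have IH: "?Q (compress i j A) (compress i j B)"
        using 2(6) AB compress_cross_intersecting[OF ne AB(3)] by (simp add: card_compress)
      show "?Q A B"
      proof (intro conjI impI)
        show "int (card A + card B) \<le> cross_bound (card V) l" using IH by (simp add: card_compress)
        assume eq: "int (card A + card B) = cross_bound (card V) l"
        then have l3: "l = 3" and sp: "sporadic_pair V (compress i j A) (compress i j B)"
          using IH by (auto simp: card_compress)
        show "l = 3" by (rule l3)
        have V7: "7 \<le> card V" using V(3) l3 by simp
        show "sporadic_pair V A B"
          using sporadic_uncompress[OF V(1) V7 2(3,4) ne 2(1,2)[unfolded l3] AB(3) eq[unfolded l3] sp] .
      qed
    qed
  qed
  then show ?thesis using A(2) B(2) cross by blast
qed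

text \<open>For \<open>l = k - 1\<close> these are the links of \<open>J_2\<close>: \<open>A\<close>
  at a point of its \<open>(k - 1)\<close>-set \<open>E\<close>, and \<open>B\<close> at
  \<open>x0\<close>.\<close>

definition tight_pair :: "'a set \<Rightarrow> nat \<Rightarrow> 'a set set \<Rightarrow> 'a set set \<Rightarrow> bool" where
  "tight_pair V l A B \<longleftrightarrow> (\<exists>P Q. P \<in> ksets V l \<and> Q \<in> ksets V l \<and> card (P \<union> Q) = l + 1 \<and>
    A = {P, Q} \<and> B = {F \<in> ksets V l. F \<inter> P \<noteq> {} \<and> F \<inter> Q \<noteq> {}})"

lemma cross_bound_alt:
  assumes "1 \<le> l" "l + 1 \<le> M"
  shows "cross_bound M l = int (M choose l) - 2 * int ((M - l) choose l) + int ((M - l - 1) choose l) + 2"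
proof -
  obtain m where m: "M - l = Suc m" using assms by (metis Suc_diff_le Suc_eq_plus1 diff_Suc_Suc)
  obtain l' where l: "l = Suc l'" using assms by (cases l) auto
  have "(Suc m choose l) = (m choose l') + (m choose l)" using l by simp
  then show ?thesis unfolding cross_bound_def m using l by simp
qed

text \<open>\<open>B\<close> consists of sets meeting both \<open>P\<close> and \<open>Q\<close>,
  and there are strictly more of these when \<open>P\<close> and \<open>Q\<close> overlap as much as
  possible, that is, when their union has \<open>l + 1\<close> points.\<close>

lemma cross_bound_two:
  assumes V: "finite V" "1 \<le> l" "2 * l < card V"
    and A: "A \<subseteq> ksets V l" "card A = 2" and B: "B \<subseteq> ksets V l"
    and cross: "cross_intersecting A B"
  shows "int (card A + card B) \<le> cross_bound (card V) l \<and>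
    (int (card A + card B) = cross_bound (card V) l \<longrightarrow> tight_pair V l A B)"
proof -
  obtain P Q where PQ: "A = {P, Q}" "P \<noteq> Q" using A(2) by (auto simp: card_2_iff)
  have PQk: "P \<in> ksets V l" "Q \<in> ksets V l" using A PQ by auto
  then have P: "P \<subseteq> V" "card P = l" "finite P" and Q: "Q \<subseteq> V" "card Q = l" "finite Q"
    using ksets_finite_mem[OF V(1) PQk(1)] ksets_finite_mem[OF V(1) PQk(2)] unfolding ksets_def by auto
  let ?T = "{F \<in> ksets V l. F \<inter> P \<noteq> {} \<and> F \<inter> Q \<noteq> {}}"
  have u: "l + 1 \<le> card (P \<union> Q)"
  proof (rule ccontr)
    assume "\<not> l + 1 \<le> card (P \<union> Q)"
    then have "P = P \<union> Q" "Q = P \<union> Q" using P Q by (intro card_seteq; simp)+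
    then show False using PQ by auto
  qed
  have fT: "finite ?T" using finite_ksets[OF V(1)] by auto
  have meet: "P \<inter> b \<noteq> {}" "Q \<inter> b \<noteq> {}" if "b \<in> B" for b
    using cross that PQ(1) unfolding cross_intersecting_def by simp_all
  have BT: "B \<subseteq> ?T"
    by (rule subset_CollectI[OF B]) (use meet in \<open>simp add: Int_commute\<close>)
  then have BTc: "card B \<le> card ?T" using fT by (rule card_mono[rotated])
  show ?thesis
  proof (cases "card (P \<union> Q) = l + 1")
    case True
    have T: "int (card ?T) + 2 = cross_bound (card V) l"
      using card_meet_both_eq_cross_bound[OF V(1) P(1) Q(1) P(2) Q(2) True V(2)] .
    have "tight_pair V l A B" if "card B = card ?T"
    proof -
      have "B = ?T" using card_subset_eq[OF fT BT that] .
      then show ?thesis unfolding tight_pair_def using PQk True PQ(1) by blast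
    qed
    then show ?thesis using T BTc A(2) by auto
  next
    case False
    then have "(card V - card (P \<union> Q)) choose l \<le> (card V - l - 2) choose l"
      using u by (intro binomial_right_mono) auto
    also have "\<dots> < (card V - l - 1) choose l"
    proof -
      have "Suc (card V - l - 2) = card V - l - 1" "l \<le> card V - l - 2 + 1" using V by linarith+
      then show ?thesis using binomial_less_Suc[OF V(2), of "card V - l - 2"] by simp
    qed
    finally have "int (card ?T) + 2 < cross_bound (card V) l"
      using card_ksets_meet_both[OF V(1) P(1) Q(1), of l] P Q cross_bound_alt[of l "card V"] V by simp
    then show ?thesis using BTc A(2) by auto
  qed
qed

text \<open>The condition for \<open>l = 2\<close> reflects the exclusion of \<open>G_2\<close> when
  \<open>k = 3\<close>: with \<open>M = card V\<close>, two stars of the same centre have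
  \<open>2 * (M - 1)\<close> members, whereas \<open>cross_bound M 2\<close> is
  \<open>M + 2\<close>. Without a common point, graphs with at least three edges each have at most 6
  edges in total, and \<open>M + 2\<close> is at least 7.\<close>

theorem cross_intersecting_bound:
  assumes V: "finite V" "2 \<le> l" "2 * l < card V"
    and A: "A \<subseteq> ksets V l" "2 \<le> card A" and B: "B \<subseteq> ksets V l" "2 \<le> card B"
    and cross: "cross_intersecting A B"
    and no_common: "l = 2 \<Longrightarrow> \<not> (\<exists>z. \<forall>e\<in>A \<union> B. z \<in> e)"
  shows "int (card A + card B) \<le> cross_bound (card V) l \<and>
    (int (card A + card B) = cross_bound (card V) l \<longrightarrow>
      tight_pair V l A B \<or> tight_pair V l B A \<or> l = 3 \<and> sporadic_pair V A B)"
proof -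
  have l1: "1 \<le> l" using V by simp
  have cross': "cross_intersecting B A" using cross cross_intersecting_commute by blast
  consider "card A = 2" | "card B = 2" | "3 \<le> card A" "3 \<le> card B" "l = 2"
    | "3 \<le> card A" "3 \<le> card B" "3 \<le> l" using A B V by linarith
  then show ?thesis
  proof cases
    case 1
    then show ?thesis using cross_bound_two[OF V(1) l1 V(3) A(1) 1 B(1) cross] by blast
  next
    case 2
    then show ?thesis
      using cross_bound_two[OF V(1) l1 V(3) B(1) 2 A(1) cross'] by (simp add: add.commute)
  next
    case 3
    have "card A + card B \<le> 6"
      using cross_pairs_bound[of A V B] A B cross 3 no_common by blast
    moreover have "cross_bound (card V) 2 \<ge> 7"
    proof -
      obtain m where m: "card V = Suc (Suc (Suc (Suc (Suc m))))"
        using V(3) 3(3) by (metis less_imp_Suc_add mult_2 numeral_2_eq_2 add_Suc add_Suc_shift)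
      show ?thesis unfolding cross_bound_def m by (simp add: numeral_2_eq_2)
    qed
    ultimately show ?thesis using 3 by auto
  next
    case 4
    then show ?thesis using cross_bound_large[OF V(1) 4(3) V(3) A(1) 4(1) B(1) 4(2) cross] by blast
  qed
qed


section \<open>Sets disjoint from a member of a shifted family\<close>

text \<open>The Kneser graph is regular of positive degree, so double counting its edges gives every
  set of vertices at least as many neighbours.\<close>

lemma disjoint_count_kneser:
  assumes V: "finite V" "2 * k \<le> card V" and D: "D \<subseteq> ksets V k"
  shows "card D \<le> card {W \<in> ksets V k. \<exists>F\<in>D. W \<inter> F = {}}"
proof -
  let ?N = "{W \<in> ksets V k. \<exists>F\<in>D. W \<inter> F = {}}" and ?c = "(card V - k) choose k"
  have fin: "finite D" "finite ?N" using D finite_ksets[OF V(1)] by (auto intro: finite_subset)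
  have deg: "card {W \<in> ksets V k. W \<inter> F = {}} = ?c" if "F \<in> ksets V k" for F
    using card_ksets_disjoint[OF V(1)] that unfolding ksets_def by auto
  have "card D * ?c = (\<Sum>F\<in>D. card {W \<in> ?N. W \<inter> F = {}})"
  proof -
    have "card {W \<in> ?N. W \<inter> F = {}} = ?c" if F: "F \<in> D" for F
    proof -
      have "{W \<in> ?N. W \<inter> F = {}} = {W \<in> ksets V k. W \<inter> F = {}}" using F by blast
      then show ?thesis using deg F D by auto
    qed
    then show ?thesis by simp
  qed
  also have "\<dots> = (\<Sum>W\<in>?N. card {F \<in> D. W \<inter> F = {}})"
    using fin by (intro sum_multicount_gen) auto
  also have "\<dots> \<le> (\<Sum>W\<in>?N. ?c)"
  proof (rule sum_mono)
    fix W assume W: "W \<in> ?N"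
    have "card {F \<in> D. W \<inter> F = {}} \<le> card {F \<in> ksets V k. F \<inter> W = {}}"
      using D finite_ksets[OF V(1)] by (intro card_mono) (auto simp: Int_commute)
    then show "card {F \<in> D. W \<inter> F = {}} \<le> ?c" using deg W by auto
  qed
  finally have "card D * ?c \<le> card ?N * ?c" by simp
  moreover have "?c > 0" using V by simp
  ultimately show ?thesis by simp
qed

text \<open>Katona's shadow theorem for \<open>(t + 1)\<close>-intersecting families, phrased for complements.
  Splitting at the first element \<open>e\<close> works because shiftedness makes the members
  avoiding \<open>e\<close> even \<open>(t + 2)\<close>-intersecting.\<close>

lemma disjoint_count_shifted:
  fixes r :: "'a \<Rightarrow> nat"
  assumes "finite V" "inj_on r V" "D \<subseteq> ksets V k" "shifted V r D"
    and "\<And>F G. F \<in> D \<Longrightarrow> G \<in> D \<Longrightarrow> t < card (F \<inter> G)" "2 * k \<le> card V + t"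
  shows "card D \<le> card {W \<in> ksets V (k - t). \<exists>F\<in>D. W \<inter> F = {}}"
  using assms
proof (induction "card V" arbitrary: V D k t)
  case 0
  then have "V = {}" by simp
  then have "D \<subseteq> {{}}" using 0 unfolding ksets_def by auto
  moreover have "{} \<notin> D" using 0(6)[of "{}" "{}"] by auto
  ultimately have "D = {}" by blast
  then show ?case by simp
next
  case (Suc v)
  note V = Suc.prems(1,2) and D = Suc.prems(3,4) and int = Suc.prems(5) and big = Suc.prems(6)
  show ?case
  proof (cases "t = 0")
    case True
    then show ?thesis using disjoint_count_kneser[OF V(1) _ D(1)] big by simp
  next
    case t: False
    have "V \<noteq> {}" using Suc.hyps(2) by auto
    then obtain e where e: "e \<in> V" and emin: "\<And>x. x \<in> V \<Longrightarrow> r e \<le> r x"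
      using ex_has_least_nat[of "\<lambda>x. x \<in> V" _ r] by blast
    have eless: "r e < r x" if "x \<in> V" "x \<noteq> e" for x
      using emin[OF that(1)] inj_onD[OF V(2) _ e that(1)] that(2) by (metis le_neq_implies_less)
    let ?U = "V - {e}"
    have U: "finite ?U" "inj_on r ?U" "v = card ?U" using V e Suc.hyps(2) by (auto intro: inj_on_subset)
    define D0 where "D0 = {F \<in> D. e \<notin> F}"
    define D1 where "D1 = {G. e \<notin> G \<and> insert e G \<in> D}"
    let ?N = "{W \<in> ksets V (k - t). \<exists>F\<in>D. W \<inter> F = {}}"
    \<comment> \<open>\<open>D0\<close> is treated with \<open>t + 1\<close>, and \<open>D1\<close>
      with \<open>k - 1\<close> and \<open>t - 1\<close>; after the loss of \<open>e\<close> both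
      still satisfy the inequality relating \<open>k\<close>, \<open>t\<close> and the ground set.
      The sets obtained from \<open>D0\<close> are one point short and receive \<open>e\<close>,
      which no member of \<open>D0\<close> contains; those from \<open>D1\<close> avoid
      \<open>e\<close>. So the two contributions to \<open>?N\<close> are disjoint.\<close>
    let ?Na = "{W \<in> ksets ?U (k - (t + 1)). \<exists>F\<in>D0. W \<inter> F = {}}"
    let ?Nb = "{W \<in> ksets ?U ((k - 1) - (t - 1)). \<exists>F\<in>D1. W \<inter> F = {}}"
    have Dk: "F \<subseteq> V" "card F = k" "finite F" if "F \<in> D" for F
      using that D(1) ksets_finite_mem[OF V(1), of F k] unfolding ksets_def by blast+
    have D0k: "D0 \<subseteq> ksets ?U k" unfolding D0_def ksets_def using Dk by auto
    have D1k: "D1 \<subseteq> ksets ?U (k - 1)"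
    proof
      fix G assume "G \<in> D1"
      then have G: "e \<notin> G" "insert e G \<in> D" unfolding D1_def by auto
      then have "finite G" using Dk(3)[of "insert e G"] by simp
      then show "G \<in> ksets ?U (k - 1)" using G Dk(1,2)[OF G(2)] unfolding ksets_def by auto
    qed
    have int0: "t + 1 < card (F \<inter> G)" if FG: "F \<in> D0" "G \<in> D0" for F G
    proof -
      have FG': "F \<in> D" "G \<in> D" "e \<notin> F" "e \<notin> G" using FG unfolding D0_def by auto
      have "F \<inter> G \<noteq> {}" using int[OF FG'(1,2)] by auto
      then obtain s where s: "s \<in> F" "s \<in> G" by auto
      have "r e < r s" using eless Dk(1)[OF FG'(1)] s FG' by blast
      then have "insert e (F - {s}) \<in> D" using shiftedD[OF D(2) FG'(1) s(1) e FG'(3)] by simp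
      then have "t < card (insert e (F - {s}) \<inter> G)" using int FG'(2) by blast
      moreover have "insert e (F - {s}) \<inter> G = (F \<inter> G) - {s}" using FG' by auto
      moreover have "card ((F \<inter> G) - {s}) = card (F \<inter> G) - 1"
        using s by simp
      ultimately show ?thesis by simp
    qed
    have int1: "t - 1 < card (F \<inter> G)" if FG: "F \<in> D1" "G \<in> D1" for F G
    proof -
      have FG': "insert e F \<in> D" "insert e G \<in> D" "e \<notin> F" "e \<notin> G" using FG unfolding D1_def by auto
      have "finite F" using Dk(3)[OF FG'(1)] by simp
      have "t < card (insert e F \<inter> insert e G)" using int FG' by blast
      also have "insert e F \<inter> insert e G = insert e (F \<inter> G)" by auto
      also have "card \<dots> = card (F \<inter> G) + 1" using FG' \<open>finite F\<close> by simp
      finally show ?thesis using t by simp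
    qed
    have sh0: "shifted ?U r D0"
      unfolding shifted_def D0_def
    proof (intro ballI impI)
      fix F j i assume *: "F \<in> {F \<in> D. e \<notin> F}" "j \<in> F" "i \<in> ?U" "i \<notin> F" "r i < r j"
      then have "insert i (F - {j}) \<in> D" using shiftedD[OF D(2), of F j i] by auto
      then show "insert i (F - {j}) \<in> {F \<in> D. e \<notin> F}" using * by auto
    qed
    have sh1: "shifted ?U r D1"
      unfolding shifted_def D1_def
    proof (intro ballI impI)
      fix F j i assume *: "F \<in> {G. e \<notin> G \<and> insert e G \<in> D}" "j \<in> F" "i \<in> ?U" "i \<notin> F" "r i < r j"
      then have "insert i (insert e F - {j}) \<in> D" using shiftedD[OF D(2), of "insert e F" j i] by auto
      moreover have "insert i (insert e F - {j}) = insert e (insert i (F - {j}))" using * by auto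
      ultimately show "insert i (F - {j}) \<in> {G. e \<notin> G \<and> insert e G \<in> D}" using * by auto
    qed
    have fN: "finite ?N" "finite ?Na" "finite ?Nb"
      using finite_ksets[OF V(1)] finite_ksets[OF U(1)] by auto
    have IH0: "card D0 \<le> card ?Na"
      using Suc.hyps(1)[OF U(3,1,2) D0k sh0 int0] big U(3) Suc.hyps(2) by simp
    have IH1: "card D1 \<le> card ?Nb"
    proof (cases "D1 = {}")
      case False
      then have "D \<noteq> {}" unfolding D1_def by auto
      then obtain F where "F \<in> D" by auto
      then have "1 \<le> k" using int[of F F] Dk(2)[of F] by simp
      then show ?thesis
        using Suc.hyps(1)[OF U(3,1,2) D1k sh1 int1] big U(3) Suc.hyps(2) t by simp
    qed simp
    have D_split: "card D = card D0 + card D1"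
    proof -
      have "F \<in> insert e ` D1" if "F \<in> D" "e \<in> F" for F
        using that by (intro image_eqI[of _ _ "F - {e}"]) (simp_all add: D1_def insert_absorb)
      then have "D \<subseteq> D0 \<union> insert e ` D1" unfolding D0_def by blast
      moreover have "D0 \<union> insert e ` D1 \<subseteq> D" "D0 \<inter> insert e ` D1 = {}"
        unfolding D0_def D1_def by blast+
      ultimately have "D = D0 \<union> insert e ` D1" "D0 \<inter> insert e ` D1 = {}" by blast+
      moreover have "inj_on (insert e) D1"
        by (rule inj_onI) (simp add: D1_def insert_ident)
      moreover have "finite D" using D(1) finite_ksets[OF V(1)] finite_subset by blast
      ultimately show ?thesis by (metis card_Un_disjoint card_image finite_Un)
    qed
    have "card ?Na + card ?Nb = card (insert e ` ?Na \<union> ?Nb)"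
    proof -
      have notin: "e \<notin> W" if "W \<in> ?Na" for W using that unfolding ksets_def by blast
      have "inj_on (insert e) ?Na"
      proof (rule inj_onI)
        fix x y assume "x \<in> ?Na" "y \<in> ?Na" "insert e x = insert e y"
        then show "x = y" using insert_ident[OF notin[of x] notin[of y]] by simp
      qed
      moreover have "insert e ` ?Na \<inter> ?Nb = {}" unfolding ksets_def by auto
      ultimately show ?thesis using fN by (simp add: card_Un_disjoint card_image)
    qed
    also have "\<dots> \<le> card ?N"
    proof (rule card_mono[OF fN(1)], rule subsetI)
      fix W assume "W \<in> insert e ` ?Na \<union> ?Nb"
      then show "W \<in> ?N"
      proof (elim UnE)
        assume "W \<in> insert e ` ?Na"
        then obtain W0 F where W0: "W = insert e W0" "W0 \<subseteq> ?U" "card W0 = k - (t + 1)" "F \<in> D0" "W0 \<inter> F = {}"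
          unfolding ksets_def by auto
        have "t + 1 < k" using int0[OF W0(4,4)] Dk(2)[of F] W0(4) unfolding D0_def by auto
        moreover have "finite W0" "e \<notin> W0" using W0(2) U(1) finite_subset by auto
        ultimately have "card W = k - t" using W0(1,3) by simp
        moreover have "W \<subseteq> V" using W0(1,2) e by auto
        ultimately have "W \<in> ksets V (k - t)" unfolding ksets_def by simp
        moreover have WF: "W \<inter> F = {}" and FD: "F \<in> D" using W0(1,4,5) unfolding D0_def by auto
        ultimately show "W \<in> ?N" using bexI[of "\<lambda>F. W \<inter> F = {}", OF WF FD] by simp
      next
        assume "W \<in> ?Nb"
        then obtain F where F: "W \<subseteq> ?U" "card W = (k - 1) - (t - 1)" "F \<in> D1" "W \<inter> F = {}"
          unfolding ksets_def by auto
        have "card W = k - t" using F(2) t by simp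
        moreover have "W \<subseteq> V" using F(1) by auto
        ultimately have "W \<in> ksets V (k - t)" unfolding ksets_def by simp
        moreover have WF: "W \<inter> insert e F = {}" and FD: "insert e F \<in> D"
          using F(1,3,4) unfolding D1_def by auto
        ultimately show "W \<in> ?N" using bexI[of "\<lambda>F. W \<inter> F = {}", OF WF FD] by simp
      qed
    qed
    finally show ?thesis using IH0 IH1 D_split by simp
  qed
qed

section \<open>Links of a pair of points\<close>

definition link :: "'a \<Rightarrow> 'a \<Rightarrow> 'a set set \<Rightarrow> 'a set set" where
  "link x y A = {G. x \<notin> G \<and> y \<notin> G \<and> insert x G \<in> A}"

definition link_both :: "'a \<Rightarrow> 'a \<Rightarrow> 'a set set \<Rightarrow> 'a set set" where
  "link_both x y A = {G. x \<notin> G \<and> y \<notin> G \<and> insert x (insert y G) \<in> A}"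

lemma card_insert_image:
  assumes "\<And>G. G \<in> C \<Longrightarrow> x \<notin> G"
  shows "card (insert x ` C) = card C"
  using assms by (intro card_image inj_onI) (simp add: insert_ident)

lemma mem_link: "x \<in> F \<Longrightarrow> y \<notin> F \<Longrightarrow> F \<in> A \<Longrightarrow> F - {x} \<in> link x y A"
  unfolding link_def by (simp add: insert_absorb)

lemma card_link_split:
  assumes fin: "finite A" and xy: "x \<noteq> y"
  shows "card A = card {F \<in> A. x \<notin> F \<and> y \<notin> F} + card (link x y A) + card (link y x A)
    + card (link_both x y A)"
proof -
  let ?n = "{F \<in> A. x \<notin> F \<and> y \<notin> F}" and ?x = "{F \<in> A. x \<in> F \<and> y \<notin> F}"
    and ?y = "{F \<in> A. y \<in> F \<and> x \<notin> F}" and ?b = "{F \<in> A. x \<in> F \<and> y \<in> F}"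
  have one: "insert u ` link u v A = {F \<in> A. u \<in> F \<and> v \<notin> F}" if "u \<noteq> v" for u v
  proof (intro equalityI subsetI)
    fix F assume "F \<in> {F \<in> A. u \<in> F \<and> v \<notin> F}"
    then have F: "F \<in> A" "u \<in> F" "v \<notin> F" by auto
    then have "F - {u} \<in> link u v A" "F = insert u (F - {u})" by (auto intro: mem_link)
    then show "F \<in> insert u ` link u v A" by (rule image_eqI[rotated])
  qed (use that in \<open>auto simp: link_def\<close>)
  have both: "insert x ` insert y ` link_both x y A = ?b"
  proof (intro equalityI subsetI)
    fix F assume "F \<in> ?b"
    then have F: "F = insert x (insert y (F - {x, y}))" "F \<in> A" by auto
    moreover have "F - {x, y} \<in> link_both x y A" unfolding link_both_def using F by auto
    ultimately show "F \<in> insert x ` insert y ` link_both x y A" by blast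
  qed (auto simp: link_both_def)
  have cx: "card ?x = card (link x y A)" and cy: "card ?y = card (link y x A)"
    using one[OF xy] one[OF xy[symmetric]] card_insert_image[of "link x y A" x]
      card_insert_image[of "link y x A" y] unfolding link_def by auto
  have cb: "card ?b = card (link_both x y A)"
  proof -
    have "card (insert x ` insert y ` link_both x y A) = card (insert y ` link_both x y A)"
      by (rule card_insert_image) (use xy in \<open>auto simp: link_both_def\<close>)
    also have "\<dots> = card (link_both x y A)"
      by (rule card_insert_image) (auto simp: link_both_def)
    finally show ?thesis using both by simp
  qed
  have "A = (?n \<union> ?x) \<union> (?y \<union> ?b)" by blast
  then have "card A = card ((?n \<union> ?x) \<union> (?y \<union> ?b))" by simp
  also have "\<dots> = card (?n \<union> ?x) + card (?y \<union> ?b)" using fin by (intro card_Un_disjoint) auto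
  also have "card (?n \<union> ?x) = card ?n + card ?x" using fin by (intro card_Un_disjoint) auto
  also have "card (?y \<union> ?b) = card ?y + card ?b" using fin by (intro card_Un_disjoint) auto
  finally show ?thesis using cx cy cb by simp
qed

lemma link_ksets:
  assumes "finite X" "H \<subseteq> ksets X k"
  shows "link x y H \<subseteq> ksets (X - {x, y}) (k - 1)"
    and "link y x H \<subseteq> ksets (X - {x, y}) (k - 1)"
    and "x \<noteq> y \<Longrightarrow> link_both x y H \<subseteq> ksets (X - {x, y}) (k - 2)"
proof -
  have *: "link x y H \<subseteq> ksets (X - {x, y}) (k - 1)" for x y
  proof
    fix G assume "G \<in> link x y H"
    then have G: "x \<notin> G" "y \<notin> G" "insert x G \<in> H" unfolding link_def by auto
    then have "insert x G \<in> ksets X k" using assms(2) by auto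
    then have "finite (insert x G)" "insert x G \<subseteq> X" "card (insert x G) = k"
      using ksets_finite_mem[OF assms(1)] unfolding ksets_def by blast+
    then show "G \<in> ksets (X - {x, y}) (k - 1)" using G unfolding ksets_def by auto
  qed
  show "link x y H \<subseteq> ksets (X - {x, y}) (k - 1)" "link y x H \<subseteq> ksets (X - {x, y}) (k - 1)"
    using *[of x y] *[of y x] by (simp_all add: insert_commute)
  assume xy: "x \<noteq> y"
  show "link_both x y H \<subseteq> ksets (X - {x, y}) (k - 2)"
  proof
    fix G assume "G \<in> link_both x y H"
    then have G: "x \<notin> G" "y \<notin> G" "insert x (insert y G) \<in> H" unfolding link_both_def by auto
    then have "insert x (insert y G) \<in> ksets X k" using assms(2) by auto
    then have "finite (insert x (insert y G))" "insert x (insert y G) \<subseteq> X" "card (insert x (insert y G)) = k"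
      using ksets_finite_mem[OF assms(1)] unfolding ksets_def by blast+
    then show "G \<in> ksets (X - {x, y}) (k - 2)" using G xy unfolding ksets_def by auto
  qed
qed

lemma link_cross_intersecting:
  assumes "x \<noteq> y" "intersecting H"
  shows "cross_intersecting (link x y H) (link y x H)"
  unfolding cross_intersecting_def
proof (intro ballI)
  fix a b assume "a \<in> link x y H" "b \<in> link y x H"
  then have ab: "x \<notin> a" "y \<notin> a" "x \<notin> b" "y \<notin> b" "insert x a \<in> H" "insert y b \<in> H"
    unfolding link_def by auto
  then have "insert x a \<inter> insert y b \<noteq> {}" using assms(2) unfolding intersecting_def by blast
  then show "a \<inter> b \<noteq> {}" using ab assms(1) by auto
qed

definition hk_bound :: "nat \<Rightarrow> nat \<Rightarrow> int" where
  "hk_bound n k = int ((n - 1) choose (k - 1)) - int ((n - k - 1) choose (k - 1))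
            - int ((n - k - 2) choose (k - 2)) + 2"

text \<open>Splits the bound along a two-element cover: the first summand counts all
  \<open>k\<close>-sets through both points, the second bounds the two links on the other
  \<open>n - 2\<close> points.\<close>

lemma hk_bound_eq:
  assumes "2 \<le> k" "2 \<le> n"
  shows "hk_bound n k = int ((n - 2) choose (k - 2)) + cross_bound (n - 2) (k - 1)"
proof -
  obtain m l where m: "n = Suc (Suc m)" and l: "k = Suc (Suc l)"
    using assms by (metis add_2_eq_Suc le_Suc_ex)
  show ?thesis unfolding hk_bound_def cross_bound_def m l by simp
qed

definition covered :: "'a set set \<Rightarrow> 'a \<Rightarrow> 'a \<Rightarrow> bool" where
  "covered H x y \<longleftrightarrow> (\<forall>F\<in>H. x \<in> F \<or> y \<in> F)"

definition two_cover :: "'a set \<Rightarrow> 'a set set \<Rightarrow> bool" where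
  "two_cover X H \<longleftrightarrow> (\<exists>x\<in>X. \<exists>y\<in>X. x \<noteq> y \<and> covered H x y)"

theorem covered_bound:
  assumes X: "finite X" "3 \<le> k" "2 * k < card X" and H: "H \<subseteq> ksets X k" "intersecting H"
    and xy: "x \<in> X" "y \<in> X" "x \<noteq> y" "covered H x y"
    and two: "2 \<le> card (link x y H)" "2 \<le> card (link y x H)"
    and no_common: "k = 3 \<Longrightarrow> \<not> (\<exists>z. \<forall>e\<in>link x y H \<union> link y x H. z \<in> e)"
  defines "V \<equiv> X - {x, y}"
  shows "int (card H) \<le> hk_bound (card X) k"
    and "int (card H) = hk_bound (card X) k \<Longrightarrow> link_both x y H = ksets V (k - 2) \<and>
      (tight_pair V (k - 1) (link x y H) (link y x H) \<or> tight_pair V (k - 1) (link y x H) (link x y H) \<or>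
       k = 4 \<and> sporadic_pair V (link x y H) (link y x H))"
proof -
  have V: "finite V" "card V = card X - 2" using X xy unfolding V_def by auto
  have V': "2 * (k - 1) < card V" "2 \<le> k - 1" using V X by auto
  have fH: "finite H" using H finite_ksets[OF X(1)] finite_subset by blast
  have lk: "link x y H \<subseteq> ksets V (k - 1)" "link y x H \<subseteq> ksets V (k - 1)" "link_both x y H \<subseteq> ksets V (k - 2)"
    using link_ksets[OF X(1) H(1), where x = x and y = y] xy(3) unfolding V_def by simp_all
  have e: "{F \<in> H. x \<notin> F \<and> y \<notin> F} = {}" using xy(4) unfolding covered_def by blast
  have split: "card H = card (link x y H) + card (link y x H) + card (link_both x y H)"
    using card_link_split[OF fH xy(3)] unfolding e by simp
  have b: "card (link_both x y H) \<le> card (ksets V (k - 2))"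
    using lk(3) finite_ksets[OF V(1)] by (intro card_mono)
  have bV: "card (ksets V (k - 2)) = (card X - 2) choose (k - 2)" using card_ksets[OF V(1)] V by simp
  have hk: "hk_bound (card X) k = int ((card X - 2) choose (k - 2)) + cross_bound (card V) (k - 1)"
    using hk_bound_eq X V by simp
  have nc: "\<not> (\<exists>z. \<forall>e\<in>link x y H \<union> link y x H. z \<in> e)" if "k - 1 = 2"
  proof -
    have "k = 3" using that by simp
    then show ?thesis by (rule no_common)
  qed
  note main = cross_intersecting_bound[OF V(1) V'(2,1) lk(1) two(1) lk(2) two(2)
      link_cross_intersecting[OF xy(3) H(2)] nc]
  show "int (card H) \<le> hk_bound (card X) k" using main split b bV hk by linarith
  assume eq: "int (card H) = hk_bound (card X) k"
  then have 1: "int (card (link x y H) + card (link y x H)) = cross_bound (card V) (k - 1)"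
    and "card (link_both x y H) = card (ksets V (k - 2))" using main split b bV hk by linarith+
  then have "link_both x y H = ksets V (k - 2)"
    using card_subset_eq[OF finite_ksets[OF V(1)] lk(3)] by blast
  moreover have "k - 1 = 3 \<longleftrightarrow> k = 4" using X(2) by auto
  ultimately show "link_both x y H = ksets V (k - 2) \<and>
      (tight_pair V (k - 1) (link x y H) (link y x H) \<or> tight_pair V (k - 1) (link y x H) (link x y H) \<or>
       k = 4 \<and> sporadic_pair V (link x y H) (link y x H))"
    using main 1 by simp
qed


section \<open>Families without a two-element cover\<close>

lemma tight_pair_card_le:
  assumes "tight_pair V l A B"
  shows "card A \<le> 2"
proof -
  obtain P Q where "A = {P, Q}" using assms unfolding tight_pair_def by (elim exE conjE)
  then show ?thesis using card_length[of "[P, Q]"] by simp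
qed

lemma sporadic_pair_common:
  assumes "sporadic_pair V A B"
  shows "(\<exists>z. \<forall>e\<in>A. z \<in> e) \<or> (\<exists>z. \<forall>e\<in>B. z \<in> e)"
  using assms unfolding sporadic_pair_def
proof (elim disjE bexE conjE)
  fix z assume "A = {F \<in> ksets V 3. z \<in> F}"
  then have "\<forall>e\<in>A. z \<in> e" by simp
  then show ?thesis by blast
next
  fix z w assume "A = {F \<in> ksets V 3. {z, w} \<subseteq> F}"
  then have "\<forall>e\<in>A. z \<in> e" by simp
  then show ?thesis by blast
next
  fix z w assume "B = {F \<in> ksets V 3. {z, w} \<subseteq> F}"
  then have "\<forall>e\<in>B. z \<in> e" by simp
  then show ?thesis by blast
qed

text \<open>Members avoiding both first points and members containing both together number at most
  \<open>(n - 2) choose (k - 2)\<close>. Strictness comes from the links: a member \<open>d\<close>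
  avoiding both points puts every \<open>d - {u}\<close> into both of them. Hence each link has at
  least three members and no common point, which rules out all extremal pairs.\<close>

lemma shifted_no_two_cover_bound:
  assumes X: "finite X" "3 \<le> k" "2 * k < card X" and r: "ranked X r"
    and H: "H \<subseteq> ksets X k" "intersecting H" "shifted X r H" and no: "\<not> two_cover X H"
  shows "int (card H) < hk_bound (card X) k"
proof -
  have bij: "bij_betw r X {..<card X}" using r unfolding ranked_def .
  have "0 \<in> r ` X" "1 \<in> r ` X" using bij X unfolding bij_betw_def by auto
  then obtain x y where x: "x \<in> X" "r x = 0" and y: "y \<in> X" "r y = 1" by (metis imageE)
  have xy: "x \<noteq> y" using x y by auto
  have inj: "inj_on r X" using bij unfolding bij_betw_def by blast
  have big: "r x < r s" "r y < r s" if "s \<in> X" "s \<noteq> x" "s \<noteq> y" for s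
  proof -
    have "r s \<noteq> 0" "r s \<noteq> 1" using inj_onD[OF inj, of s x] inj_onD[OF inj, of s y] that x y by auto
    then show "r x < r s" "r y < r s" using x y by auto
  qed
  let ?V = "X - {x, y}"
  define D where "D = {F \<in> H. x \<notin> F \<and> y \<notin> F}"
  let ?A = "link x y H" and ?B = "link y x H" and ?C = "link_both x y H"
  have V: "finite ?V" "card ?V = card X - 2" using X x y xy by auto
  have fH: "finite H" using H finite_ksets[OF X(1)] finite_subset by blast
  have Hk: "F \<subseteq> X" "card F = k" "finite F" if "F \<in> H" for F
    using that H(1) ksets_finite_mem[OF X(1), of F k] unfolding ksets_def by blast+
  have lk: "?A \<subseteq> ksets ?V (k - 1)" "?B \<subseteq> ksets ?V (k - 1)" "?C \<subseteq> ksets ?V (k - 2)"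
    using link_ksets[OF X(1) H(1), where x = x and y = y] xy by simp_all
  have "D \<noteq> {}" using no x(1) y(1) xy unfolding two_cover_def covered_def D_def by blast
  then obtain d where d: "d \<in> D" by auto
  have dH: "d \<in> H" "x \<notin> d" "y \<notin> d" using d unfolding D_def by auto
  have HI: "F \<inter> G \<noteq> {}" if "F \<in> H" "G \<in> H" for F G using H(2) that unfolding intersecting_def by blast
  have Dk: "D \<subseteq> ksets ?V k" unfolding D_def ksets_def using Hk by auto
  have Dsh: "shifted ?V r D"
    unfolding shifted_def
  proof (intro ballI impI)
    fix F j i assume *: "F \<in> D" "j \<in> F" "i \<in> ?V" "i \<notin> F" "r i < r j"
    then have "insert i (F - {j}) \<in> H" using shiftedD[OF H(3), of F j i] unfolding D_def by auto
    then show "insert i (F - {j}) \<in> D" using * unfolding D_def by auto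
  qed
  \<comment> \<open>Replacing a common point of \<open>F\<close> and \<open>G\<close> by
    \<open>x\<close>, and then a second one by \<open>y\<close>, keeps \<open>F\<close> in
    \<open>H\<close>; it must still meet \<open>G\<close>, which yields a third common
    point.\<close>
  have Dint: "2 < card (F \<inter> G)" if FG: "F \<in> D" "G \<in> D" for F G
  proof -
    have F: "F \<in> H" "x \<notin> F" "y \<notin> F" and G: "G \<in> H" "x \<notin> G" "y \<notin> G" using FG unfolding D_def by auto
    obtain s where s: "s \<in> F" "s \<in> G" using HI[OF F(1) G(1)] by auto
    have "s \<in> X" "s \<noteq> x" "s \<noteq> y" using s F Hk(1) by blast+
    then have F1: "insert x (F - {s}) \<in> H" using shiftedD[OF H(3) F(1) s(1) x(1) F(2)] big by blast
    obtain t where t: "t \<in> insert x (F - {s})" "t \<in> G" using HI[OF F1 G(1)] by auto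
    then have t': "t \<in> F" "t \<noteq> s" "t \<noteq> x" "t \<noteq> y" using F G by auto
    then have "t \<in> X" using Hk(1)[OF F(1)] by blast
    then have "insert y (insert x (F - {s}) - {t}) \<in> H"
      using shiftedD[OF H(3) F1 t(1) y(1)] big t' F(3) xy by blast
    from HI[OF this G(1)] obtain u where "u \<in> F" "u \<in> G" "u \<noteq> s" "u \<noteq> t" using G by auto
    then have "{s, t, u} \<subseteq> F \<inter> G" "card {s, t, u} = 3" using s t t' by auto
    moreover have "finite (F \<inter> G)" using Hk(3)[OF F(1)] by simp
    ultimately have "3 \<le> card (F \<inter> G)" using card_mono by metis
    then show ?thesis by simp
  qed
  let ?N = "{W \<in> ksets ?V (k - 2). \<exists>F\<in>D. W \<inter> F = {}}"
  have "inj_on r ?V" using inj by (rule inj_on_subset) auto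
  then have "card D \<le> card ?N"
    using disjoint_count_shifted[OF V(1) _ Dk Dsh Dint] X(3) V(2) by simp
  moreover have "?C \<inter> ?N = {}"
  proof -
    have "W \<inter> F \<noteq> {}" if "W \<in> ?C" "F \<in> D" for W F
    proof -
      have "insert x (insert y W) \<in> H" "F \<in> H" "x \<notin> F" "y \<notin> F"
        using that unfolding link_both_def D_def by auto
      then show ?thesis using HI[of "insert x (insert y W)" F] by auto
    qed
    then show ?thesis by blast
  qed
  then have "card ?C + card ?N = card (?C \<union> ?N)"
    using finite_ksets[OF V(1)] lk(3) by (intro card_Un_disjoint[symmetric]) (auto intro: finite_subset)
  moreover have "card (?C \<union> ?N) \<le> card (ksets ?V (k - 2))"
    using lk(3) finite_ksets[OF V(1)] by (intro card_mono) auto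
  moreover have "card (ksets ?V (k - 2)) = (card X - 2) choose (k - 2)" using card_ksets[OF V(1)] V by simp
  ultimately have CD: "card ?C + card D \<le> (card X - 2) choose (k - 2)" by linarith
  have shadow: "d - {u} \<in> ?A" "d - {u} \<in> ?B" if u: "u \<in> d" for u
  proof -
    have "u \<in> X" "u \<noteq> x" "u \<noteq> y" using u dH Hk(1) by blast+
    then have "insert x (d - {u}) \<in> H" "insert y (d - {u}) \<in> H"
      using shiftedD[OF H(3) dH(1) u] x(1) y(1) dH big by blast+
    then show "d - {u} \<in> ?A" "d - {u} \<in> ?B" using dH unfolding link_def by auto
  qed
  have "inj_on (\<lambda>u. d - {u}) d" by (rule inj_onI) blast
  then have dc: "card ((\<lambda>u. d - {u}) ` d) = k" using Hk(2)[OF dH(1)] by (simp add: card_image)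
  have AB3: "3 \<le> card ?A" "3 \<le> card ?B"
  proof -
    have "finite ?A" "finite ?B" using lk finite_ksets[OF V(1)] finite_subset by blast+
    then have "card ((\<lambda>u. d - {u}) ` d) \<le> card ?A" "card ((\<lambda>u. d - {u}) ` d) \<le> card ?B"
      using shadow by (auto intro!: card_mono)
    then show "3 \<le> card ?A" "3 \<le> card ?B" using dc X(2) by auto
  qed
  have "d \<noteq> {}" using Hk(2)[OF dH(1)] X(2) by auto
  then have avoid: "\<exists>u\<in>d. z \<notin> d - {u}" for z by blast
  have ncA: "\<not> (\<forall>e\<in>?A. z \<in> e)" and ncB: "\<not> (\<forall>e\<in>?B. z \<in> e)" for z
  proof -
    obtain u where u: "u \<in> d" "z \<notin> d - {u}" using avoid by blast
    show "\<not> (\<forall>e\<in>?A. z \<in> e)" "\<not> (\<forall>e\<in>?B. z \<in> e)" using shadow[OF u(1)] u(2) by metis+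
  qed
  have nt: "\<not> tight_pair ?V (k - 1) ?A ?B" "\<not> tight_pair ?V (k - 1) ?B ?A"
    using tight_pair_card_le[of ?V "k - 1" ?A ?B] tight_pair_card_le[of ?V "k - 1" ?B ?A] AB3 by linarith+
  have ns: "\<not> sporadic_pair ?V ?A ?B"
  proof
    assume "sporadic_pair ?V ?A ?B"
    then have "(\<exists>z. \<forall>e\<in>?A. z \<in> e) \<or> (\<exists>z. \<forall>e\<in>?B. z \<in> e)"
      by (rule sporadic_pair_common)
    then show False using ncA ncB by blast
  qed
  have V2: "2 \<le> k - 1" "2 * (k - 1) < card ?V" and AB2: "2 \<le> card ?A" "2 \<le> card ?B" using X V AB3 by auto
  have nc: "\<not> (\<exists>z. \<forall>e\<in>?A \<union> ?B. z \<in> e)" using ncA by blast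
  have "int (card ?A + card ?B) < cross_bound (card ?V) (k - 1)"
    using cross_intersecting_bound[OF V(1) V2 lk(1) AB2(1) lk(2) AB2(2)
        link_cross_intersecting[OF xy H(2)] nc] nt ns by linarith
  moreover have "card H = card D + card ?A + card ?B + card ?C"
    using card_link_split[OF fH xy] unfolding D_def .
  ultimately show ?thesis using CD hk_bound_eq[of k "card X"] X V(2) by simp
qed

text \<open>The subtracted binomial is at least \<open>l\<close>, which compensates the summand 2
  and outweighs it from \<open>l = 3\<close> on. The right-hand side counts the
  \<open>l\<close>-sets meeting a fixed \<open>l\<close>-set.\<close>

lemma cross_bound_le_meet:
  assumes "2 \<le> l" "2 * l < M"
  shows "cross_bound M l \<le> int (M choose l) - int ((M - l) choose l)"
    and "3 \<le> l \<Longrightarrow> cross_bound M l < int (M choose l) - int ((M - l) choose l)"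
proof -
  have "l choose (l - 1) \<le> (M - l - 1) choose (l - 1)" using assms by (intro binomial_right_mono) auto
  moreover have "l choose (l - 1) = l" using assms by (metis One_nat_def Suc_diff_le Suc_leD binomial_Suc_n diff_Suc_Suc minus_nat.diff_0 numeral_2_eq_2)
  ultimately have "l \<le> (M - l - 1) choose (l - 1)" by simp
  then show "cross_bound M l \<le> int (M choose l) - int ((M - l) choose l)"
    "3 \<le> l \<Longrightarrow> cross_bound M l < int (M choose l) - int ((M - l) choose l)"
    using assms(1) unfolding cross_bound_def by linarith+
qed

text \<open>On links, compression replaces those at \<open>i\<close> and \<open>j\<close> by their
  union and their intersection, and it leaves members avoiding both points alone.\<close>

lemma compress_link:
  assumes "i \<noteq> j" "i \<notin> e" "j \<notin> e"
  shows "insert i e \<in> compress i j H \<longleftrightarrow> e \<in> link i j H \<or> e \<in> link j i H"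
    and "insert j e \<in> compress i j H \<longleftrightarrow> e \<in> link i j H \<and> e \<in> link j i H"
    and "e \<in> compress i j H \<longleftrightarrow> e \<in> H"
proof -
  have e: "insert j (insert i e - {i}) = insert j e" "insert i (insert j e - {j}) = insert i e"
    using assms by auto
  show "insert i e \<in> compress i j H \<longleftrightarrow> e \<in> link i j H \<or> e \<in> link j i H"
    "insert j e \<in> compress i j H \<longleftrightarrow> e \<in> link i j H \<and> e \<in> link j i H"
    "e \<in> compress i j H \<longleftrightarrow> e \<in> H"
    using mem_compress_iff[OF assms(1), of "insert i e" H] mem_compress_iff[OF assms(1), of "insert j e" H]
      mem_compress_iff[OF assms(1), of e H] e assms unfolding link_def by auto
qed

text \<open>Compression only trades \<open>j\<close> for \<open>i\<close>, so every newly created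
  two-element cover contains \<open>i\<close> but not \<open>j\<close>.\<close>

lemma covered_compress:
  assumes "covered (compress i j H) x y" "x \<noteq> i \<and> y \<noteq> i \<or> {x, y} = {i, j}"
  shows "covered H x y"
  unfolding covered_def
proof
  fix F assume F: "F \<in> H"
  from compress_cases[OF F, of i j] show "x \<in> F \<or> y \<in> F"
  proof (elim disjE conjE)
    assume "F \<in> compress i j H"
    then show ?thesis using assms(1) unfolding covered_def by blast
  next
    assume j: "j \<in> F" and F': "insert i (F - {j}) \<in> compress i j H"
    have m: "x \<in> insert i (F - {j}) \<or> y \<in> insert i (F - {j})"
      using bspec[OF assms(1)[unfolded covered_def] F'] .
    show ?thesis using assms(2)
    proof
      assume "x \<noteq> i \<and> y \<noteq> i"
      then show ?thesis using m by blast
    next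
      assume "{x, y} = {i, j}"
      then have "j \<in> {x, y}" by simp
      then show ?thesis using j by auto
    qed
  qed
qed

text \<open>The hypotheses describe what \<open>J_2\<close> and \<open>G_{k-1}\<close> with
  \<open>x0 = i\<close> have in common. If \<open>H\<close> had no two-element cover, its links
  \<open>C\<close>, \<open>D\<close> at \<open>i\<close>, \<open>j\<close> would together contain
  all \<open>l\<close>-sets meeting \<open>E\<close> and share at most \<open>E\<close>. With at
  least two members each they would then reach \<open>cross_bound\<close> with equality and be
  disjoint, which no extremal pair permits. So one link has at most one member, and a point of
  \<open>E\<close> together with \<open>i\<close> or \<open>j\<close> covers
  \<open>H\<close>.\<close>

lemma compress_extremal_two_cover:
  assumes X: "finite X" "3 \<le> k" "2 * k < card X" and H: "H \<subseteq> ksets X k" "intersecting H"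
    and ij: "i \<in> X" "j \<in> X" "i \<noteq> j"
    and E: "E \<subseteq> X" "i \<notin> E" "card E = k - 1"
    and out: "\<And>F. F \<in> compress i j H \<Longrightarrow> i \<notin> F \<Longrightarrow> E \<subseteq> F"
    and inn: "\<And>F. F \<in> ksets X k \<Longrightarrow> i \<in> F \<Longrightarrow> F \<inter> E \<noteq> {} \<Longrightarrow> F \<in> compress i j H"
  shows "two_cover X H"
proof (rule ccontr)
  assume no: "\<not> two_cover X H"
  have nocov: "\<not> covered H x y" if "x \<in> X" "y \<in> X" "x \<noteq> y" for x y
    using no that unfolding two_cover_def by blast
  have jE: "j \<notin> E"
  proof
    assume "j \<in> E"
    then have "covered (compress i j H) i j" using out unfolding covered_def by blast
    then show False using covered_compress[of i j H i j] nocov[OF ij] by blast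
  qed
  define V where "V = X - {i, j}"
  define l where "l = k - 1"
  have V: "finite V" "card V = card X - 2" using X ij unfolding V_def by auto
  have l: "2 \<le> l" "2 * l < card V" "k = Suc l" using X V unfolding l_def by auto
  have EV: "E \<subseteq> V" "card E = l" using E jE unfolding V_def l_def by auto
  have Ene: "E \<noteq> {}" using EV l by auto
  define C where "C = link i j H"
  define D where "D = link j i H"
  have lk: "C \<subseteq> ksets V l" "D \<subseteq> ksets V l"
    using link_ksets(1,2)[OF X(1) H(1), where x = i and y = j] unfolding V_def l_def C_def D_def by simp_all
  have cross: "cross_intersecting C D" using link_cross_intersecting[OF ij(3) H(2)] unfolding C_def D_def .
  have finCD: "finite C" "finite D" using lk finite_ksets[OF V(1)] finite_subset by blast+
  let ?T = "{e \<in> ksets V l. e \<inter> E \<noteq> {}}"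
  have T: "?T \<subseteq> C \<union> D"
  proof
    fix e assume e: "e \<in> ?T"
    then have e': "i \<notin> e" "j \<notin> e" unfolding V_def ksets_def by auto
    have "insert i e \<in> ksets X k"
      using ksets_add[OF X(1), of e i j l] e ij l(3) unfolding V_def by simp
    then have "insert i e \<in> compress i j H" using inn[of "insert i e"] e by blast
    then show "e \<in> C \<union> D" using compress_link(1)[OF ij(3) e'] unfolding C_def D_def by blast
  qed
  have CD: "C \<inter> D \<subseteq> {E}"
  proof
    fix e assume e: "e \<in> C \<inter> D"
    then have e': "i \<notin> e" "j \<notin> e" unfolding C_def link_def by auto
    have ek: "e \<in> ksets V l" using e lk by auto
    have "insert j e \<in> compress i j H" using compress_link(2)[OF ij(3) e'] e unfolding C_def D_def by blast
    then have "E \<subseteq> insert j e" using out[of "insert j e"] e' ij(3) by blast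
    then have "E \<subseteq> e" using jE by blast
    moreover have "finite e" "card e = l" using ek ksets_finite_mem[OF V(1) ek] unfolding ksets_def by auto
    ultimately have "E = e" using card_subset_eq[of e E] EV(2) by simp
    then show "e \<in> {E}" by simp
  qed
  have Tcard: "int (card ?T) = int (card V choose l) - int ((card V - l) choose l)"
    using card_ksets_meet[OF V(1) EV(1), of l, unfolded EV(2)] by linarith
  have "card C + card D = card (C \<union> D) + card (C \<inter> D)" using finCD by (rule card_Un_Int)
  moreover have "card ?T \<le> card (C \<union> D)" using T finCD by (intro card_mono) auto
  ultimately have sumge: "card ?T + card (C \<inter> D) \<le> card C + card D" by linarith
  have small: "card C \<le> 1 \<or> card D \<le> 1"
  proof (rule ccontr)
    assume "\<not> (card C \<le> 1 \<or> card D \<le> 1)"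
    then have two: "2 \<le> card C" "2 \<le> card D" by auto
    have nc: "\<not> (\<exists>z. \<forall>e\<in>C \<union> D. z \<in> e)"
    proof
      assume "\<exists>z. \<forall>e\<in>C \<union> D. z \<in> e"
      then obtain z where z: "\<And>e. e \<in> C \<union> D \<Longrightarrow> z \<in> e" by blast
      have "\<not> E \<subseteq> {z}" using EV l(1) card_mono[of "{z}" E] by auto
      then obtain a where a: "a \<in> E" "a \<noteq> z" by auto
      have "card (V - {z}) \<ge> l" using diff_card_le_card_Diff[of "{z}" V] l(1,2) by simp
      moreover have "{a} \<subseteq> V - {z}" "card {a} \<le> l" using a EV l by auto
      moreover have "finite (V - {z})" using V by simp
      ultimately obtain e where e: "{a} \<subseteq> e" "e \<subseteq> V - {z}" "card e = l"
        using exists_subset_between[of "{a}" l "V - {z}"] by blast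
      then have "e \<in> ?T" using a(1) unfolding ksets_def by blast
      then have "z \<in> e" using T z by blast
      then show False using e by blast
    qed
    note main = cross_intersecting_bound[OF V(1) l(1,2) lk(1) two(1) lk(2) two(2) cross nc]
    have eq: "int (card C + card D) = cross_bound (card V) l" "card (C \<inter> D) = 0"
      using main cross_bound_le_meet(1)[OF l(1,2)] Tcard sumge by linarith+
    have nl: "l \<noteq> 3" using eq cross_bound_le_meet(2)[OF l(1,2)] Tcard sumge by auto
    have disj: "C \<inter> D = {}" using eq(2) finCD by simp
    \<comment> \<open>The two families of a tight pair share the set \<open>p\<close>, since
      \<open>p\<close> meets \<open>q\<close>; disjoint links are therefore not tight.\<close>
    have nt: "\<not> tight_pair V l P Q" if PQ: "P \<inter> Q = {}" for P Q
    proof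
      assume "tight_pair V l P Q"
      then obtain p q where pq: "p \<in> ksets V l" "q \<in> ksets V l" "card (p \<union> q) = l + 1" "P = {p, q}"
        "Q = {F \<in> ksets V l. F \<inter> p \<noteq> {} \<and> F \<inter> q \<noteq> {}}" unfolding tight_pair_def by (elim exE conjE)
      have f: "finite p" "finite q" "card p = l" "card q = l"
        using ksets_finite_mem[OF V(1)] pq(1,2) unfolding ksets_def by blast+
      have "card (p \<inter> q) \<noteq> 0" using card_Un_Int[OF f(1,2)] f pq(3) l(1) by linarith
      then have "p \<inter> q \<noteq> {}" by auto
      moreover have "p \<noteq> {}" using f l by auto
      ultimately have "p \<in> Q" using pq(1) unfolding pq(5) by simp
      then show False using PQ pq(4) by blast
    qed
    have "D \<inter> C = {}" using disj by blast
    then show False using main eq(1) nl nt[OF disj] nt[of D C] by blast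
  qed
  have ET: "E \<in> ?T" using EV Ene unfolding ksets_def by simp
  have neither: "E \<subseteq> F" if "F \<in> H" "i \<notin> F" "j \<notin> F" for F
    using compress_link(3)[OF ij(3) that(2,3), of H] out[of F] that by blast
  \<comment> \<open>\<open>S\<close> is the small link. Its only possible member meets
    \<open>E\<close>, because \<open>E\<close> itself lies in one of the two links. A point
    \<open>y\<close> of \<open>E\<close> in this member then covers \<open>H\<close> together with
    \<open>x\<close>.\<close>
  have finish: False
    if S: "card S \<le> 1" "finite S" and cr: "\<And>a b. a \<in> S \<Longrightarrow> b \<in> R \<Longrightarrow> a \<inter> b \<noteq> {}" and SR: "S \<union> R = C \<union> D"
      and x: "x \<in> X" "x \<notin> E" and cov: "\<And>F. F \<in> H \<Longrightarrow> x \<notin> F \<Longrightarrow> E \<subseteq> F \<or> (\<exists>e\<in>S. e \<subseteq> F)" for S R x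
  proof -
    have "\<exists>y\<in>E. \<forall>e\<in>S. y \<in> e"
    proof (cases "S = {}")
      case True
      then show ?thesis using Ene by blast
    next
      case False
      then have "card S = 1" using S by (simp add: le_Suc_eq)
      then obtain s where s: "S = {s}" using card_1_singletonE by blast
      have "s \<inter> E \<noteq> {}"
      proof
        assume e: "s \<inter> E = {}"
        have "E \<in> S \<union> R" using ET T SR by blast
        then consider "E = s" | "E \<in> R" using s by blast
        then show False
        proof cases
          case 1
          then show ?thesis using e Ene by blast
        next
          case 2
          then show ?thesis using cr[of s E] s e by blast
        qed
      qed
      then show ?thesis using s by blast
    qed
    then obtain y where y: "y \<in> E" "\<And>e. e \<in> S \<Longrightarrow> y \<in> e" by blast
    have "covered H x y" unfolding covered_def
    proof
      fix F assume "F \<in> H"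
      then show "x \<in> F \<or> y \<in> F" using cov[of F] y by blast
    qed
    moreover have "y \<in> X" "x \<noteq> y" using y(1) E(1) x(2) by auto
    ultimately show False using nocov[OF x(1)] by blast
  qed
  have crCD: "a \<inter> b \<noteq> {}" if "a \<in> C" "b \<in> D" for a b
    using cross that unfolding cross_intersecting_def by blast
  from small show False
  proof
    assume "card C \<le> 1"
    moreover have "E \<subseteq> F \<or> (\<exists>e\<in>C. e \<subseteq> F)" if F: "F \<in> H" "j \<notin> F" for F
    proof (cases "i \<in> F")
      case True
      then have "F - {i} \<in> C" using mem_link[of i F j H] F unfolding C_def by blast
      then show ?thesis by blast
    next
      case False
      then show ?thesis using neither F by blast
    qed
    ultimately show False using finish[of C D j] finCD crCD ij(2) jE by blast
  next
    assume "card D \<le> 1"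
    moreover have "E \<subseteq> F \<or> (\<exists>e\<in>D. e \<subseteq> F)" if F: "F \<in> H" "i \<notin> F" for F
    proof (cases "j \<in> F")
      case True
      then have "F - {j} \<in> D" using mem_link[of j F i H] F unfolding D_def by blast
      then show ?thesis by blast
    next
      case False
      then show ?thesis using neither F by blast
    qed
    moreover have "a \<inter> b \<noteq> {}" if "a \<in> D" "b \<in> C" for a b using crCD[OF that(2,1)] by blast
    moreover have "D \<union> C = C \<union> D" by blast
    ultimately show False using finish[of D C i] finCD ij(1) E(2) by blast
  qed
qed


text \<open>The links \<open>C\<close>, \<open>D\<close> of \<open>H\<close> at \<open>i\<close>,
  \<open>j\<close> are disjoint, since a common set would give a second member of the compressed
  family avoiding \<open>i\<close>. They have at most as many members together as there are
  \<open>l\<close>-sets meeting a fixed \<open>l\<close>-set. The common link loses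
  \<open>(card V - k) choose (k - 2)\<close> sets, as its members meet \<open>F0\<close>. Adding 1
  for \<open>F0\<close> gives a total at least one below the bound.\<close>

lemma compress_single_exception_bound:
  assumes X: "finite X" "3 \<le> k" "2 * k < card X" and H: "H \<subseteq> ksets X k" "intersecting H"
    and ij: "i \<in> X" "j \<in> X" "i \<noteq> j"
    and F0: "F0 \<in> compress i j H" "i \<notin> F0" "j \<notin> F0"
    and uniq: "\<And>F. F \<in> compress i j H \<Longrightarrow> i \<notin> F \<Longrightarrow> F = F0"
    and no: "\<not> two_cover X H"
  shows "int (card H) < hk_bound (card X) k"
proof -
  have nocov: "\<not> covered H x y" if "x \<in> X" "y \<in> X" "x \<noteq> y" for x y
    using no that unfolding two_cover_def by blast
  define V where "V = X - {i, j}"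
  define l where "l = k - 1"
  have V: "finite V" "card V = card X - 2" using X ij unfolding V_def by auto
  have l: "2 \<le> l" "2 * l < card V" "k = Suc l" using X V unfolding l_def by auto
  have F0H: "F0 \<in> H" using compress_link(3)[OF ij(3) F0(2,3)] F0(1) by blast
  then have F0k: "F0 \<subseteq> V" "card F0 = k" using H(1) F0 unfolding ksets_def V_def by auto
  have fH: "finite H" using H finite_ksets[OF X(1)] finite_subset by blast
  have neither: "{F \<in> H. i \<notin> F \<and> j \<notin> F} = {F0}"
  proof -
    have "F = F0" if "F \<in> H" "i \<notin> F" "j \<notin> F" for F
      using uniq[of F] compress_link(3)[OF ij(3) that(2,3), of H] that by blast
    then show ?thesis using F0H F0(2,3) by blast
  qed
  define C where "C = link i j H"
  define D where "D = link j i H"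
  have lk: "C \<subseteq> ksets V l" "D \<subseteq> ksets V l" "link_both i j H \<subseteq> ksets V (k - 2)"
    using link_ksets[OF X(1) H(1), where x = i and y = j] ij(3) unfolding V_def l_def C_def D_def by simp_all
  have cross: "cross_intersecting C D" using link_cross_intersecting[OF ij(3) H(2)] unfolding C_def D_def .
  have finCD: "finite C" "finite D" using lk finite_ksets[OF V(1)] finite_subset by blast+
  have disj: "C \<inter> D = {}"
  proof -
    have False if e: "e \<in> C" "e \<in> D" for e
    proof -
      have e': "i \<notin> e" "j \<notin> e" using e unfolding C_def link_def by auto
      have "insert j e \<in> compress i j H" using compress_link(2)[OF ij(3) e'] e unfolding C_def D_def by blast
      then have "insert j e = F0" using uniq[of "insert j e"] e' ij(3) by blast
      then show False using F0(3) by blast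
    qed
    then show ?thesis by blast
  qed
  have F0ne: "F0 \<noteq> {}" using F0k X(2) by auto
  then obtain f where f: "f \<in> F0" by blast
  then have fX: "f \<in> X" "f \<noteq> i" "f \<noteq> j" using F0k(1) unfolding V_def by auto
  have ne: "C \<noteq> {}" "D \<noteq> {}"
  proof -
    have cov: "i \<in> F \<or> j \<in> F \<or> f \<in> F" if F: "F \<in> H" for F
    proof (cases "i \<in> F \<or> j \<in> F")
      case False
      then have "F \<in> {F \<in> H. i \<notin> F \<and> j \<notin> F}" using F by simp
      then show ?thesis using f unfolding neither by blast
    qed blast
    show "C \<noteq> {}"
    proof
      assume "C = {}"
      then have "j \<in> F" if "F \<in> H" "i \<in> F" for F
        using mem_link[of i F j H] that unfolding C_def by blast
      then have "covered H j f" unfolding covered_def using cov by blast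
      then show False using nocov[OF ij(2) fX(1)] fX by blast
    qed
    show "D \<noteq> {}"
    proof
      assume "D = {}"
      then have "i \<in> F" if "F \<in> H" "j \<in> F" for F
        using mem_link[of j F i H] that unfolding D_def by blast
      then have "covered H i f" unfolding covered_def using cov by blast
      then show False using nocov[OF ij(1) fX(1)] fX by blast
    qed
  qed
  have single: "int (card P + card Q) \<le> int (card V choose l) - int ((card V - l) choose l)"
    if P: "card P = 1" "P \<subseteq> ksets V l" and Q: "Q \<subseteq> ksets V l" and PQ: "P \<inter> Q = {}" "cross_intersecting P Q" for P Q
  proof -
    obtain p where p: "P = {p}" using P(1) card_1_singletonE by blast
    have pk: "p \<subseteq> V" "card p = l" using P(2) p unfolding ksets_def by auto
    let ?T = "{F \<in> ksets V l. F \<inter> p \<noteq> {}}"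
    have fT: "finite ?T" using finite_ksets[OF V(1)] by simp
    have "Q \<subseteq> ?T"
    proof (rule subset_CollectI[OF Q])
      fix q assume "q \<in> Q"
      then have "p \<inter> q \<noteq> {}" using PQ(2) p unfolding cross_intersecting_def by blast
      then show "q \<inter> p \<noteq> {}" by blast
    qed
    moreover have "p \<in> ?T" using pk l unfolding ksets_def by auto
    moreover have "p \<notin> Q" using PQ(1) p by blast
    ultimately have "Q \<subset> ?T" by blast
    then have "card Q < card ?T" using fT by (rule psubset_card_mono[rotated])
    then show ?thesis using card_ksets_meet[OF V(1) pk(1), of l, unfolded pk(2)] P(1) by linarith
  qed
  have CDb: "int (card C + card D) \<le> int (card V choose l) - int ((card V - l) choose l)"
  proof -
    have "1 \<le> card C" "1 \<le> card D" using ne finCD by (simp_all add: Suc_le_eq card_gt_0_iff)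
    then consider "card C = 1" | "card D = 1" | "2 \<le> card C" "2 \<le> card D" by linarith
    then show ?thesis
    proof cases
      case 1
      then show ?thesis using single[OF 1 lk(1,2) disj cross] by simp
    next
      case 2
      have "D \<inter> C = {}" "cross_intersecting D C" using disj cross cross_intersecting_commute by blast+
      then show ?thesis using single[OF 2 lk(2,1)] by simp
    next
      case 3
      show ?thesis
      proof (cases "\<exists>z. \<forall>e\<in>C \<union> D. z \<in> e")
        case False
        then show ?thesis
          using cross_intersecting_bound[OF V(1) l(1,2) lk(1) 3(1) lk(2) 3(2) cross False]
            cross_bound_le_meet(1)[OF l(1,2)] by linarith
      next
        case True
        \<comment> \<open>\<open>cross_intersecting_bound\<close> does not cover a common point for
          \<open>l = 2\<close>. Here disjointness helps: all members of both links meet one fixed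
          member \<open>c\<close>, and none is counted twice.\<close>
        then obtain z where z: "\<And>e. e \<in> C \<union> D \<Longrightarrow> z \<in> e" by blast
        obtain c where c: "c \<in> C" using ne by blast
        then have "z \<in> c" "c \<in> ksets V l" using z lk by blast+
        then have ck: "z \<in> c" "c \<subseteq> V" "card c = l" unfolding ksets_def by auto
        have "C \<union> D \<subseteq> {F \<in> ksets V l. F \<inter> c \<noteq> {}}"
        proof (rule subset_CollectI)
          show "C \<union> D \<subseteq> ksets V l" using lk by blast
          fix F assume "F \<in> C \<union> D"
          then show "F \<inter> c \<noteq> {}" using z[of F] ck(1) by blast
        qed
        then have "card (C \<union> D) \<le> card {F \<in> ksets V l. F \<inter> c \<noteq> {}}"
          using finite_ksets[OF V(1)] by (intro card_mono) auto
        moreover have "card (C \<union> D) = card C + card D" using finCD disj by (simp add: card_Un_disjoint)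
        ultimately show ?thesis
          using card_ksets_meet[OF V(1) ck(2), of l, unfolded ck(3)] by linarith
      qed
    qed
  qed
  have both: "card (link_both i j H) + ((card V - k) choose (k - 2)) \<le> card V choose (k - 2)"
  proof -
    have "link_both i j H \<subseteq> {e \<in> ksets V (k - 2). e \<inter> F0 \<noteq> {}}"
    proof (rule subset_CollectI[OF lk(3)])
      fix e assume "e \<in> link_both i j H"
      then have "insert i (insert j e) \<inter> F0 \<noteq> {}"
        using H(2) F0H unfolding link_both_def intersecting_def by blast
      then show "e \<inter> F0 \<noteq> {}" using F0(2,3) by blast
    qed
    then have "card (link_both i j H) \<le> card {e \<in> ksets V (k - 2). e \<inter> F0 \<noteq> {}}"
      using finite_ksets[OF V(1)] by (intro card_mono) auto
    then show ?thesis using card_ksets_meet[OF V(1) F0k(1), of "k - 2", unfolded F0k(2)] by linarith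
  qed
  have "card H = 1 + card C + card D + card (link_both i j H)"
    using card_link_split[OF fH ij(3)] unfolding neither C_def D_def by simp
  moreover have "hk_bound (card X) k = int (card V choose (k - 2)) + cross_bound (card V) l"
    using hk_bound_eq[of k "card X"] X V(2) unfolding l_def by simp
  moreover have "card V - l - 1 = card V - k" "l - 1 = k - 2" using l(3) by auto
  ultimately show ?thesis using both CDb unfolding cross_bound_def by simp
qed


section \<open>Reduction to shifted families in the absence of a two-element cover\<close>

lemma intersecting_iff_cross: "intersecting H \<longleftrightarrow> cross_intersecting H H"
  unfolding intersecting_def cross_intersecting_def ..

text \<open>A cover created by the compression has the form \<open>{i, q}\<close> with
  \<open>q \<noteq> j\<close>. The link \<open>A\<close> of the compressed family at
  \<open>i\<close> has no common point \<open>z\<close>, for otherwise \<open>q\<close> and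
  \<open>z\<close> would form a cover without \<open>i\<close>. If the link \<open>B\<close> at
  \<open>q\<close> is a singleton, there is a single exceptional member; otherwise
  \<open>covered_bound\<close> applies. Equality in it leaves only extremal pairs in which
  \<open>A\<close> has no common point, and those fall under
  \<open>compress_extremal_two_cover\<close>.\<close>

lemma no_two_cover_compress_step:
  assumes X: "finite X" "3 \<le> k" "2 * k < card X" and H: "H \<subseteq> ksets X k" "intersecting H"
    and ij: "i \<in> X" "j \<in> X" "i \<noteq> j" and no: "\<not> two_cover X H"
    and IH: "\<not> two_cover X (compress i j H) \<Longrightarrow> int (card (compress i j H)) < hk_bound (card X) k"
  shows "int (card H) < hk_bound (card X) k"
proof (cases "two_cover X (compress i j H)")
  case False
  then show ?thesis using IH by (simp add: card_compress)
next
  case True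
  let ?S = "compress i j H"
  have S: "?S \<subseteq> ksets X k" "intersecting ?S"
    using compress_ksets[OF X(1) ij(1) H(1)] compress_cross_intersecting[OF ij(3)] H(2)
    unfolding intersecting_iff_cross by blast+
  have cov: "i \<in> {x, y} \<and> j \<notin> {x, y}"
    if xy: "x \<in> X" "y \<in> X" "x \<noteq> y" and c: "covered ?S x y" for x y
  proof -
    have nc: "\<not> covered H x y" using no xy unfolding two_cover_def by blast
    have "\<not> (x \<noteq> i \<and> y \<noteq> i \<or> {x, y} = {i, j})"
      using covered_compress[OF c] nc by blast
    then show ?thesis using xy(3) ij(3) by (auto simp: doubleton_eq_iff)
  qed
  obtain q where q: "q \<in> X" "q \<noteq> i" "q \<noteq> j" and cq: "covered ?S i q"
  proof -
    obtain x y where xy: "x \<in> X" "y \<in> X" "x \<noteq> y" "covered ?S x y" using True unfolding two_cover_def by blast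
    have ic: "i \<in> {x, y}" "j \<notin> {x, y}" using cov[OF xy] by blast+
    have "covered ?S y x" using xy(4) unfolding covered_def by blast
    then show ?thesis using that[of x] that[of y] xy ic by auto
  qed
  define A where "A = link i q ?S"
  define B where "B = link q i ?S"
  let ?V = "X - {i, q}"
  have V: "finite ?V" using X by simp
  have iq: "i \<noteq> q" using q by simp
  have lk: "A \<subseteq> ksets ?V (k - 1)" "B \<subseteq> ksets ?V (k - 1)"
    using link_ksets(1,2)[OF X(1) S(1), where x = i and y = q] unfolding A_def B_def by simp_all
  have finAB: "finite A" "finite B" using lk finite_ksets[OF V] finite_subset by blast+
  have inA: "F - {i} \<in> A" "i \<in> F" if "F \<in> ?S" "q \<notin> F" for F
  proof -
    show "i \<in> F" using cq that unfolding covered_def by blast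
    then show "F - {i} \<in> A" using mem_link[of i F q ?S] that unfolding A_def by blast
  qed
  have inB: "F - {q} \<in> B" "q \<in> F" if "F \<in> ?S" "i \<notin> F" for F
  proof -
    show "q \<in> F" using cq that unfolding covered_def by blast
    then show "F - {q} \<in> B" using mem_link[of q F i ?S] that unfolding B_def by blast
  qed
  have no_z: "\<not> (\<forall>e\<in>A. z \<in> e)" for z
  proof
    assume z: "\<forall>e\<in>A. z \<in> e"
    have c: "covered ?S q z" unfolding covered_def using inA(1) z by blast
    show False
    proof (cases "A = {}")
      case True
      then have "covered ?S q j" unfolding covered_def using inA(1) by blast
      then show ?thesis using cov[of q j] q ij by blast
    next
      case False
      then obtain a where "a \<in> A" by blast
      then have "a \<subseteq> ?V" "z \<in> a" using lk z unfolding ksets_def by blast+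
      then have "z \<in> X" "z \<noteq> i" "z \<noteq> q" by blast+
      then show ?thesis using cov[of q z] c q by blast
    qed
  qed
  have A2: "2 \<le> card A"
  proof (rule ccontr)
    assume "\<not> 2 \<le> card A"
    then consider "card A = 0" | "card A = 1" by linarith
    then show False
    proof cases
      case 1
      then show ?thesis using no_z finAB by auto
    next
      case 2
      then obtain a where a: "A = {a}" using card_1_singletonE by blast
      then have "card a = k - 1" using lk unfolding ksets_def by blast
      then have "a \<noteq> {}" using X(2) by auto
      then show ?thesis using no_z a by blast
    qed
  qed
  show ?thesis
  proof (cases "2 \<le> card B")
    case False
    have "B \<noteq> {}"
    proof
      assume "B = {}"
      then have "covered ?S i j" unfolding covered_def using inB(1) by blast
      then show False using cov[OF ij] by blast
    qed
    then have "card B \<noteq> 0" using finAB by simp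
    then have "card B = 1" using False by linarith
    then obtain b where b: "B = {b}" using card_1_singletonE by blast
    then have "b \<in> B" by simp
    then have bS: "insert q b \<in> ?S" "i \<notin> insert q b" using iq unfolding B_def link_def by auto
    have uniq: "F = insert q b" if "F \<in> ?S" "i \<notin> F" for F
    proof -
      have "F - {q} = b" "q \<in> F" using inB[OF that] b by auto
      then show ?thesis by blast
    qed
    have "j \<notin> insert q b"
    proof
      assume "j \<in> insert q b"
      then have "covered ?S i j" unfolding covered_def using uniq by blast
      then show False using cov[OF ij] by blast
    qed
    then show ?thesis
      using compress_single_exception_bound[OF X H ij bS(1,2) _ uniq no] by blast
  next
    case True
    have nc: "\<not> (\<exists>z. \<forall>e\<in>A \<union> B. z \<in> e)" using no_z by blast
    note bound = covered_bound[OF X S ij(1) q(1) iq cq A2[unfolded A_def] True[unfolded B_def]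
        nc[unfolded A_def B_def], folded A_def B_def]
    have "int (card ?S) \<noteq> hk_bound (card X) k"
    proof
      assume eq: "int (card ?S) = hk_bound (card X) k"
      have full: "link_both i q ?S = ksets ?V (k - 2)" using bound(2)[OF eq] by blast
      \<comment> \<open>\<open>e0\<close> is the core common to all members of \<open>B\<close>: the
        intersection \<open>P \<inter> Q\<close> for a tight pair, the edge \<open>{z, w}\<close>
        for a sporadic one. Together with \<open>q\<close> it forms the set \<open>E\<close> of the
        extremal family.\<close>
      have fin: False
        if E: "e0 \<subseteq> ?V" "card e0 = k - 2" and out: "\<And>b. b \<in> B \<Longrightarrow> e0 \<subseteq> b"
          and inn: "\<And>a. a \<in> ksets ?V (k - 1) \<Longrightarrow> a \<inter> e0 \<noteq> {} \<Longrightarrow> a \<in> A" for e0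
      proof -
        let ?E = "insert q e0"
        have fe: "finite e0" using E(1) V finite_subset by blast
        have "two_cover X H"
        proof (rule compress_extremal_two_cover[OF X H ij])
          show "?E \<subseteq> X" "i \<notin> ?E" using E q iq by blast+
          have "q \<notin> e0" using E(1) by blast
          then show "card ?E = k - 1" using E(2) fe X(2) by simp
          fix F assume F: "F \<in> ?S" "i \<notin> F"
          show "?E \<subseteq> F" using inB[OF F] out[of "F - {q}"] by blast
        next
          fix F assume F: "F \<in> ksets X k" "i \<in> F" "F \<inter> ?E \<noteq> {}"
          have Fk: "F \<subseteq> X" "card F = k" "finite F" using F(1) ksets_finite_mem[OF X(1) F(1)] unfolding ksets_def by auto
          show "F \<in> ?S"
          proof (cases "q \<in> F")
            case True
            have "F - {i, q} \<in> ksets ?V (k - 2)"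
              using Fk F(2) True iq unfolding ksets_def by (auto simp: card_Diff_subset)
            then have "insert i (insert q (F - {i, q})) \<in> ?S" using full unfolding link_both_def by blast
            moreover have "insert i (insert q (F - {i, q})) = F" using F(2) True by blast
            ultimately show ?thesis by simp
          next
            case False
            have "F - {i} \<in> ksets ?V (k - 1)" using Fk F(2) False unfolding ksets_def by auto
            moreover have "(F - {i}) \<inter> e0 \<noteq> {}" using F(3) False E(1) by blast
            ultimately have "F - {i} \<in> A" using inn by blast
            then show ?thesis using F(2) unfolding A_def link_def by (simp add: insert_absorb)
          qed
        qed
        then show False using no by blast
      qed
      have tA: False if t: "tight_pair ?V (k - 1) A B"
      proof -
        obtain P Q where PQ: "P \<in> ksets ?V (k - 1)" "Q \<in> ksets ?V (k - 1)" "card (P \<union> Q) = k - 1 + 1" "A = {P, Q}"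
          using t unfolding tight_pair_def by (elim exE conjE)
        have "finite P" "finite Q" "card P = k - 1" "card Q = k - 1"
          using PQ(1,2) ksets_finite_mem[OF V] unfolding ksets_def by blast+
        then have "card (P \<inter> Q) \<noteq> 0" using card_Un_Int[of P Q] PQ(3) X(2) by linarith
        then obtain z where "z \<in> P" "z \<in> Q" by (metis Int_iff card.empty ex_in_conv)
        then show False using no_z[of z] PQ(4) by simp
      qed
      have tB: False if t: "tight_pair ?V (k - 1) B A"
      proof -
        obtain P Q where PQ: "P \<in> ksets ?V (k - 1)" "Q \<in> ksets ?V (k - 1)" "card (P \<union> Q) = k - 1 + 1" "B = {P, Q}"
          and A: "A = {F \<in> ksets ?V (k - 1). F \<inter> P \<noteq> {} \<and> F \<inter> Q \<noteq> {}}"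
          using t unfolding tight_pair_def by (elim exE conjE)
        have PQf: "finite P" "finite Q" "card P = k - 1" "card Q = k - 1" "P \<subseteq> ?V"
          using PQ(1,2) ksets_finite_mem[OF V] unfolding ksets_def by blast+
        then have c: "card (P \<inter> Q) = k - 2" using card_Un_Int[of P Q] PQ(3) X(2) by linarith
        show False
        proof (rule fin[of "P \<inter> Q"])
          show "P \<inter> Q \<subseteq> ?V" "card (P \<inter> Q) = k - 2" using PQf(5) c by blast+
          show "P \<inter> Q \<subseteq> b" if "b \<in> B" for b using that PQ(4) by blast
          show "a \<in> A" if "a \<in> ksets ?V (k - 1)" "a \<inter> (P \<inter> Q) \<noteq> {}" for a
            unfolding A using that by blast
        qed
      qed
      have sp: False if k4: "k = 4" and s: "sporadic_pair ?V A B"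
        using s unfolding sporadic_pair_def
      proof (elim disjE bexE conjE)
        fix z assume "A = {F \<in> ksets ?V 3. z \<in> F}"
        then show False using no_z[of z] by simp
      next
        fix z w assume "A = {F \<in> ksets ?V 3. {z, w} \<subseteq> F}"
        then show False using no_z[of z] by simp
      next
        fix z w assume zw: "z \<in> ?V" "w \<in> ?V" "z \<noteq> w"
          and B: "B = {F \<in> ksets ?V 3. {z, w} \<subseteq> F}" and A: "A = {F \<in> ksets ?V 3. F \<inter> {z, w} \<noteq> {}}"
        show False
        proof (rule fin[of "{z, w}"])
          show "{z, w} \<subseteq> ?V" "card {z, w} = k - 2" using zw k4 by auto
          show "{z, w} \<subseteq> b" if "b \<in> B" for b using that unfolding B by simp
          show "a \<in> A" if "a \<in> ksets ?V (k - 1)" "a \<inter> {z, w} \<noteq> {}" for a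
            unfolding A using that k4 by simp
        qed
      qed
      show False using bound(2)[OF eq] tA tB sp by blast
    qed
    then show ?thesis using bound(1) by (simp add: card_compress)
  qed
qed

theorem no_two_cover_bound:
  assumes X: "finite X" "3 \<le> k" "2 * k < card X" and H: "H \<subseteq> ksets X k" "intersecting H"
    and no: "\<not> two_cover X H"
  shows "int (card H) < hk_bound (card X) k"
proof -
  obtain r where r: "ranked X r" using ranked_exists[OF X(1)] .
  \<comment> \<open>The induction is stated for pairs; equating the two families in the predicate
    specialises it to a single family.\<close>
  have "H = H \<longrightarrow> intersecting H \<longrightarrow> \<not> two_cover X H \<longrightarrow> int (card H) < hk_bound (card X) k"
  proof (rule compress_weight_pair_induct[OF X(1) H(1) H(1), where r = r
      and P = "\<lambda>A B. A = B \<longrightarrow> intersecting A \<longrightarrow> \<not> two_cover X A \<longrightarrow> int (card A) < hk_bound (card X) k"],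
      goal_cases)
    case (1 A B)
    then show ?case using shifted_no_two_cover_bound[OF X r, of A] by blast
  next
    case (2 i j A B)
    show ?case
    proof (intro impI)
      assume AB: "A = B" "intersecting A" "\<not> two_cover X A"
      have ne: "i \<noteq> j" using 2(5) by auto
      have "intersecting (compress i j A)"
        using compress_cross_intersecting[OF ne] AB(2) unfolding intersecting_iff_cross by blast
      then show "int (card A) < hk_bound (card X) k"
        using no_two_cover_compress_step[OF X 2(1) AB(2) 2(3,4) ne AB(3)] 2(6) AB(1) by blast
    qed
  qed
  then show ?thesis using H(2) no by blast
qed

section \<open>The extremal families\<close>

lemma subS_subset: "H \<subseteq> G \<Longrightarrow> subS X H X G"
  unfolding subS_def by (rule exI[of _ id]) auto

lemma iso_fam_refl: "iso_fam X G X G"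
  unfolding iso_fam_def using subS_subset by blast

lemma subS_card_le:
  assumes "finite G" "H \<subseteq> Pow X" "subS X H Y G"
  shows "card H \<le> card G"
proof -
  obtain f where f: "inj_on f X" "\<forall>E\<in>H. f ` E \<in> G" using assms(3) unfolding subS_def by blast
  have "inj_on (image f) H" using inj_on_image_Pow[OF f(1)] assms(2) by (rule inj_on_subset)
  then show ?thesis using f(2) assms(1) card_inj_on_le[of "image f" H G] by blast
qed

lemma iso_fam_card:
  assumes "finite X" "H \<subseteq> ksets X k" "G \<subseteq> ksets X k" "iso_fam X H X G"
  shows "card H = card G"
proof -
  have fin: "finite H" "finite G" using assms(1-3) finite_ksets finite_subset by blast+
  have "H \<subseteq> Pow X" "G \<subseteq> Pow X" using assms(2,3) unfolding ksets_def by auto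
  then show ?thesis
    using assms(4) subS_card_le[OF fin(2)] subS_card_le[OF fin(1)] unfolding iso_fam_def
    by (meson order_antisym)
qed

lemma card_through_point:
  assumes "finite X" "x \<in> X" "1 \<le> k"
  shows "card {G \<in> ksets X k. x \<in> G \<and> R (G - {x})} = card {e \<in> ksets (X - {x}) (k - 1). R e}"
proof -
  let ?T = "{e \<in> ksets (X - {x}) (k - 1). R e}"
  have "{G \<in> ksets X k. x \<in> G \<and> R (G - {x})} = insert x ` ?T"
  proof (intro equalityI subsetI)
    fix G assume "G \<in> {G \<in> ksets X k. x \<in> G \<and> R (G - {x})}"
    then have G: "G \<in> ksets X k" "x \<in> G" "R (G - {x})" by auto
    have "finite G" using ksets_finite_mem[OF assms(1) G(1)] .
    then have "G - {x} \<in> ksets (X - {x}) (k - 1)" using G(1,2) unfolding ksets_def by auto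
    then have "G - {x} \<in> ?T" using G(3) by simp
    moreover have "G = insert x (G - {x})" using G(2) by blast
    ultimately show "G \<in> insert x ` ?T" by (rule image_eqI[rotated])
  next
    fix G assume "G \<in> insert x ` ?T"
    then obtain e where e: "G = insert x e" "e \<in> ksets (X - {x}) (k - 1)" "R e" by blast
    have fe: "finite e" using ksets_finite_mem[OF _ e(2)] assms(1) by simp
    have xe: "x \<notin> e" using e(2) unfolding ksets_def by blast
    have "G \<in> ksets X k" using e(1,2) fe xe assms(2,3) unfolding ksets_def by auto
    moreover have "G - {x} = e" using e(1) xe by simp
    ultimately show "G \<in> {G \<in> ksets X k. x \<in> G \<and> R (G - {x})}" using e by simp
  qed
  then show ?thesis using card_insert_image[of ?T x] unfolding ksets_def by auto
qed

text \<open>Write \<open>J\<close> as \<open>x0\<close>, \<open>a\<close>, \<open>b\<close>. A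
  \<open>k\<close>-set through \<open>x0\<close> meets \<open>E\<close> or contains \<open>J\<close>
  exactly if its other points meet both \<open>insert a E\<close> and \<open>insert b E\<close>, and
  these two \<open>k\<close>-sets are the only members avoiding \<open>x0\<close>.
  Inclusion-exclusion on \<open>n - 1\<close> points then gives the bound in the form used in the
  theorem.\<close>

lemma card_Jfam:
  assumes X: "finite X" "3 \<le> k" "2 * k < card X"
    and E: "E \<subseteq> X" "card E = k - 1" and J: "J \<subseteq> X - E" "card J = 3" "x0 \<in> J"
  shows "int (card (Jfam X k E J x0)) = hk_bound (card X) k"
proof -
  have fE: "finite E" "finite J" using E J X(1) finite_subset by blast+
  have "card (J - {x0}) = 2" using J fE by simp
  then obtain a b where ab: "J - {x0} = {a, b}" "a \<noteq> b" by (auto simp: card_2_iff)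
  have Jab: "J = {x0, a, b}" "x0 \<noteq> a" "x0 \<noteq> b" using ab J(3) by blast+
  have out: "x0 \<notin> E" "a \<notin> E" "b \<notin> E" "x0 \<in> X" "a \<in> X" "b \<in> X" using J(1) Jab(1) by blast+
  let ?P = "insert a E" and ?Q = "insert b E" and ?V = "X - {x0}"
  let ?T = "{G \<in> ksets X k. x0 \<in> G \<and> (G - {x0}) \<inter> ?P \<noteq> {} \<and> (G - {x0}) \<inter> ?Q \<noteq> {}}"
  have PQ: "?P \<subseteq> ?V" "?Q \<subseteq> ?V" "card ?P = k" "card ?Q = k" "card (?P \<union> ?Q) = k + 1"
    using E out ab(2) Jab fE X(2) by (auto simp: insert_commute)
  have V: "finite ?V" "card ?V = card X - 1" using X out by auto
  have eqJ: "Jfam X k E J x0 = {?P, ?Q} \<union> ?T"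
  proof (intro equalityI subsetI)
    fix G assume "G \<in> Jfam X k E J x0"
    then have Gk: "G \<in> ksets X k" and G: "E \<subseteq> G \<and> G \<inter> J \<noteq> {} \<or> J \<subseteq> G \<or> x0 \<in> G \<and> G \<inter> E \<noteq> {}"
      unfolding Jfam_def by blast+
    have fG: "finite G" "card G = k" using Gk ksets_finite_mem[OF X(1) Gk] unfolding ksets_def by auto
    show "G \<in> {?P, ?Q} \<union> ?T"
    proof (cases "x0 \<in> G")
      case True
      have "(G - {x0}) \<inter> ?P \<noteq> {} \<and> (G - {x0}) \<inter> ?Q \<noteq> {}"
      proof (cases "G \<inter> E = {}")
        case True
        have "E \<noteq> {}" using E(2) X(2) by auto
        then have "J \<subseteq> G" using G True by blast
        then show ?thesis using Jab by blast
      next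
        case False
        then show ?thesis using out(1) by blast
      qed
      then show ?thesis using Gk True by blast
    next
      case False
      then have "E \<subseteq> G" "G \<inter> J \<noteq> {}" using G J(3) by blast+
      then have "?P \<subseteq> G \<or> ?Q \<subseteq> G" using Jab(1) False by blast
      then have "G = ?P \<or> G = ?Q" using card_subset_eq[OF fG(1)] fG(2) PQ(3,4) by metis
      then show ?thesis by blast
    qed
  next
    fix G assume G: "G \<in> {?P, ?Q} \<union> ?T"
    show "G \<in> Jfam X k E J x0"
    proof (cases "G \<in> ?T")
      case True
      then have T: "G \<in> ksets X k" "x0 \<in> G" "(G - {x0}) \<inter> ?P \<noteq> {}" "(G - {x0}) \<inter> ?Q \<noteq> {}" by auto
      have "G \<inter> E \<noteq> {} \<or> J \<subseteq> G" using T Jab by blast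
      then show ?thesis using T(1,2) unfolding Jfam_def by blast
    next
      case False
      then have "G = ?P \<or> G = ?Q" using G by blast
      then have "E \<subseteq> G" "G \<inter> J \<noteq> {}" "G \<subseteq> X" "card G = k" using Jab PQ(3,4) out E(1) by auto
      then show ?thesis unfolding Jfam_def ksets_def by blast
    qed
  qed
  have disj: "{?P, ?Q} \<inter> ?T = {}" using PQ(1,2) by blast
  have fin: "finite {?P, ?Q}" "finite ?T" using finite_ksets[OF X(1)] by simp_all
  have "card (Jfam X k E J x0) = card {?P, ?Q} + card ?T"
    unfolding eqJ by (rule card_Un_disjoint[OF fin disj])
  moreover have "?P \<noteq> ?Q" using ab(2) out by blast
  moreover have "card ?T = card {e \<in> ksets ?V (k - 1). e \<inter> ?P \<noteq> {} \<and> e \<inter> ?Q \<noteq> {}}"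
    using card_through_point[OF X(1) out(4), of k "\<lambda>e. e \<inter> ?P \<noteq> {} \<and> e \<inter> ?Q \<noteq> {}"] X(2) by linarith
  ultimately have c: "card (Jfam X k E J x0) = 2 + card {e \<in> ksets ?V (k - 1). e \<inter> ?P \<noteq> {} \<and> e \<inter> ?Q \<noteq> {}}"
    by simp
  have m: "card {e \<in> ksets ?V (k - 1). e \<inter> ?P \<noteq> {} \<and> e \<inter> ?Q \<noteq> {}}
      + ((card X - 1 - k) choose (k - 1)) + ((card X - 1 - k) choose (k - 1))
    = ((card X - 1) choose (k - 1)) + ((card X - 1 - (k + 1)) choose (k - 1))"
    using card_ksets_meet_both[OF V(1) PQ(1,2), of "k - 1", unfolded PQ(3,4,5) V(2)] .
  define n' where "n' = card X - k - 2"
  define k' where "k' = k - 2"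
  have n': "card X - 1 - k = Suc n'" and k': "k - 1 = Suc k'" using X(2,3) unfolding n'_def k'_def by simp_all
  have "card X - k - 1 = Suc n'" "card X - k - 2 = n'" "card X - 1 - (k + 1) = n'" "k - 2 = k'" using n' k' by auto
  then show ?thesis using c m n' k' unfolding hk_bound_def by simp
qed

lemma card_Gfam:
  assumes X: "finite X" and E: "E \<subseteq> X" "card E = s" "1 \<le> s" "s \<le> k" and x0: "x0 \<in> X - E"
  shows "card (Gfam X k E x0) + ((card X - 1 - s) choose (k - 1))
    = ((card X - 1) choose (k - 1)) + ((card X - 1 - s) choose (k - s))"
proof -
  let ?V = "X - {x0}"
  let ?S = "{G \<in> ksets ?V k. E \<subseteq> G}" and ?T = "{G \<in> ksets X k. x0 \<in> G \<and> (G - {x0}) \<inter> E \<noteq> {}}"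
  have V: "finite ?V" "card ?V = card X - 1" "E \<subseteq> ?V" "x0 \<in> X" using X x0 E by auto
  have "E \<noteq> {}" using E by auto
  then have "Gfam X k E x0 = ?S \<union> ?T" using x0 unfolding Gfam_def ksets_def by blast
  moreover have "?S \<inter> ?T = {}" unfolding ksets_def by blast
  moreover have "finite ?S" "finite ?T" using finite_ksets[OF X] finite_ksets[OF V(1)] by simp_all
  ultimately have "card (Gfam X k E x0) = card ?S + card ?T" by (simp add: card_Un_disjoint)
  moreover have "card ?S = (card X - 1 - s) choose (k - s)"
    using card_ksets_superset[OF V(1,3), of k] E V(2) by simp
  moreover have "card ?T = card {e \<in> ksets ?V (k - 1). e \<inter> E \<noteq> {}}"
    using card_through_point[OF X V(4), of k "\<lambda>e. e \<inter> E \<noteq> {}"] E by linarith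
  moreover have "card {e \<in> ksets ?V (k - 1). e \<inter> E \<noteq> {}} + ((card X - 1 - s) choose (k - 1)) = (card X - 1) choose (k - 1)"
    using card_ksets_meet[OF V(1,3), of "k - 1", unfolded E(2) V(2)] .
  ultimately show ?thesis by linarith
qed

lemma card_Gfam_4:
  assumes X: "finite X" "8 < card X" and E: "E \<subseteq> X" "card E = 2 \<or> card E = 3" and x0: "x0 \<in> X - E"
  shows "int (card (Gfam X 4 E x0)) = hk_bound (card X) 4"
proof -
  \<comment> \<open>The offset 6 makes all subtractions in the binomials exact, the largest being
    \<open>card X - 4 - 2\<close>.\<close>
  define m where "m = card X - 6"
  have m: "card X = m + 6" using X(2) unfolding m_def by simp
  have s3: "Suc x choose 3 = (x choose 2) + (x choose 3)" for x
    by (simp add: numeral_3_eq_3 numeral_2_eq_2)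
  have s2: "Suc x choose 2 = x + (x choose 2)" for x by (simp add: numeral_2_eq_2)
  have e: "m + 5 = Suc (Suc (Suc (Suc (Suc m))))" "m + 4 = Suc (Suc (Suc (Suc m)))"
    "m + 3 = Suc (Suc (Suc m))" "m + 2 = Suc (Suc m)" "m + 1 = Suc m" by auto
  have d: "m + 6 - 1 = m + 5" "m + 6 - 4 - 1 = m + 1" "m + 6 - 4 - 2 = m"
    "m + 6 - 1 - 2 = m + 3" "m + 6 - 1 - 3 = m + 2" by auto
  have hk: "hk_bound (card X) 4 = int ((m + 5) choose 3) - int ((m + 1) choose 3) - int (m choose 2) + 2"
    unfolding hk_bound_def m d by simp
  from E(2) show ?thesis
  proof
    assume E2: "card E = 2"
    have "card (Gfam X 4 E x0) + ((m + 3) choose 3) = ((m + 5) choose 3) + ((m + 3) choose 2)"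
      using card_Gfam[OF X(1) E(1) E2 _ _ x0, of 4] unfolding m d by (simp add: add.commute)
    then show ?thesis unfolding hk by (simp add: e s2 s3 del: binomial_Suc_Suc)
  next
    assume E3: "card E = 3"
    have "card (Gfam X 4 E x0) + ((m + 2) choose 3) = ((m + 5) choose 3) + (m + 2)"
      using card_Gfam[OF X(1) E(1) E3 _ _ x0, of 4] unfolding m d by (simp add: add.commute)
    then show ?thesis unfolding hk by (simp add: e s2 s3 del: binomial_Suc_Suc)
  qed
qed


section \<open>Recognising the extremal families from their links\<close>

lemma covered_cases:
  assumes "covered H x y" "F \<in> H"
  obtains "x \<in> F" "y \<in> F" | "x \<in> F" "y \<notin> F" "F - {x} \<in> link x y H"
    | "y \<in> F" "x \<notin> F" "F - {y} \<in> link y x H"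
proof (cases "x \<in> F")
  case True
  then show ?thesis using that(1,2) mem_link[OF True _ assms(2), of y] by blast
next
  case False
  then have "y \<in> F" using assms unfolding covered_def by blast
  then show ?thesis using that(3) False mem_link[OF _ False assms(2)] by blast
qed

lemma link_common_subset_Gfam:
  assumes "H \<subseteq> ksets X k" "covered H x y" "\<And>e. e \<in> link x y H \<union> link y x H \<Longrightarrow> z \<in> e"
  shows "H \<subseteq> Gfam X k {y, z} x"
proof
  fix F assume F: "F \<in> H"
  have Fk: "F \<in> ksets X k" using assms(1) F by blast
  from assms(2) F show "F \<in> Gfam X k {y, z} x"
  proof (cases rule: covered_cases)
    case 1
    then have "F \<inter> {y, z} \<noteq> {}" by blast
    then show ?thesis using Fk 1(1) unfolding Gfam_def by blast
  next
    case 2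
    then have "z \<in> F" using assms(3)[of "F - {x}"] by blast
    then have "F \<inter> {y, z} \<noteq> {}" by blast
    then show ?thesis using Fk 2(1) unfolding Gfam_def by blast
  next
    case 3
    then have "z \<in> F" using assms(3)[of "F - {y}"] by blast
    then have "{y, z} \<subseteq> F" using 3(1) by blast
    then show ?thesis using Fk unfolding Gfam_def by blast
  qed
qed

lemma link_edge_subset_Gfam:
  assumes "H \<subseteq> ksets X k" "covered H x y"
    and "\<And>e. e \<in> link x y H \<Longrightarrow> {z, w} \<subseteq> e" "\<And>e. e \<in> link y x H \<Longrightarrow> e \<inter> {z, w} \<noteq> {}"
  shows "H \<subseteq> Gfam X k {x, z, w} y"
proof
  fix F assume F: "F \<in> H"
  have Fk: "F \<in> ksets X k" using assms(1) F by blast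
  from assms(2) F show "F \<in> Gfam X k {x, z, w} y"
  proof (cases rule: covered_cases)
    case 1
    then have "F \<inter> {x, z, w} \<noteq> {}" by blast
    then show ?thesis using Fk 1(2) unfolding Gfam_def by blast
  next
    case 2
    then have "{x, z, w} \<subseteq> F" using assms(3)[of "F - {x}"] by blast
    then show ?thesis using Fk unfolding Gfam_def by blast
  next
    case 3
    then have "F \<inter> {x, z, w} \<noteq> {}" using assms(4)[of "F - {y}"] by blast
    then show ?thesis using Fk 3(1) unfolding Gfam_def by blast
  qed
qed

lemma Jfam_subset_ksets: "Jfam X k E J x0 \<subseteq> ksets X k"
  unfolding Jfam_def by blast

lemma Gfam_subset_ksets: "Gfam X k E x0 \<subseteq> ksets X k"
  unfolding Gfam_def by blast

text \<open>\<open>E\<close> is \<open>x\<close> with the common part of \<open>P\<close> and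
  \<open>Q\<close>, and \<open>J\<close> consists of \<open>y\<close> and the two points in which
  \<open>P\<close> and \<open>Q\<close> differ. Containment suffices, since both families have the
  extremal size.\<close>

lemma tight_pair_is_J:
  assumes X: "finite X" "3 \<le> k" "2 * k < card X" and H: "H \<subseteq> ksets X k"
    and xy: "x \<in> X" "y \<in> X" "x \<noteq> y" "covered H x y"
    and eq: "int (card H) = hk_bound (card X) k"
    and tight: "tight_pair (X - {x, y}) (k - 1) (link x y H) (link y x H)"
  shows "is_J X k 2 H"
proof -
  let ?V = "X - {x, y}"
  obtain P Q where PQ: "P \<in> ksets ?V (k - 1)" "Q \<in> ksets ?V (k - 1)" "card (P \<union> Q) = k - 1 + 1"
    and A: "link x y H = {P, Q}" and B: "link y x H = {F \<in> ksets ?V (k - 1). F \<inter> P \<noteq> {} \<and> F \<inter> Q \<noteq> {}}"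
    using tight unfolding tight_pair_def by (elim exE conjE)
  have V: "finite ?V" using X by simp
  have f: "finite P" "finite Q" "card P = k - 1" "card Q = k - 1" "P \<subseteq> ?V" "Q \<subseteq> ?V"
    using PQ(1,2) ksets_finite_mem[OF V] unfolding ksets_def by blast+
  then have c: "card (P \<inter> Q) = k - 2" using card_Un_Int[of P Q] PQ(3) X(2) by linarith
  have "card (P - Q) = 1" "card (Q - P) = 1"
    using card_Diff_subset_Int[of P Q] card_Diff_subset_Int[of Q P] f c X(2) by (simp_all add: Int_commute)
  then obtain p q where p: "P - Q = {p}" and q: "Q - P = {q}" by (metis card_1_singletonE)
  have pq: "p \<in> P" "p \<notin> Q" "q \<in> Q" "q \<notin> P" using p q by blast+
  have P: "P = insert p (P \<inter> Q)" and Q: "Q = insert q (P \<inter> Q)" using p q by blast+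
  define E where "E = insert x (P \<inter> Q)"
  define J where "J = {y, p, q}"
  have "finite (P \<inter> Q)" "x \<notin> P \<inter> Q" using f by auto
  then have E: "E \<subseteq> X" "card E = k - 1" using f(5) xy(1) c X(2) unfolding E_def by auto
  have "p \<noteq> q" "y \<noteq> p" "y \<noteq> q" using pq f(5,6) by blast+
  then have J: "J \<subseteq> X - E" "card J = 3" "y \<in> J"
    using xy pq f(5,6) unfolding J_def E_def by auto
  have sub: "H \<subseteq> Jfam X k E J y"
  proof
    fix F assume F: "F \<in> H"
    have Fk: "F \<in> ksets X k" using H F by blast
    from xy(4) F show "F \<in> Jfam X k E J y"
    proof (cases rule: covered_cases)
      case 1
      then have "F \<inter> E \<noteq> {}" unfolding E_def by blast
      then show ?thesis using Fk 1(2) unfolding Jfam_def by blast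
    next
      case 2
      then have "F - {x} = P \<or> F - {x} = Q" unfolding A by blast
      then have "P \<subseteq> F \<or> Q \<subseteq> F" by blast
      then have "E \<subseteq> F" "F \<inter> J \<noteq> {}" using 2(1) pq unfolding E_def J_def by blast+
      then show ?thesis using Fk unfolding Jfam_def by blast
    next
      case 3
      then have m: "F \<inter> P \<noteq> {}" "F \<inter> Q \<noteq> {}" unfolding B by blast+
      have "F \<inter> E \<noteq> {} \<or> J \<subseteq> F"
      proof (cases "F \<inter> (P \<inter> Q) = {}")
        case True
        obtain u v where uv: "u \<in> F" "u \<in> P" "v \<in> F" "v \<in> Q" using m by blast
        then have "u \<in> P - Q" "v \<in> Q - P" using True by blast+
        then have "u = p" "v = q" unfolding p q by simp_all
        then have "p \<in> F" "q \<in> F" using uv by simp_all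
        then show ?thesis using 3(1) unfolding J_def by blast
      next
        case False
        then show ?thesis unfolding E_def by blast
      qed
      then show ?thesis using Fk 3(1) unfolding Jfam_def by blast
    qed
  qed
  have "card H = card (Jfam X k E J y)" using card_Jfam[OF X E J] eq by linarith
  then have "H = Jfam X k E J y"
    using card_subset_eq[OF finite_subset[OF Jfam_subset_ksets finite_ksets[OF X(1)]] sub] by blast
  then have "iso_fam X H X (Jfam X k E J y)" using iso_fam_refl[of X H] by simp
  moreover have "card J = 2 + 1" using J(2) by simp
  ultimately show ?thesis unfolding is_J_def using E J by blast
qed

lemma is_G_of_subset:
  assumes X: "finite X" "8 < card X" and E: "E \<subseteq> X" "card E = s" "s = 2 \<or> s = 3" and x0: "x0 \<in> X - E"
    and sub: "H \<subseteq> Gfam X 4 E x0" and eq: "int (card H) = hk_bound (card X) 4"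
  shows "is_G X 4 s H"
proof -
  have "card E = 2 \<or> card E = 3" using E(2,3) by simp
  then have "card H = card (Gfam X 4 E x0)" using card_Gfam_4[OF X E(1) _ x0] eq by simp
  then have "H = Gfam X 4 E x0"
    using card_subset_eq[OF finite_subset[OF Gfam_subset_ksets finite_ksets[OF X(1)]] sub] by blast
  then have "iso_fam X H X (Gfam X 4 E x0)" using iso_fam_refl[of X H] by simp
  then show ?thesis unfolding is_G_def using E(1,2) x0 by blast
qed

text \<open>Two stars centred at \<open>z\<close> give \<open>G_2\<close> with
  \<open>E = {y, z}\<close> and \<open>x0 = x\<close>. An edge pair gives \<open>G_3\<close>:
  \<open>E\<close> is the edge plus the cover point whose link contains it, and \<open>x0\<close> is
  the other cover point.\<close>

lemma sporadic_is_G: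
  assumes X: "finite X" "8 < card X" and H: "H \<subseteq> ksets X 4"
    and xy: "x \<in> X" "y \<in> X" "x \<noteq> y" "covered H x y"
    and eq: "int (card H) = hk_bound (card X) 4"
    and sp: "sporadic_pair (X - {x, y}) (link x y H) (link y x H)"
  shows "is_G X 4 2 H \<or> is_G X 4 3 H"
proof -
  let ?V = "X - {x, y}"
  have covyx: "covered H y x" using xy(4) unfolding covered_def by blast
  show ?thesis using sp unfolding sporadic_pair_def
  proof (elim disjE bexE conjE)
    fix z assume z: "z \<in> ?V" and A: "link x y H = {F \<in> ksets ?V 3. z \<in> F}" and B: "link y x H = {F \<in> ksets ?V 3. z \<in> F}"
    have "H \<subseteq> Gfam X 4 {y, z} x"
      by (rule link_common_subset_Gfam[OF H xy(4)]) (simp add: A B)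
    moreover have "{y, z} \<subseteq> X" "card {y, z} = 2" "x \<in> X - {y, z}" using z xy by auto
    ultimately show ?thesis using is_G_of_subset[OF X _ _ _ _ _ eq, of "{y, z}" 2 x] by blast
  next
    fix z w assume zw: "z \<in> ?V" "w \<in> ?V" "z \<noteq> w" and A: "link x y H = {F \<in> ksets ?V 3. {z, w} \<subseteq> F}"
      and B: "link y x H = {F \<in> ksets ?V 3. F \<inter> {z, w} \<noteq> {}}"
    have "H \<subseteq> Gfam X 4 {x, z, w} y"
      by (rule link_edge_subset_Gfam[OF H xy(4)]) (simp_all add: A B)
    moreover have "{x, z, w} \<subseteq> X" "card {x, z, w} = 3" "y \<in> X - {x, z, w}" using zw xy by auto
    ultimately show ?thesis using is_G_of_subset[OF X _ _ _ _ _ eq, of "{x, z, w}" 3 y] by blast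
  next
    fix z w assume zw: "z \<in> ?V" "w \<in> ?V" "z \<noteq> w" and B: "link y x H = {F \<in> ksets ?V 3. {z, w} \<subseteq> F}"
      and A: "link x y H = {F \<in> ksets ?V 3. F \<inter> {z, w} \<noteq> {}}"
    have "H \<subseteq> Gfam X 4 {y, z, w} x"
      by (rule link_edge_subset_Gfam[OF H covyx]) (simp_all add: A B)
    moreover have "{y, z, w} \<subseteq> X" "card {y, z, w} = 3" "x \<in> X - {y, z, w}" using zw xy by auto
    ultimately show ?thesis using is_G_of_subset[OF X _ _ _ _ _ eq, of "{y, z, w}" 3 x] by blast
  qed
qed

text \<open>At most one member avoids \<open>y\<close>: its other points form the only set in the
  link at \<open>x\<close>. Without such a member \<open>H\<close> lies in a star, and with it in
  \<open>F_1\<close>, where intersection with that member is the remaining condition.\<close>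

lemma single_link_in_F1:
  assumes X: "finite X" "3 \<le> k" and H: "H \<subseteq> ksets X k" "intersecting H"
    and xy: "y \<in> X" "x \<noteq> y" "covered H x y" and small: "card (link x y H) \<le> 1"
  shows "(\<exists>G. is_F0 X k G \<and> subS X H X G) \<or> (\<exists>G. is_F1 X k G \<and> subS X H X G)"
proof (cases "\<forall>F\<in>H. y \<in> F")
  case True
  then have "H \<subseteq> star X k y" using H(1) unfolding star_def by blast
  moreover have "is_F0 X k (star X k y)" unfolding is_F0_def using xy(1) iso_fam_refl by blast
  ultimately show ?thesis using subS_subset by blast
next
  case False
  then obtain F where F: "F \<in> H" "y \<notin> F" by blast
  have x: "x \<in> G" if "G \<in> H" "y \<notin> G" for G using xy(3) that unfolding covered_def by blast
  have fin: "finite (link x y H)"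
    using link_ksets(1)[OF X(1) H(1), of x y] finite_ksets[of "X - {x, y}"] X(1) finite_subset by blast
  have uniq: "G = F" if G: "G \<in> H" "y \<notin> G" for G
  proof -
    have "G - {x} \<in> link x y H" "F - {x} \<in> link x y H"
      using mem_link[OF x[OF G] G(2,1)] mem_link[OF x[OF F] F(2,1)] .
    then have "G - {x} = F - {x}" using small fin by (metis card_le_Suc0_iff_eq One_nat_def)
    then show ?thesis using x[OF G] x[OF F] by blast
  qed
  have Fk: "F \<in> ksets X k" using F H(1) by blast
  have "H \<subseteq> F1fam X k F y"
  proof
    fix G assume G: "G \<in> H"
    show "G \<in> F1fam X k F y"
    proof (cases "y \<in> G")
      case True
      have "G \<inter> F \<noteq> {}" using H(2) G F(1) unfolding intersecting_def by blast
      then show ?thesis using True G H(1) unfolding F1fam_def by blast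
    next
      case False
      then show ?thesis using uniq[OF G] unfolding F1fam_def by blast
    qed
  qed
  moreover have "is_F1 X k (F1fam X k F y)"
    unfolding is_F1_def using Fk xy(1) F(2) iso_fam_refl by blast
  ultimately show ?thesis using subS_subset by blast
qed

theorem theorem1p6:
  fixes X :: "'a set" and H :: "'a set set" and k n :: nat
  assumes "k \<ge> 3" and "finite X" and "card X = n" and "n > 2 * k"
    and "H \<subseteq> ksets X k" and "intersecting H"
    and "\<not> (\<exists>G. is_F0 X k G \<and> subS X H X G)"
    and "\<not> (\<exists>G. is_F1 X k G \<and> subS X H X G)"
    and "k = 3 \<longrightarrow> \<not> (\<exists>G. is_G X k 2 G \<and> subS X H X G)"
  shows "int (card H) \<le> int ((n - 1) choose (k - 1)) - int ((n - k - 1) choose (k - 1))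
            - int ((n - k - 2) choose (k - 2)) + 2
    \<and> (int (card H) = int ((n - 1) choose (k - 1)) - int ((n - k - 1) choose (k - 1))
            - int ((n - k - 2) choose (k - 2)) + 2
       \<longleftrightarrow> (if k = 4 then is_J X k 2 H \<or> is_G X k 2 H \<or> is_G X k 3 H
            else is_J X k 2 H))"
proof -
  have X: "finite X" "3 \<le> k" "2 * k < card X" using assms by auto
  note H = assms(5,6)
  let ?ext = "if k = 4 then is_J X k 2 H \<or> is_G X k 2 H \<or> is_G X k 3 H else is_J X k 2 H"
  have J_eq: "int (card H) = hk_bound (card X) k" if hJ: "is_J X k 2 H"
  proof -
    obtain E J x0 where E: "E \<subseteq> X" "card E = k - 1" and J: "J \<subseteq> X - E" "card J = 2 + 1" "x0 \<in> J"
      and iso: "iso_fam X H X (Jfam X k E J x0)"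
      using hJ unfolding is_J_def by (elim exE conjE)
    have J3: "card J = 3" using J(2) by simp
    show ?thesis
      using card_Jfam[OF X E J(1) J3 J(3)] iso_fam_card[OF X(1) H(1) Jfam_subset_ksets iso] by linarith
  qed
  have G_eq: "int (card H) = hk_bound (card X) k" if hG: "k = 4" "is_G X k s H" "s = 2 \<or> s = 3" for s
  proof -
    obtain E x0 where E: "E \<subseteq> X" "card E = s" "x0 \<in> X - E" and iso: "iso_fam X H X (Gfam X k E x0)"
      using hG(2) unfolding is_G_def by (elim exE conjE)
    have "8 < card X" "card E = 2 \<or> card E = 3" using X(3) hG(1,3) E(2) by auto
    then show ?thesis
      using card_Gfam_4[OF X(1) _ E(1) _ E(3)] iso_fam_card[OF X(1) H(1) Gfam_subset_ksets iso] hG(1) by simp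
  qed
  have ext_eq: "int (card H) = hk_bound (card X) k" if ?ext
  proof (cases "k = 4")
    case True
    then have "is_J X k 2 H \<or> is_G X k 2 H \<or> is_G X k 3 H" using that by simp
    then show ?thesis using J_eq G_eq[OF True, of 2] G_eq[OF True, of 3] by blast
  next
    case False
    then show ?thesis using that J_eq by simp
  qed
  have main: "int (card H) \<le> hk_bound (card X) k \<and> (int (card H) = hk_bound (card X) k \<longrightarrow> ?ext)"
  proof (cases "two_cover X H")
    case False
    then show ?thesis using no_two_cover_bound[OF X H] by simp
  next
    case True
    then obtain x y where xy: "x \<in> X" "y \<in> X" "x \<noteq> y" "covered H x y" unfolding two_cover_def by blast
    have covyx: "covered H y x" using xy(4) unfolding covered_def by blast
    have "\<not> card (link x y H) \<le> 1" "\<not> card (link y x H) \<le> 1"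
      using single_link_in_F1[OF X(1,2) H xy(2,3,4)] single_link_in_F1[OF X(1,2) H xy(1) xy(3)[symmetric] covyx]
        assms(7,8) by blast+
    then have two: "2 \<le> card (link x y H)" "2 \<le> card (link y x H)" by simp_all
    \<comment> \<open>A common point \<open>z\<close> of both links would place \<open>H\<close> in
      the family \<open>G_2\<close> with \<open>E = {y, z}\<close> and \<open>x0 = x\<close>,
      excluded for \<open>k = 3\<close>.\<close>
    have nc: "\<not> (\<exists>z. \<forall>e\<in>link x y H \<union> link y x H. z \<in> e)" if k3: "k = 3"
    proof
      assume "\<exists>z. \<forall>e\<in>link x y H \<union> link y x H. z \<in> e"
      then obtain z where z: "\<And>e. e \<in> link x y H \<union> link y x H \<Longrightarrow> z \<in> e" by blast
      have "link x y H \<noteq> {}" using two(1) by auto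
      then obtain e where "e \<in> link x y H" by blast
      then have "z \<in> e" "e \<subseteq> X - {x, y}" using z link_ksets(1)[OF X(1) H(1), of x y] unfolding ksets_def by blast+
      then have "z \<in> X" "z \<noteq> x" "z \<noteq> y" by blast+
      then have "{y, z} \<subseteq> X" "card {y, z} = 2" "x \<in> X - {y, z}" using xy(1,2,3) by auto
      then have "is_G X k 2 (Gfam X k {y, z} x)" unfolding is_G_def using iso_fam_refl by blast
      moreover have "subS X H X (Gfam X k {y, z} x)"
        using subS_subset[OF link_common_subset_Gfam[OF H(1) xy(4) z]] .
      ultimately show False using assms(9) k3 by blast
    qed
    note bound = covered_bound[OF X H xy two nc]
    show ?thesis
    proof (intro conjI impI)
      show "int (card H) \<le> hk_bound (card X) k" by (rule bound(1))
      assume eq: "int (card H) = hk_bound (card X) k"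
      have yx: "X - {x, y} = X - {y, x}" by blast
      have "tight_pair (X - {x, y}) (k - 1) (link x y H) (link y x H) \<or>
          tight_pair (X - {x, y}) (k - 1) (link y x H) (link x y H) \<or>
          k = 4 \<and> sporadic_pair (X - {x, y}) (link x y H) (link y x H)"
        using bound(2)[OF _ eq] by blast
      then show ?ext
      proof (elim disjE conjE)
        assume "tight_pair (X - {x, y}) (k - 1) (link x y H) (link y x H)"
        then have "is_J X k 2 H" by (rule tight_pair_is_J[OF X H(1) xy eq])
        then show ?ext by auto
      next
        assume "tight_pair (X - {x, y}) (k - 1) (link y x H) (link x y H)"
        then have "is_J X k 2 H"
          unfolding yx by (rule tight_pair_is_J[OF X H(1) xy(2,1) xy(3)[symmetric] covyx eq])
        then show ?ext by auto
      next
        assume k4: "k = 4" and sp: "sporadic_pair (X - {x, y}) (link x y H) (link y x H)"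
        have "8 < card X" using X(3) k4 by simp
        then have "is_G X 4 2 H \<or> is_G X 4 3 H"
          using sporadic_is_G[OF X(1) _ H(1)[unfolded k4] xy eq[unfolded k4] sp] by blast
        then show ?ext using k4 by simp
      qed
    qed
  qed
  have "int (card H) \<le> hk_bound (card X) k \<and> (int (card H) = hk_bound (card X) k \<longleftrightarrow> ?ext)"
    using main ext_eq by blast
  then show ?thesis unfolding hk_bound_def assms(3) .
qed

end
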